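(* Let $\alpha\ge0$ and fix $v>0$. There exists a solution $E^*\in\mathcal{A}^x(v)\cap\mathcal{S}_x\cap\mathcal{S}_y^*$, bounded and $x$-transformed-convex, to the minimal partition problem $$\inf\{\mathcal{P}_\alpha^x(E) : E\in\mathcal{A}^x(v)\}.$$ Moreover, there exist $r\in\,]0,+\infty[$ and $f\in C([0,r])\cap\mathrm{Lip}_{loc}(]0,r[)$ such that $$E^*=\{(x,y)\in\mathbb{R}^2 : |y|\le f(|x|),\ |x|\le r\}.$$
   Context: For $\alpha\ge0$ and an $\mathcal{L}^2$-measurable set $E\subset\mathbb{R}^2$, the Grushin $\alpha$-perimeter is $$P_\alpha(E)=\sup\left\{\int_E(\partial_x\phi_1+|x|^\alpha\partial_y\phi_2)\,dx\,dy : \phi_1,\phi_2\in C^1_c(\mathbb{R}^2),\ \sup_{\mathbb{R}^2}\sqrt{\phi_1^2+\phi_2^2}\le1\right\}.$$ Set $E^{+x}=E\cap\{x>0\}$, $E^{-x}=E\cap\{x<0\}$. For $v>0$, $\mathcal{A}^x(v)$ is the class of $\mathcal{L}^2$-measurable $E\subset\mathbb{R}^2$ with $\mathcal{L}^2(E^{+x})=\mathcal{L}^2(E^{-x})=v$, and $\mathcal{P}_\alpha^x(E)=\frac12(P_\alpha(E^{+x})+P_\alpha(E^{-x})+P_\alpha(E))$. Sets are considered up to $\mathcal{L}^2$-negligible sets. $\mathcal{S}_x$ is the class of $\mathcal{L}^2$-measurable $x$-symmetric sets ($(x,y)\in E$ implies $(-x,y)\in E$). $\mathcal{S}_y^*$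 is the class of $\mathcal{L}^2$-measurable $y$-Schwarz symmetric sets, i.e. $y$-symmetric ($(x,y)\in E$ implies $(x,-y)\in E$) and $y$-convex (for each $t$ the section $\{y:(t,y)\in E\}$ is a, possibly empty, open interval). A set $E\in\mathcal{S}_x$ is $x$-transformed-convex if $\Psi(E^{+x})$ is convex, where $\Psi(x,y)=\left(\operatorname{sgn}(x)\frac{|x|^{\alpha+1}}{\alpha+1},\,y\right)$. *)

theory Defs
  imports "HOL-Analysis.Analysis"
begin

definition test_functions :: "(real \<times> real \<Rightarrow> real) set" where
  "test_functions = {\<phi>. (\<exists>D :: real \<times> real \<Rightarrow> (real \<times> real) \<Rightarrow>\<^sub>L real.
      (\<forall>z. (\<phi> has_derivative blinfun_apply (D z)) (at z)) \<and> continuous_on UNIV D)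
    \<and> compact (closure {z. \<phi> z \<noteq> 0})}"

definition partial_x :: "(real \<times> real \<Rightarrow> real) \<Rightarrow> real \<times> real \<Rightarrow> real" where
  "partial_x \<phi> = (\<lambda>(x, y). deriv (\<lambda>t. \<phi> (t, y)) x)"

definition partial_y :: "(real \<times> real \<Rightarrow> real) \<Rightarrow> real \<times> real \<Rightarrow> real" where
  "partial_y \<phi> = (\<lambda>(x, y). deriv (\<lambda>t. \<phi> (x, t)) y)"

text \<open>The case split is needed because \<open>0 powr 0 = 0\<close>, whereas \<open>\<bar>x\<bar>\<close> to the power 0 is
  to be identically 1.\<close>

definition grushin_weight :: "real \<Rightarrow> real \<Rightarrow> real" where
  "grushin_weight \<alpha> x = (if \<alpha> = 0 then 1 else \<bar>x\<bar> powr \<alpha>)"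

definition grushin_div ::
    "real \<Rightarrow> (real \<times> real \<Rightarrow> real) \<Rightarrow> (real \<times> real \<Rightarrow> real) \<Rightarrow> real \<times> real \<Rightarrow> real" where
  "grushin_div \<alpha> \<phi>\<^sub>1 \<phi>\<^sub>2 = (\<lambda>z. partial_x \<phi>\<^sub>1 z + grushin_weight \<alpha> (fst z) * partial_y \<phi>\<^sub>2 z)"

definition grushin_perimeter :: "real \<Rightarrow> (real \<times> real) set \<Rightarrow> ereal" where
  "grushin_perimeter \<alpha> E =
     Sup {ereal (set_lebesgue_integral lebesgue E (grushin_div \<alpha> \<phi>\<^sub>1 \<phi>\<^sub>2)) | \<phi>\<^sub>1 \<phi>\<^sub>2.
       \<phi>\<^sub>1 \<in> test_functions \<and> \<phi>\<^sub>2 \<in> test_functions \<and>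
       (\<forall>z. sqrt ((\<phi>\<^sub>1 z)\<^sup>2 + (\<phi>\<^sub>2 z)\<^sup>2) \<le> 1)}"

definition pos_x :: "(real \<times> real) set \<Rightarrow> (real \<times> real) set" where
  "pos_x E = E \<inter> {(x, y). x > 0}"

definition neg_x :: "(real \<times> real) set \<Rightarrow> (real \<times> real) set" where
  "neg_x E = E \<inter> {(x, y). x < 0}"

definition partition_class :: "real \<Rightarrow> (real \<times> real) set set" where
  "partition_class v = {E \<in> sets lebesgue.
     emeasure lebesgue (pos_x E) = ennreal v \<and> emeasure lebesgue (neg_x E) = ennreal v}"

definition partition_perimeter :: "real \<Rightarrow> (real \<times> real) set \<Rightarrow> ereal" where
  "partition_perimeter \<alpha> E =
     1/2 * (grushin_perimeter \<alpha> (pos_x E) + grushin_perimeter \<alpha> (neg_x E) + grushin_perimeter \<alpha> E)"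

definition x_symmetric_sets :: "(real \<times> real) set set" where
  "x_symmetric_sets = {E \<in> sets lebesgue. \<forall>x y. (x, y) \<in> E \<longrightarrow> (- x, y) \<in> E}"

definition y_schwarz_symmetric_sets :: "(real \<times> real) set set" where
  "y_schwarz_symmetric_sets = {E \<in> sets lebesgue.
     (\<forall>x y. (x, y) \<in> E \<longrightarrow> (x, - y) \<in> E) \<and>
     (\<forall>t. open {y. (t, y) \<in> E} \<and> is_interval {y. (t, y) \<in> E})}"

definition Psi :: "real \<Rightarrow> real \<times> real \<Rightarrow> real \<times> real" where
  "Psi \<alpha> = (\<lambda>(x, y). (sgn x * (\<bar>x\<bar> powr (\<alpha> + 1) / (\<alpha> + 1)), y))"

definition x_transformed_convex :: "real \<Rightarrow> (real \<times> real) set \<Rightarrow> bool" where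
  "x_transformed_convex \<alpha> E \<longleftrightarrow> E \<in> x_symmetric_sets \<and> convex (Psi \<alpha> ` pos_x E)"

definition locally_lipschitz_on :: "real set \<Rightarrow> (real \<Rightarrow> real) \<Rightarrow> bool" where
  "locally_lipschitz_on S f \<longleftrightarrow> (\<forall>K. compact K \<and> K \<subseteq> S \<longrightarrow> (\<exists>L. L-lipschitz_on K f))"

text \<open>The vertical sections of a \<open>y\<close>-Schwarz symmetric set are open, those of a closed subgraph
  are closed, so the two can only coincide up to Lebesgue-negligible sets.\<close>

definition eq_up_to_null :: "(real \<times> real) set \<Rightarrow> (real \<times> real) set \<Rightarrow> bool" where
  "eq_up_to_null E F \<longleftrightarrow> sym_diff E F \<in> null_sets lebesgue"

end

theory Submission
  imports Defs
begin

text \<open>The minimiser is written down explicitly and a calibration shows that it is optimal. In the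
  coordinates of \<open>Psi\<close> the perimeter is Euclidean and the area has density \<open>1 / w\<close>, with
  \<open>w = \<bar>x\<bar>\<^sup>\<alpha>\<close>. Stationarity makes the sine of the angle of the boundary curve an affine function of
  \<open>x\<close>, and on the line \<open>x = 0\<close> it meets its mirror image and the line at 120 degrees; hence the sine is
  \<open>1 / 2 - 3 x / (2 r)\<close>, where \<open>r\<close> is the width of the set. The divergence theorem gives the value
  \<open>3 v / (2 r) + 2 \<kappa> r\<^bsup>\<alpha> + 1\<^esup>\<close> for each of the two chambers.

  Conversely, let \<open>G\<close> be one chamber of a competitor. A test field with first component minus this
  sine, evaluated at a point \<open>\<theta> x\<close> of the rescaled profile, and second component plus or minus the
  cosine, with the sign switching inside \<open>G\<close> on each vertical line that meets \<open>G\<close>, bounds the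
  perimeter from below. If \<open>\<theta>\<close> skips the vertical lines missing \<open>G\<close>, the bound is again
  \<open>3 v / (2 \<rho>) + 2 \<kappa> \<rho>\<^bsup>\<alpha> + 1\<^esup>\<close> for some \<open>\<rho>\<close>, because the area density decreases in \<open>x\<close>; minimising over
  \<open>\<rho>\<close> recovers the value at the minimiser. No symmetrisation of \<open>G\<close> is needed.\<close>

section \<open>Continuously differentiable functions of two variables\<close>

text \<open>The factor 1/2 in front of the three perimeters counts every curved arc once and the
  common segment on \<open>x = 0\<close> once. So a chamber is tested by two fields with the same
  second component: one for its own perimeter, one that vanishes on the line and, glued to a
  mirrored field on the other side, serves the perimeter of the whole set. Only their mean enters
  the estimate. If the mean has first component minus the sine, the first field must double the sine
  on the line, which is admissible because the sine is 1/2 there. The coefficient 3 / 2 makes the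
  sine fall to -1 at \<open>x = r\<close>, where the curve closes up on the axis
  \<open>y = 0\<close> with a vertical tangent. The obstacle is regularity: fields must be of class
  C1, \<open>G\<close> is only measurable, and the cosine is not differentiable where it vanishes.
  Hence the indicator of \<open>G\<close> is replaced by a C1 function, the sign switch by its
  vertical primitive divided by a regularised section length, and the sine is shrunk by a factor
  below 1. The errors are bounded through a parameter \<open>e\<close>, which tends to 0 with the
  competitor fixed.\<close>

definition C1 :: "(real \<times> real \<Rightarrow> real) \<Rightarrow> (real \<times> real \<Rightarrow> real) \<Rightarrow> (real \<times> real \<Rightarrow> real) \<Rightarrow> bool" where
  "C1 \<phi> g h \<longleftrightarrow> continuous_on UNIV g \<and> continuous_on UNIV h \<and>
     (\<forall>z. (\<phi> has_derivative (\<lambda>d. g z * fst d + h z * snd d)) (at z))"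

lemma C1_continuous: "C1 \<phi> g h \<Longrightarrow> continuous_on S \<phi>"
  unfolding C1_def by (meson continuous_at_imp_continuous_on has_derivative_continuous)

lemma C1_continuous_x: "C1 \<phi> g h \<Longrightarrow> continuous_on S g"
  unfolding C1_def by (meson continuous_on_subset subset_UNIV)

lemma C1_continuous_y: "C1 \<phi> g h \<Longrightarrow> continuous_on S h"
  unfolding C1_def by (meson continuous_on_subset subset_UNIV)

lemma C1_chain:
  assumes "C1 \<phi> g h" "(u has_real_derivative u') (at t within S)" "(v has_real_derivative v') (at t within S)"
  shows "((\<lambda>t. \<phi> (u t, v t)) has_real_derivative g (u t, v t) * u' + h (u t, v t) * v') (at t within S)"
proof -
  have 1: "(\<phi> has_derivative (\<lambda>d. g (u t, v t) * fst d + h (u t, v t) * snd d)) (at (u t, v t))"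
    using assms(1) by (auto simp: C1_def)
  have 2: "((\<lambda>t. (u t, v t)) has_derivative (\<lambda>s. (u' * s, v' * s))) (at t within S)"
    using assms(2,3) by (auto simp: has_field_derivative_def intro!: has_derivative_Pair)
  have "(\<lambda>s. g (u t, v t) * fst (u' * s, v' * s) + h (u t, v t) * snd (u' * s, v' * s))
      = (*) (g (u t, v t) * u' + h (u t, v t) * v')"
    by (auto simp: fun_eq_iff algebra_simps)
  thus ?thesis
    using has_derivative_compose[OF 2 1] by (simp add: has_field_derivative_def)
qed

lemma C1_DERIV_x: "C1 \<phi> g h \<Longrightarrow> ((\<lambda>x. \<phi> (x, y)) has_real_derivative g (x, y)) (at x within S)"
  using C1_chain[of \<phi> g h "\<lambda>x. x" 1 x S "\<lambda>_. y" 0] by simp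

lemma C1_DERIV_y: "C1 \<phi> g h \<Longrightarrow> ((\<lambda>y. \<phi> (x, y)) has_real_derivative h (x, y)) (at y within S)"
  using C1_chain[of \<phi> g h "\<lambda>_. x" 0 y S "\<lambda>y. y" 1] by simp

text \<open>\<open>partial_x\<close> is defined through \<open>deriv\<close> and hard to compute
  with. Carrying the partials as arguments of \<open>C1\<close> lets the rules for sums, products
  and compositions produce them; this lemma then feeds them into \<open>grushin_div\<close>.\<close>

lemma C1_partial_x: "C1 \<phi> g h \<Longrightarrow> partial_x \<phi> = g"
  by (auto simp: partial_x_def fun_eq_iff intro!: DERIV_imp_deriv C1_DERIV_x)

lemma C1_partial_y: "C1 \<phi> g h \<Longrightarrow> partial_y \<phi> = h"
  by (auto simp: partial_y_def fun_eq_iff intro!: DERIV_imp_deriv C1_DERIV_y)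

lemma test_functionsI:
  assumes "C1 \<phi> g h" "\<And>z. z \<notin> S \<Longrightarrow> \<phi> z = 0" "bounded S"
  shows "\<phi> \<in> test_functions"
proof -
  define D where "D = (\<lambda>z. g z *\<^sub>R Blinfun fst + h z *\<^sub>R Blinfun (snd :: real \<times> real \<Rightarrow> real))"
  have "blinfun_apply (D z) = (\<lambda>d. g z * fst d + h z * snd d)" for z
    by (auto simp: D_def blinfun.add_left blinfun.scaleR_left bounded_linear_Blinfun_apply
        bounded_linear_fst bounded_linear_snd fun_eq_iff)
  moreover have "continuous_on UNIV D"
    unfolding D_def using assms(1) by (auto simp: C1_def intro!: continuous_intros)
  moreover have "compact (closure {z. \<phi> z \<noteq> 0})"
    using assms(2,3) by (metis (mono_tags, lifting) bounded_subset compact_closure mem_Collect_eq subsetI)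
  ultimately show ?thesis
    using assms(1) unfolding test_functions_def C1_def mem_Collect_eq
    by (intro conjI exI[of _ D]) auto
qed

lemma test_functionsI_box:
  assumes "C1 \<phi> g h" "\<And>x y. \<bar>x\<bar> \<ge> R \<or> \<bar>y\<bar> \<ge> R \<Longrightarrow> \<phi> (x, y) = 0"
  shows "\<phi> \<in> test_functions"
proof (rule test_functionsI[OF assms(1)])
  fix z assume "z \<notin> cbox (- R, - R) (R, R)"
  hence "\<bar>fst z\<bar> \<ge> R \<or> \<bar>snd z\<bar> \<ge> R" by (cases z) (auto simp: cbox_Pair_eq)
  thus "\<phi> z = 0" using assms(2)[of "fst z" "snd z"] by simp
qed (rule bounded_cbox)

lemma test_functionsE:
  assumes "\<phi> \<in> test_functions"
  obtains R where "C1 \<phi> (partial_x \<phi>) (partial_y \<phi>)"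
    "R > 0" "\<And>x y. \<bar>x\<bar> \<ge> R \<or> \<bar>y\<bar> \<ge> R \<Longrightarrow> \<phi> (x, y) = 0"
proof -
  obtain D where D: "\<And>z. (\<phi> has_derivative blinfun_apply (D z)) (at z)" "continuous_on UNIV D"
    and c: "compact (closure {z. \<phi> z \<noteq> 0})"
    using assms by (auto simp: test_functions_def)
  have eq: "blinfun_apply (D z) = (\<lambda>d. D z (1, 0) * fst d + D z (0, 1) * snd d)" for z
  proof
    fix d :: "real \<times> real"
    have "D z d = D z (fst d *\<^sub>R (1, 0) + snd d *\<^sub>R (0, 1))" by simp
    also have "\<dots> = D z (1, 0) * fst d + D z (0, 1) * snd d"
      by (simp only: blinfun.add_right blinfun.scaleR_right) simp
    finally show "D z d = D z (1, 0) * fst d + D z (0, 1) * snd d" .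
  qed
  have "C1 \<phi> (\<lambda>z. D z (1, 0)) (\<lambda>z. D z (0, 1))"
    unfolding C1_def using D eq by (auto intro!: continuous_intros)
  hence 1: "C1 \<phi> (partial_x \<phi>) (partial_y \<phi>)"
    using C1_partial_x C1_partial_y by metis
  from c have "bounded {z. \<phi> z \<noteq> 0}" by (simp add: bounded_subset closure_subset compact_imp_bounded)
  then obtain R where R: "R > 0" "\<And>z. \<phi> z \<noteq> 0 \<Longrightarrow> norm z \<le> R"
    by (auto simp: bounded_pos)
  have "\<phi> (x, y) = 0" if "\<bar>x\<bar> \<ge> R + 1 \<or> \<bar>y\<bar> \<ge> R + 1" for x y
  proof (rule ccontr)
    assume "\<phi> (x, y) \<noteq> 0"
    from R(2)[OF this] show False using norm_fst_le[of x y] norm_snd_le[of y x] that by auto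
  qed
  with 1 R(1) show ?thesis by (intro that[of "R + 1"]) auto
qed

lemma C1_add: "C1 \<phi> g h \<Longrightarrow> C1 \<psi> g' h' \<Longrightarrow> C1 (\<lambda>z. \<phi> z + \<psi> z) (\<lambda>z. g z + g' z) (\<lambda>z. h z + h' z)"
  unfolding C1_def
  by (auto intro!: continuous_intros derivative_eq_intros simp: algebra_simps)

lemma C1_cmult: "C1 \<phi> g h \<Longrightarrow> C1 (\<lambda>z. c * \<phi> z) (\<lambda>z. c * g z) (\<lambda>z. c * h z)"
  unfolding C1_def
  by (auto intro!: continuous_intros derivative_eq_intros simp: algebra_simps)

lemma C1_mult:
  assumes "C1 \<phi> g h" "C1 \<psi> g' h'"
  shows "C1 (\<lambda>z. \<phi> z * \<psi> z) (\<lambda>z. g z * \<psi> z + \<phi> z * g' z) (\<lambda>z. h z * \<psi> z + \<phi> z * h' z)"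
  using assms C1_continuous[OF assms(1), of UNIV] C1_continuous[OF assms(2), of UNIV] unfolding C1_def
  by (auto intro!: continuous_intros derivative_eq_intros simp: algebra_simps)

lemma C1_sum:
  assumes "finite I" "\<And>i. i \<in> I \<Longrightarrow> C1 (\<phi> i) (g i) (h i)"
  shows "C1 (\<lambda>z. \<Sum>i\<in>I. \<phi> i z) (\<lambda>z. \<Sum>i\<in>I. g i z) (\<lambda>z. \<Sum>i\<in>I. h i z)"
  using assms
proof (induction rule: finite_induct)
  case empty
  show ?case by (simp add: C1_def)
next
  case (insert i I)
  then show ?case by (auto intro!: C1_add)
qed

lemma C1_compose:
  assumes "C1 \<phi> g h" "\<And>t. (F has_real_derivative F' t) (at t)" "continuous_on UNIV F'"
  shows "C1 (\<lambda>z. F (\<phi> z)) (\<lambda>z. F' (\<phi> z) * g z) (\<lambda>z. F' (\<phi> z) * h z)"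
proof -
  have c: "continuous_on UNIV (\<lambda>z. F' (\<phi> z))"
    by (rule continuous_on_compose2[OF assms(3) C1_continuous[OF assms(1)]]) auto
  have "((\<lambda>z. F (\<phi> z)) has_derivative (\<lambda>d. F' (\<phi> z) * g z * fst d + F' (\<phi> z) * h z * snd d)) (at z)" for z
  proof -
    have 1: "(\<phi> has_derivative (\<lambda>d. g z * fst d + h z * snd d)) (at z)"
      using assms(1) unfolding C1_def by blast
    have 2: "(F has_derivative (\<lambda>t. F' (\<phi> z) * t)) (at (\<phi> z))"
      using assms(2) by (simp add: has_field_derivative_def)
    show ?thesis
      using has_derivative_compose[OF 1 2] by (simp add: algebra_simps)
  qed
  with c assms(1) show ?thesis by (auto simp: C1_def intro!: continuous_intros)
qed

lemma C1_fst:
  assumes "\<And>t. (F has_real_derivative F' t) (at t)" "continuous_on UNIV F'"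
  shows "C1 (\<lambda>z. F (fst z)) (\<lambda>z. F' (fst z)) (\<lambda>z. 0)"
proof -
  have "C1 fst (\<lambda>_. 1) (\<lambda>_. 0)"
    by (auto simp: C1_def intro!: derivative_eq_intros)
  from C1_compose[OF this assms] show ?thesis by simp
qed

lemma C1_snd:
  assumes "\<And>t. (F has_real_derivative F' t) (at t)" "continuous_on UNIV F'"
  shows "C1 (\<lambda>z. F (snd z)) (\<lambda>z. 0) (\<lambda>z. F' (snd z))"
proof -
  have "C1 snd (\<lambda>_. 0) (\<lambda>_. 1)"
    by (auto simp: C1_def intro!: derivative_eq_intros)
  from C1_compose[OF this assms] show ?thesis by simp
qed

lemma C1_reflect:
  assumes "C1 \<phi> g h"
  shows "C1 (\<lambda>z. \<phi> (- fst z, snd z)) (\<lambda>z. - g (- fst z, snd z)) (\<lambda>z. h (- fst z, snd z))"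
proof -
  have c: "continuous_on UNIV (\<lambda>z :: real \<times> real. (- fst z, snd z))"
    by (intro continuous_intros)
  have "continuous_on UNIV (\<lambda>z. k (- fst z, snd z))" if "continuous_on UNIV k" for k :: "real \<times> real \<Rightarrow> real"
    by (rule continuous_on_compose2[OF that c]) auto
  moreover have "((\<lambda>z. \<phi> (- fst z, snd z)) has_derivative
      (\<lambda>d. - g (- fst z, snd z) * fst d + h (- fst z, snd z) * snd d)) (at z)" for z
  proof -
    have 1: "((\<lambda>z :: real \<times> real. (- fst z, snd z)) has_derivative (\<lambda>d. (- fst d, snd d))) (at z)"
      by (auto intro!: derivative_eq_intros)
    have 2: "(\<phi> has_derivative (\<lambda>d. g (- fst z, snd z) * fst d + h (- fst z, snd z) * snd d))
        (at (- fst z, snd z))"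
      using assms unfolding C1_def by blast
    show ?thesis
      using has_derivative_compose[OF 1 2] by simp
  qed
  ultimately show ?thesis
    using assms by (auto simp: C1_def intro!: continuous_intros)
qed

section \<open>Primitives in the vertical variable\<close>

text \<open>Continuous partials give Frechet differentiability. This serves functions defined by
  parametric integrals, which are known only through their two partials.\<close>

lemma C1I_partials:
  assumes "\<And>x y. ((\<lambda>x. \<phi> (x, y)) has_real_derivative g (x, y)) (at x)"
    and "\<And>x y. ((\<lambda>y. \<phi> (x, y)) has_real_derivative h (x, y)) (at y)"
    and "continuous_on UNIV g" "continuous_on UNIV h"
  shows "C1 \<phi> g h"
  unfolding C1_def
proof (intro conjI allI assms(3,4))
  fix z :: "real \<times> real"
  obtain x y where z: "z = (x, y)" by (cases z)
  have hc: "continuous (at (x, y) within UNIV \<times> UNIV) (\<lambda>(x, y). blinfun_mult_right (h (x, y)))"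
  proof -
    have "continuous_on UNIV (\<lambda>z. blinfun_mult_right (h z))"
      using assms(4) by (intro continuous_intros)
    thus ?thesis by (simp add: continuous_on_eq_continuous_within case_prod_unfold)
  qed
  have "((\<lambda>(x, y). \<phi> (x, y)) has_derivative
      (\<lambda>(tx, ty). g (x, y) * tx + blinfun_mult_right (h (x, y)) ty)) (at (x, y) within UNIV \<times> UNIV)"
    by (rule has_derivative_partialsI[where f = "\<lambda>x y. \<phi> (x, y)" and fx = "(*) (g (x, y))"])
      (use assms(1,2) hc in \<open>auto simp: has_field_derivative_def\<close>)
  thus "(\<phi> has_derivative (\<lambda>d. g z * fst d + h z * snd d)) (at z)"
    by (simp add: z case_prod_unfold)
qed

text \<open>Writing the antiderivative in \<open>y\<close> as an integral over the fixed interval \<open>{0..1}\<close> avoids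
  orientation issues for negative \<open>y\<close> and keeps the parametric integral theorems applicable.\<close>

lemma C1_antiderivative_y:
  assumes "C1 \<phi> g h"
  defines "Q \<equiv> \<lambda>z. integral {0..1} (\<lambda>t. snd z * \<phi> (fst z, t * snd z))"
  shows "C1 Q (\<lambda>z. integral {0..1} (\<lambda>t. snd z * g (fst z, t * snd z))) \<phi>"
proof (rule C1I_partials)
  note cont = continuous_on_compose2[OF C1_continuous[OF assms(1), of UNIV]]
    continuous_on_compose2[OF C1_continuous_x[OF assms(1), of UNIV]]
    continuous_on_compose2[OF C1_continuous_y[OF assms(1), of UNIV]]
  note [continuous_intros] = cont
  show "continuous_on UNIV \<phi>" by (rule C1_continuous[OF assms(1)])
  show "continuous_on UNIV (\<lambda>z. integral {0..1} (\<lambda>t. snd z * g (fst z, t * snd z)))"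
  proof -
    have "continuous_on (UNIV \<times> cbox 0 1) (\<lambda>(z, t). snd z * g (fst z, t * snd z))"
      unfolding case_prod_unfold by (intro continuous_intros) auto
    from integral_continuous_on_param[OF this] show ?thesis by simp
  qed
  fix x y :: real
  show "((\<lambda>x. Q (x, y)) has_real_derivative
      integral {0..1} (\<lambda>t. snd (x, y) * g (fst (x, y), t * snd (x, y)))) (at x)"
  proof -
    have "continuous_on (UNIV \<times> cbox 0 1) (\<lambda>(x, t). y * g (x, t * y))"
      unfolding case_prod_unfold by (intro continuous_intros) auto
    moreover have "(\<lambda>t. y * \<phi> (x, t * y)) integrable_on cbox 0 1" for x
      by (intro integrable_continuous continuous_intros) auto
    moreover have "((\<lambda>x. y * \<phi> (x, t * y)) has_real_derivative y * g (x, t * y)) (at x)" for x t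
      by (intro DERIV_cmult C1_DERIV_x[OF assms(1)])
    ultimately show ?thesis
      unfolding Q_def
      using leibniz_rule_field_derivative[of UNIV 0 1 "\<lambda>x t. y * \<phi> (x, t * y)" "\<lambda>x t. y * g (x, t * y)" x]
      by simp
  qed
  have d: "((\<lambda>y. y * \<phi> (x, t * y)) has_real_derivative \<phi> (x, t * y) + t * (y * h (x, t * y))) (at y)" for y t
    by (rule derivative_eq_intros C1_chain[OF assms(1)] refl | simp)+
  \<comment> \<open>The integrand that arises by differentiating under the integral sign is the
    \<open>t\<close>-derivative of \<open>t * \<phi> (x, t * y)\<close>, so it integrates to the
    boundary value \<open>\<phi> (x, y)\<close>.\<close>
  have i: "((\<lambda>t. \<phi> (x, t * y) + t * (y * h (x, t * y))) has_integral (1 * \<phi> (x, 1 * y) - 0 * \<phi> (x, 0 * y))) {0..1}"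
    by (intro fundamental_theorem_of_calculus, simp, unfold has_real_derivative_iff_has_vector_derivative[symmetric])
      (rule derivative_eq_intros C1_chain[OF assms(1)] refl | simp)+
  show "((\<lambda>y. Q (x, y)) has_real_derivative \<phi> (x, y)) (at y)"
  proof -
    have "continuous_on (UNIV \<times> cbox 0 1) (\<lambda>(y, t). \<phi> (x, t * y) + t * (y * h (x, t * y)))"
      unfolding case_prod_unfold by (intro continuous_intros) auto
    moreover have "(\<lambda>t. y * \<phi> (x, t * y)) integrable_on cbox 0 1" for y
      by (intro integrable_continuous continuous_intros) auto
    ultimately show ?thesis
      unfolding Q_def
      using leibniz_rule_field_derivative[of UNIV 0 1 "\<lambda>y t. y * \<phi> (x, t * y)"
          "\<lambda>y t. \<phi> (x, t * y) + t * (y * h (x, t * y))" y] i[THEN integral_unique] d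
      by simp
  qed
qed

lemma global_antiderivative:
  fixes f :: "real \<Rightarrow> real"
  assumes "continuous_on UNIV f"
  obtains F where "\<And>x. (F has_real_derivative f x) (at x)"
proof -
  have "\<exists>F. \<forall>x::real. - \<infinity> < ereal x \<longrightarrow> ereal x < \<infinity> \<longrightarrow> (F has_vector_derivative f x) (at x)"
    by (rule einterval_antiderivative) (use assms in \<open>auto simp: continuous_on_eq_continuous_at\<close>)
  thus ?thesis using that by (auto simp: has_real_derivative_iff_has_vector_derivative)
qed

lemma integral_rescale:
  fixes g :: "real \<Rightarrow> real"
  assumes "\<And>x. (G has_real_derivative g x) (at x)"
  shows "integral {0..1} (\<lambda>t. y * g (t * y)) = G y - G 0"
proof -
  have "((\<lambda>t. G (t * y)) has_real_derivative y * g (t * y)) (at t within S)" for t S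
  proof -
    have "((\<lambda>t. t * y) has_real_derivative y) (at t within S)"
      by (auto intro!: derivative_eq_intros)
    from DERIV_chain2[OF assms this] show ?thesis by (simp add: mult.commute)
  qed
  hence "((\<lambda>t. y * g (t * y)) has_integral G (1 * y) - G (0 * y)) {0..1}"
    by (intro fundamental_theorem_of_calculus) (auto simp flip: has_real_derivative_iff_has_vector_derivative)
  thus ?thesis by (simp only: integral_unique mult_1 mult_zero_left)
qed

text \<open>Turns the fixed-interval primitive, evaluated at the two ends of a vertical section of
  half-length \<open>f\<close>, into the ordinary integral over that section.\<close>

lemma integral_rescale_symmetric:
  fixes g :: "real \<Rightarrow> real"
  assumes "continuous_on UNIV g" "f \<ge> 0"
  shows "integral {0..1} (\<lambda>t. f * g (t * f)) - integral {0..1} (\<lambda>t. (- f) * g (t * (- f))) = integral {- f..f} g"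
proof -
  obtain G where G: "\<And>x. (G has_real_derivative g x) (at x)"
    using global_antiderivative[OF assms(1)] by blast
  have "(g has_integral G f - G (- f)) {- f..f}"
    using assms(2) G
    by (intro fundamental_theorem_of_calculus)
      (auto simp: has_real_derivative_iff_has_vector_derivative[symmetric] intro: has_field_derivative_at_within)
  thus ?thesis
    unfolding integral_rescale[OF G] by (simp add: integral_unique)
qed

section \<open>Steps, cutoffs and bumps of class C1\<close>

text \<open>The square of the positive part is already C1. The quotient
  \<open>m t / (m t + m (1 - t))\<close> is exactly 0 and 1 beyond the two ends of the unit
  interval, and its denominator never vanishes.\<close>

lemma smooth_step:
  obtains s s' :: "real \<Rightarrow> real" and c where "\<And>t. (s has_real_derivative s' t) (at t)" "continuous_on UNIV s'"
    "\<And>t. 0 \<le> s t" "\<And>t. s t \<le> 1" "\<And>t. t \<le> 0 \<Longrightarrow> s t = 0" "\<And>t. t \<ge> 1 \<Longrightarrow> s t = 1" "\<And>t. \<bar>s' t\<bar> \<le> c"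
    "\<And>t. 0 < t \<Longrightarrow> 0 < s t" "c > 0"
proof -
  define m where "m = (\<lambda>t::real. (max 0 t)\<^sup>2)"
  have m': "(m has_real_derivative 2 * max 0 t) (at t)" for t
  proof -
    consider "t < 0" | "t > 0" | "t = 0" by linarith
    thus ?thesis
    proof cases
      case 1
      have "((\<lambda>_. 0) has_real_derivative 0) (at t)" by simp
      hence "(m has_real_derivative 0) (at t)"
        by (rule has_field_derivative_transform_within_open[of _ _ _ "{..<0}"]) (use 1 in \<open>auto simp: m_def\<close>)
      thus ?thesis using 1 by simp
    next
      case 2
      have "((\<lambda>t. t\<^sup>2) has_real_derivative 2 * t) (at t)" by (auto intro!: derivative_eq_intros)
      hence "(m has_real_derivative 2 * t) (at t)"
        by (rule has_field_derivative_transform_within_open[of _ _ _ "{0<..}"]) (use 2 in \<open>auto simp: m_def\<close>)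
      thus ?thesis using 2 by simp
    next
      case 3
      have "((\<lambda>h. max 0 h * (max 0 h / h)) \<longlongrightarrow> 0) (at (0::real))"
      proof (rule Lim_null_comparison)
        show "\<forall>\<^sub>F h in at 0. norm (max 0 h * (max 0 h / h)) \<le> \<bar>h\<bar>"
          by (rule always_eventually) (auto simp: max_def)
        show "((\<lambda>h::real. \<bar>h\<bar>) \<longlongrightarrow> 0) (at 0)" by (intro tendsto_rabs_zero tendsto_ident_at)
      qed
      thus ?thesis using 3 by (simp add: has_field_derivative_iff m_def power2_eq_square)
    qed
  qed
  have pos: "m t + m (1 - t) > 0" for t
    by (cases "t > 0") (auto simp: m_def max_def add_pos_nonneg)
  define s where "s = (\<lambda>t. m t / (m t + m (1 - t)))"
  define s' where "s' = (\<lambda>t. (2 * max 0 t * (m t + m (1 - t)) - m t * (2 * max 0 t - 2 * max 0 (1 - t)))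
      / (m t + m (1 - t))\<^sup>2)"
  have d: "(s has_real_derivative s' t) (at t)" for t
    unfolding s_def s'_def using pos[of t]
    by (auto intro!: derivative_eq_intros m' DERIV_chain2[OF m'] simp: power2_eq_square)
  have mc: "continuous_on UNIV m" unfolding m_def by (intro continuous_intros)
  have mc': "continuous_on UNIV (\<lambda>t. m (1 - t))" unfolding m_def by (intro continuous_intros)
  have c: "continuous_on UNIV s'"
    unfolding s'_def using mc mc' pos by (intro continuous_intros) (auto simp: less_imp_neq[symmetric])
  have nn: "m t \<ge> 0" for t by (simp add: m_def)
  have out: "s' t = 0" if "t \<notin> {0..1}" for t
    using that by (auto simp: s'_def m_def max_def not_le)
  have "compact (s' ` {0..1})" by (intro compact_continuous_image continuous_on_subset[OF c]) auto
  then obtain b where b: "b > 0" "\<And>t. t \<in> {0..1} \<Longrightarrow> \<bar>s' t\<bar> \<le> b"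
    by (metis bounded_pos compact_imp_bounded image_eqI real_norm_def)
  have bnd: "\<bar>s' t\<bar> \<le> b" for t
    using b out[of t] by (cases "t \<in> {0..1}") auto
  show ?thesis
  proof (rule that[OF d c _ _ _ _ bnd])
    show "0 \<le> s t" "s t \<le> 1" for t using nn[of t] nn[of "1 - t"] pos[of t] by (auto simp: s_def)
    show "s t = 0" if "t \<le> 0" for t using that by (auto simp: s_def m_def)
    show "s t = 1" if "t \<ge> 1" for t using that by (auto simp: s_def m_def)
    show "0 < s t" if "0 < t" for t using that pos[of t] by (auto simp: s_def m_def)
  qed (use b in auto)
qed

text \<open>The constant \<open>c\<close> is independent of \<open>L\<close>: truncating a field at
  scale \<open>L\<close> changes its divergence by \<open>O (1 / L)\<close>, which is negligible on
  a set of finite area once \<open>L\<close> is large.\<close>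

lemma smooth_cutoff:
  obtains c where "c > 0" "\<And>L. L > 0 \<Longrightarrow> \<exists>\<theta> \<theta>'.
      (\<forall>t. (\<theta> has_real_derivative \<theta>' t) (at t)) \<and> continuous_on UNIV \<theta>' \<and>
      (\<forall>t. 0 \<le> \<theta> t \<and> \<theta> t \<le> 1 \<and> \<bar>\<theta>' t\<bar> \<le> c / L) \<and> (\<forall>t. \<bar>t\<bar> \<le> L \<longrightarrow> \<theta> t = 1) \<and>
      (\<forall>t. \<bar>t\<bar> \<ge> 2 * L \<longrightarrow> \<theta> t = 0)"
proof -
  obtain s s' :: "real \<Rightarrow> real" and c where s: "\<And>t. (s has_real_derivative s' t) (at t)" "continuous_on UNIV s'"
    "\<And>t. 0 \<le> s t" "\<And>t. s t \<le> 1" "\<And>t. t \<le> 0 \<Longrightarrow> s t = 0" "\<And>t. t \<ge> 1 \<Longrightarrow> s t = 1" "\<And>t. \<bar>s' t\<bar> \<le> c"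
    "\<And>t. 0 < t \<Longrightarrow> 0 < s t" "c > 0"
    using smooth_step by metis
  have sc: "continuous_on UNIV s" using s(1) DERIV_continuous_on by blast
  note [continuous_intros] = continuous_on_compose2[OF sc] continuous_on_compose2[OF s(2)]
  show ?thesis
  proof (rule that[of "2 * c"])
    fix L :: real assume L: "L > 0"
    \<comment> \<open>One factor falls from 1 to 0 between \<open>L\<close> and
      \<open>2 * L\<close>, the other rises between \<open>- 2 * L\<close> and
      \<open>- L\<close>.\<close>
    define \<theta> where "\<theta> = (\<lambda>t. s (2 - t / L) * s (2 + t / L))"
    define \<theta>' where "\<theta>' = (\<lambda>t. - s' (2 - t / L) / L * s (2 + t / L) + s (2 - t / L) * (s' (2 + t / L) / L))"
    have "(\<theta> has_real_derivative \<theta>' t) (at t)" for t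
      unfolding \<theta>_def \<theta>'_def using L
      by (auto intro!: derivative_eq_intros DERIV_chain2[OF s(1)])
    moreover have "continuous_on UNIV \<theta>'"
      unfolding \<theta>'_def using L by (intro continuous_intros) auto
    moreover have "0 \<le> \<theta> t" "\<theta> t \<le> 1" for t
      using s(3,4) by (auto simp: \<theta>_def mult_le_one)
    moreover have "\<bar>\<theta>' t\<bar> \<le> 2 * c / L" for t
    proof -
      have "\<bar>\<theta>' t\<bar> \<le> \<bar>s' (2 - t / L)\<bar> / L * \<bar>s (2 + t / L)\<bar> + \<bar>s (2 - t / L)\<bar> * (\<bar>s' (2 + t / L)\<bar> / L)"
        unfolding \<theta>'_def using L by (intro order_trans[OF abs_triangle_ineq]) (simp add: abs_mult)
      also have "\<dots> \<le> c / L * 1 + 1 * (c / L)"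
        using L s(3,4,7) by (intro add_mono mult_mono divide_right_mono) (auto simp: abs_of_nonneg order_less_imp_le[OF s(9)])
      finally show ?thesis by simp
    qed
    moreover have "\<theta> t = 1" if "\<bar>t\<bar> \<le> L" for t
    proof -
      have "t / L \<le> 1" "t / L \<ge> - 1" using that L by (auto simp: field_simps)
      thus ?thesis using s(6) by (simp add: \<theta>_def)
    qed
    moreover have "\<theta> t = 0" if "\<bar>t\<bar> \<ge> 2 * L" for t
    proof -
      have "t / L \<ge> 2 \<or> t / L \<le> - 2" using that L by (auto simp: field_simps abs_real_def split: if_splits)
      thus ?thesis using s(5) by (auto simp: \<theta>_def)
    qed
    ultimately show "\<exists>\<theta> \<theta>'.
      (\<forall>t. (\<theta> has_real_derivative \<theta>' t) (at t)) \<and> continuous_on UNIV \<theta>' \<and>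
      (\<forall>t. 0 \<le> \<theta> t \<and> \<theta> t \<le> 1 \<and> \<bar>\<theta>' t\<bar> \<le> 2 * c / L) \<and> (\<forall>t. \<bar>t\<bar> \<le> L \<longrightarrow> \<theta> t = 1) \<and>
      (\<forall>t. \<bar>t\<bar> \<ge> 2 * L \<longrightarrow> \<theta> t = 0)" by blast
  qed (use s(9) in auto)
qed

section \<open>Smooth approximation, the weight, and reflection\<close>

text \<open>The step is applied to \<open>r\<^sup>2\<close> minus the squared distance, a
  polynomial, so the kink of the norm at the centre never appears.\<close>

lemma C1_ball_bump:
  fixes c :: "real \<times> real"
  assumes "r > 0"
  obtains b g h where "C1 b g h" "\<And>z. 0 \<le> b z" "\<And>z. z \<in> ball c r \<Longrightarrow> 0 < b z" "\<And>z. z \<notin> ball c r \<Longrightarrow> b z = 0"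
proof -
  obtain s s' :: "real \<Rightarrow> real" and C where s: "\<And>t. (s has_real_derivative s' t) (at t)" "continuous_on UNIV s'"
    "\<And>t. 0 \<le> s t" "\<And>t. s t \<le> 1" "\<And>t. t \<le> 0 \<Longrightarrow> s t = 0" "\<And>t. t \<ge> 1 \<Longrightarrow> s t = 1" "\<And>t. \<bar>s' t\<bar> \<le> C"
    "\<And>t. 0 < t \<Longrightarrow> 0 < s t" "C > 0"
    using smooth_step by metis
  have sq: "((\<lambda>t. - ((t - a)\<^sup>2)) has_real_derivative - (2 * (t - a))) (at t)" for a t :: real
    by (auto intro!: derivative_eq_intros)
  have c: "continuous_on UNIV (\<lambda>t. - (2 * (t - a)))" for a :: real by (intro continuous_intros)
  note C1_add[OF C1_fst[OF sq c] C1_snd[OF sq c], of "fst c" "snd c"]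
  hence "\<exists>g h. C1 (\<lambda>z. - ((fst z - fst c)\<^sup>2) + - ((snd z - snd c)\<^sup>2)) g h" by blast
  then obtain g h where gh: "C1 (\<lambda>z. - ((fst z - fst c)\<^sup>2) + - ((snd z - snd c)\<^sup>2)) g h" by blast
  have d: "((\<lambda>t. s (r\<^sup>2 + t)) has_real_derivative s' (r\<^sup>2 + t)) (at t)" for t
    using s(1)[of "r\<^sup>2 + t"] by (simp add: DERIV_shift add.commute)
  have d': "continuous_on UNIV (\<lambda>t. s' (r\<^sup>2 + t))"
    by (intro continuous_on_compose2[OF s(2)] continuous_intros) auto
  have ball: "z \<in> ball c r \<longleftrightarrow> (fst z - fst c)\<^sup>2 + (snd z - snd c)\<^sup>2 < r\<^sup>2" for z
  proof -
    have "z \<in> ball c r \<longleftrightarrow> sqrt ((fst z - fst c)\<^sup>2 + (snd z - snd c)\<^sup>2) < r"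
      by (simp add: mem_ball dist_prod_def dist_real_def power2_commute)
    also have "\<dots> \<longleftrightarrow> (fst z - fst c)\<^sup>2 + (snd z - snd c)\<^sup>2 < r\<^sup>2"
      using assms by (metis real_sqrt_less_iff real_sqrt_abs abs_of_pos)
    finally show ?thesis .
  qed
  show ?thesis
    by (rule that[OF C1_compose[OF gh d d']]) (use s(3,5,8) ball in \<open>auto simp del: mem_ball simp: not_less\<close>)
qed

text \<open>Finitely many balls inside \<open>U\<close> cover \<open>K\<close>. The sum of their
  bumps has a positive minimum \<open>m\<close> on \<open>K\<close>; dividing by \<open>m\<close>
  and applying the step flattens the sum to exactly 1 on \<open>K\<close> and keeps it 0 off
  \<open>U\<close>.\<close>

lemma C1_Urysohn:
  fixes K U :: "(real \<times> real) set"
  assumes "compact K" "open U" "K \<subseteq> U"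
  obtains p g h where "C1 p g h" "\<And>z. 0 \<le> p z" "\<And>z. p z \<le> 1" "\<And>z. z \<in> K \<Longrightarrow> p z = 1"
    "\<And>z. z \<notin> U \<Longrightarrow> p z = 0"
proof -
  have "\<exists>r>0. ball c r \<subseteq> U" if "c \<in> K" for c
    using that assms openE by blast
  then obtain r where r: "\<And>c. c \<in> K \<Longrightarrow> r c > 0" "\<And>c. c \<in> K \<Longrightarrow> ball c (r c) \<subseteq> U" by metis
  obtain I where I: "I \<subseteq> K" "finite I" "K \<subseteq> (\<Union>c\<in>I. ball c (r c))"
  proof (rule compactE_image[OF assms(1), of K "\<lambda>c. ball c (r c)"])
    show "K \<subseteq> (\<Union>c\<in>K. ball c (r c))" using r(1) by auto
  qed auto
  have "\<exists>b g h. C1 b g h \<and> (\<forall>z. 0 \<le> b z) \<and> (\<forall>z\<in>ball c (r c). 0 < b z) \<and> (\<forall>z. z \<notin> ball c (r c) \<longrightarrow> b z = 0)"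
    if "c \<in> I" for c
    using C1_ball_bump[of "r c" c] r(1) that I(1) by (metis subsetD)
  then obtain b g h where b: "\<And>c. c \<in> I \<Longrightarrow> C1 (b c) (g c) (h c)" "\<And>c z. c \<in> I \<Longrightarrow> 0 \<le> b c z"
    "\<And>c z. c \<in> I \<Longrightarrow> z \<in> ball c (r c) \<Longrightarrow> 0 < b c z" "\<And>c z. c \<in> I \<Longrightarrow> z \<notin> ball c (r c) \<Longrightarrow> b c z = 0"
    by metis
  define \<sigma> where "\<sigma> = (\<lambda>z. \<Sum>c\<in>I. b c z)"
  have C: "C1 \<sigma> (\<lambda>z. \<Sum>c\<in>I. g c z) (\<lambda>z. \<Sum>c\<in>I. h c z)"
    unfolding \<sigma>_def using I(2) b(1) by (intro C1_sum)
  have pos: "\<sigma> z > 0" if zK: "z \<in> K" for z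
  proof -
    obtain c where c: "c \<in> I" "z \<in> ball c (r c)" using I(3) zK by blast
    show ?thesis unfolding \<sigma>_def using sum_pos2[of I c "\<lambda>c. b c z"] I(2) c b(2,3) by blast
  qed
  have "\<exists>m>0. \<forall>z\<in>K. m \<le> \<sigma> z"
  proof (cases "K = {}")
    case False
    obtain x where "x \<in> K" "\<And>z. z \<in> K \<Longrightarrow> \<sigma> x \<le> \<sigma> z"
      using continuous_attains_inf[OF assms(1) False, of \<sigma>] C1_continuous[OF C] by blast
    thus ?thesis using pos by blast
  qed (auto intro: exI[of _ 1])
  then obtain m where m: "m > 0" "\<And>z. z \<in> K \<Longrightarrow> m \<le> \<sigma> z" by blast
  obtain s s' :: "real \<Rightarrow> real" and B where s: "\<And>t. (s has_real_derivative s' t) (at t)" "continuous_on UNIV s'"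
    "\<And>t. 0 \<le> s t" "\<And>t. s t \<le> 1" "\<And>t. t \<le> 0 \<Longrightarrow> s t = 0" "\<And>t. t \<ge> 1 \<Longrightarrow> s t = 1" "\<And>t. \<bar>s' t\<bar> \<le> B"
    "\<And>t. 0 < t \<Longrightarrow> 0 < s t" "B > 0"
    using smooth_step by metis
  show ?thesis
  proof (rule that[OF C1_compose[OF C1_cmult[OF C, of "1 / m"] s(1,2)]])
    fix z
    show "s (1 / m * \<sigma> z) = 1" if "z \<in> K"
      using m(2)[OF that] m(1) by (intro s(6)) (simp add: field_simps)
    show "s (1 / m * \<sigma> z) = 0" if "z \<notin> U"
    proof -
      have "\<sigma> z = 0" unfolding \<sigma>_def using r(2) I(1) that by (intro sum.neutral ballI b(4); blast)
      thus ?thesis using s(5) by simp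
    qed
  qed (use s(3,4) in auto)
qed

text \<open>Regularity of Lebesgue measure squeezes \<open>G\<close> between a compact
  \<open>K\<close> and an open \<open>T\<close>. A Urysohn function for \<open>K\<close> inside
  \<open>T \<inter> B\<close> can differ from the indicator of \<open>G\<close> only on
  \<open>(G - K) \<union> (T - G)\<close>.\<close>

lemma C1_approx_indicator:
  fixes G B :: "(real \<times> real) set"
  assumes "G \<in> sets lebesgue" "G \<subseteq> B" "open B" "bounded B" "e > 0"
  obtains p g h where "C1 p g h" "\<And>z. 0 \<le> p z" "\<And>z. p z \<le> 1" "\<And>z. z \<notin> B \<Longrightarrow> p z = 0"
    "(\<integral>z. \<bar>p z - indicator G z\<bar> \<partial>lebesgue) \<le> e"
proof -
  have BL: "B \<in> lmeasurable" using assms(3,4) by (simp add: lmeasurable_open)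
  have GL: "G \<in> lmeasurable" using bounded_set_imp_lmeasurable[OF bounded_subset[OF assms(4,2)] assms(1)] .
  obtain K where K: "closed K" "K \<subseteq> G" "G - K \<in> lmeasurable" "emeasure lebesgue (G - K) < ennreal (e / 2)"
    using sets_lebesgue_inner_closed[OF assms(1), of "e / 2"] assms(5) by auto
  obtain T where T: "open T" "G \<subseteq> T" "T - G \<in> lmeasurable" "emeasure lebesgue (T - G) < ennreal (e / 2)"
    using sets_lebesgue_outer_open[OF assms(1), of "e / 2"] assms(5) by auto
  have "compact K" using K(1,2) assms(2,4) by (meson bounded_subset compact_eq_bounded_closed)
  then obtain p g h where p: "C1 p g h" "\<And>z. 0 \<le> p z" "\<And>z. p z \<le> 1" "\<And>z. z \<in> K \<Longrightarrow> p z = 1"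
    "\<And>z. z \<notin> T \<inter> B \<Longrightarrow> p z = 0"
  proof (rule C1_Urysohn[of K "T \<inter> B"])
    show "open (T \<inter> B)" "K \<subseteq> T \<inter> B" using T(1,2) assms(2,3) K(2) by auto
  qed auto
  have m1: "measure lebesgue (G - K) \<le> e / 2"
    using K(3,4) assms(5) by (simp add: emeasure_eq_measure2 ennreal_less_iff)
  have m2: "measure lebesgue (T - G) \<le> e / 2"
    using T(3,4) assms(5) by (simp add: emeasure_eq_measure2 ennreal_less_iff)
  have D: "(G - K) \<union> (T - G) \<in> lmeasurable" using K(3) T(3) by (rule fmeasurable.Un)
  have "(\<integral>z. \<bar>p z - indicator G z\<bar> \<partial>lebesgue) \<le> (\<integral>z. indicator ((G - K) \<union> (T - G)) z \<partial>lebesgue)"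
  proof (rule Bochner_Integration.integral_mono')
    show "integrable lebesgue (indicator ((G - K) \<union> (T - G)) :: _ \<Rightarrow> real)"
      using D unfolding fmeasurable_def by (auto intro: integrable_real_indicator)
    fix z show "\<bar>p z - indicator G z\<bar> \<le> indicator ((G - K) \<union> (T - G)) z"
      using p(2,3)[of z] p(4,5)[of z] T(2) K(2) assms(2)
      by (auto simp: indicator_def abs_real_def split: if_splits)
  qed auto
  also have "\<dots> = measure lebesgue ((G - K) \<union> (T - G))" by simp
  also have "\<dots> \<le> measure lebesgue (G - K) + measure lebesgue (T - G)"
    using K(3) T(3) by (intro measure_Un_le) auto
  finally have "(\<integral>z. \<bar>p z - indicator G z\<bar> \<partial>lebesgue) \<le> e" using m1 m2 by linarith
  with p show ?thesis by (intro that[of p g h]) auto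
qed

section \<open>The weight and integrability of the divergence\<close>

lemma weight_nonneg: "0 \<le> grushin_weight \<alpha> x"
  by (simp add: grushin_weight_def)

lemma weight_pos: "x \<noteq> 0 \<Longrightarrow> 0 < grushin_weight \<alpha> x"
  by (simp add: grushin_weight_def)

lemma weight_eq_powr: "x > 0 \<Longrightarrow> grushin_weight \<alpha> x = x powr \<alpha>"
  by (simp add: grushin_weight_def)

lemma weight_minus: "grushin_weight \<alpha> (- x) = grushin_weight \<alpha> x"
  by (simp add: grushin_weight_def)

lemma weight_scale: "r > 0 \<Longrightarrow> grushin_weight \<alpha> (r * x) = r powr \<alpha> * grushin_weight \<alpha> x"
  by (simp add: grushin_weight_def abs_mult powr_mult)

lemma weight_mono: "\<alpha> \<ge> 0 \<Longrightarrow> 0 \<le> x \<Longrightarrow> x \<le> y \<Longrightarrow> grushin_weight \<alpha> x \<le> grushin_weight \<alpha> y"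
  by (simp add: grushin_weight_def powr_mono2)

lemma continuous_on_weight:
  assumes "\<alpha> \<ge> 0"
  shows "continuous_on S (grushin_weight \<alpha>)"
proof (cases "\<alpha> = 0")
  case False
  have "continuous_on S (\<lambda>x. \<bar>x\<bar> powr \<alpha>)"
    using assms False by (intro continuous_on_powr' continuous_intros) auto
  with False show ?thesis by (simp add: grushin_weight_def[abs_def])
qed (simp add: grushin_weight_def[abs_def])

lemma continuous_on_grushin_div:
  assumes "\<alpha> \<ge> 0" "C1 \<phi>\<^sub>1 g\<^sub>1 h\<^sub>1" "C1 \<phi>\<^sub>2 g\<^sub>2 h\<^sub>2"
  shows "continuous_on S (grushin_div \<alpha> \<phi>\<^sub>1 \<phi>\<^sub>2)"
  unfolding grushin_div_def C1_partial_x[OF assms(2)] C1_partial_y[OF assms(3)]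
  by (intro continuous_intros C1_continuous_x[OF assms(2)] C1_continuous_y[OF assms(3)]
      continuous_on_compose2[OF continuous_on_weight[OF assms(1), of UNIV]]) auto

lemma set_integrable_compact_support:
  fixes f :: "real \<times> real \<Rightarrow> real"
  assumes "continuous_on UNIV f" "\<And>z. z \<notin> S \<Longrightarrow> f z = 0" "bounded S" "G \<in> sets lebesgue"
  shows "set_integrable lebesgue G f"
proof -
  obtain b where b: "S \<subseteq> cbox (- b) b" using assms(3) bounded_subset_cbox_symmetric by blast
  have "integrable lborel (\<lambda>z. indicator (cbox (- b) b) z *\<^sub>R f z)"
    by (intro borel_integrable_compact compact_cbox continuous_on_subset[OF assms(1)]) auto
  also have "(\<lambda>z. indicator (cbox (- b) b) z *\<^sub>R f z) = f"
    using assms(2) b by (auto simp: fun_eq_iff indicator_def)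
  finally have "integrable lebesgue f" using integrable_completion[of f lborel] by (simp add: borel_measurable_integrable)
  thus ?thesis
    using integrable_mult_indicator[OF assms(4)] unfolding set_integrable_def by blast
qed

text \<open>Shows that divergences vanish off the support of the field, and that fields living on
  opposite sides of \<open>x = 0\<close> do not disturb each other when added.\<close>

lemma test_partial_zero:
  assumes "C1 \<phi> g h" "open T" "\<And>z. z \<in> T \<Longrightarrow> \<phi> z = 0" "z \<in> T"
  shows "g z = 0" "h z = 0"
proof -
  have "(\<phi> has_derivative (\<lambda>d. g z * fst d + h z * snd d)) (at z)"
    using assms(1) unfolding C1_def by blast
  moreover have "(\<phi> has_derivative (\<lambda>d. 0)) (at z)"
    by (rule has_derivative_transform_within_open[of "\<lambda>_. 0" _ _ _ T]) (use assms in auto)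
  ultimately have "(\<lambda>d. g z * fst d + h z * snd d) = (\<lambda>d. 0)" by (rule has_derivative_unique)
  from fun_cong[OF this, of "(1, 0)"] fun_cong[OF this, of "(0, 1)"] show "g z = 0" "h z = 0" by auto
qed

lemma set_integrable_grushin_div:
  assumes "\<alpha> \<ge> 0" "\<phi>\<^sub>1 \<in> test_functions" "\<phi>\<^sub>2 \<in> test_functions" "G \<in> sets lebesgue"
  shows "set_integrable lebesgue G (grushin_div \<alpha> \<phi>\<^sub>1 \<phi>\<^sub>2)"
proof -
  obtain R1 where 1: "C1 \<phi>\<^sub>1 (partial_x \<phi>\<^sub>1) (partial_y \<phi>\<^sub>1)" "R1 > 0" "\<And>x y. \<bar>x\<bar> \<ge> R1 \<or> \<bar>y\<bar> \<ge> R1 \<Longrightarrow> \<phi>\<^sub>1 (x, y) = 0"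
    using test_functionsE[OF assms(2)] by blast
  obtain R2 where 2: "C1 \<phi>\<^sub>2 (partial_x \<phi>\<^sub>2) (partial_y \<phi>\<^sub>2)" "R2 > 0" "\<And>x y. \<bar>x\<bar> \<ge> R2 \<or> \<bar>y\<bar> \<ge> R2 \<Longrightarrow> \<phi>\<^sub>2 (x, y) = 0"
    using test_functionsE[OF assms(3)] by blast
  define R where "R = max R1 R2"
  define T where "T = - (cbox (- R, - R) (R, R))"
  have T: "open T" unfolding T_def by (intro open_Compl closed_cbox)
  have z: "\<phi>\<^sub>1 z = 0 \<and> \<phi>\<^sub>2 z = 0" if "z \<in> T" for z
  proof -
    have "\<bar>fst z\<bar> \<ge> R \<or> \<bar>snd z\<bar> \<ge> R" using that by (cases z) (auto simp: T_def cbox_Pair_eq)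
    thus ?thesis using 1(3)[of "fst z" "snd z"] 2(3)[of "fst z" "snd z"] by (auto simp: R_def)
  qed
  show ?thesis
  proof (rule set_integrable_compact_support[OF continuous_on_grushin_div[OF assms(1) 1(1) 2(1)] _ _ assms(4)])
    show "grushin_div \<alpha> \<phi>\<^sub>1 \<phi>\<^sub>2 z = 0" if "z \<notin> cbox (- R, - R) (R, R)" for z
      using test_partial_zero[OF 1(1) T, of z] test_partial_zero[OF 2(1) T, of z] z that
      by (auto simp: grushin_div_def T_def)
  qed auto
qed

section \<open>Reflection in the line x = 0\<close>

lemma reflect_lebesgue:
  shows "(\<lambda>z. (- fst z, snd z)) \<in> lebesgue \<rightarrow>\<^sub>M (lebesgue :: (real \<times> real) measure)"
    and "distr lebesgue lebesgue (\<lambda>z. (- fst z, snd z)) = (lebesgue :: (real \<times> real) measure)"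
proof -
  \<comment> \<open>The reflection as a diagonal affine map with entries -1 and 1, so the Jacobian
    factor is 1.\<close>
  define c where "c = (\<lambda>b :: real \<times> real. if b = (1, 0) then - 1 else 1 :: real)"
  have T: "(\<lambda>x. (0 :: real \<times> real) + (\<Sum>j\<in>Basis. (c j * (x \<bullet> j)) *\<^sub>R j)) = (\<lambda>z. (- fst z, snd z))"
    by (auto simp: fun_eq_iff Basis_prod_def c_def sum.union_disjoint inner_Pair)
  have c: "c j \<noteq> 0" "\<bar>c j\<bar> = 1" for j by (auto simp: c_def)
  show "(\<lambda>z. (- fst z, snd z)) \<in> lebesgue \<rightarrow>\<^sub>M (lebesgue :: (real \<times> real) measure)"
    using lebesgue_affine_measurable[of c 0] c(1) unfolding T by auto
  show "distr lebesgue lebesgue (\<lambda>z. (- fst z, snd z)) = (lebesgue :: (real \<times> real) measure)"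
    using lebesgue_affine_euclidean[of c 0] c unfolding T by (simp add: density_1)
qed

lemma reflect_set:
  assumes "G \<in> sets lebesgue"
  defines "G' \<equiv> (\<lambda>z :: real \<times> real. (- fst z, snd z)) -` G"
  shows "G' \<in> sets lebesgue" "emeasure lebesgue G' = emeasure lebesgue G"
proof -
  show "G' \<in> sets lebesgue"
    using measurable_sets[OF reflect_lebesgue(1) assms(1)] by (simp add: G'_def)
  show "emeasure lebesgue G' = emeasure lebesgue G"
    using emeasure_distr[OF reflect_lebesgue(1) assms(1)] by (simp add: reflect_lebesgue(2) G'_def)
qed

lemma reflect_integral:
  fixes f :: "real \<times> real \<Rightarrow> real"
  assumes "G \<in> sets lebesgue" "continuous_on UNIV f"
  shows "set_lebesgue_integral lebesgue ((\<lambda>z. (- fst z, snd z)) -` G) (\<lambda>z. f (- fst z, snd z))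
    = set_lebesgue_integral lebesgue G f"
proof -
  have "f \<in> borel_measurable lebesgue"
    using assms(2) by (simp add: borel_measurable_continuous_onI measurable_completion)
  hence "(\<lambda>z. indicator G z *\<^sub>R f z) \<in> borel_measurable lebesgue"
    using assms(1) by measurable
  from integral_distr[OF reflect_lebesgue(1) this]
  show ?thesis
    by (simp add: reflect_lebesgue(2) set_lebesgue_integral_def indicator_def)
qed

lemma reflect_test_function:
  assumes "\<phi> \<in> test_functions"
  shows "(\<lambda>z. \<phi> (- fst z, snd z)) \<in> test_functions"
    "partial_x (\<lambda>z. \<phi> (- fst z, snd z)) = (\<lambda>z. - partial_x \<phi> (- fst z, snd z))"
    "partial_y (\<lambda>z. \<phi> (- fst z, snd z)) = (\<lambda>z. partial_y \<phi> (- fst z, snd z))"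
proof -
  obtain R where R: "C1 \<phi> (partial_x \<phi>) (partial_y \<phi>)" "R > 0" "\<And>x y. \<bar>x\<bar> \<ge> R \<or> \<bar>y\<bar> \<ge> R \<Longrightarrow> \<phi> (x, y) = 0"
    using test_functionsE[OF assms] by blast
  show "(\<lambda>z. \<phi> (- fst z, snd z)) \<in> test_functions"
    by (rule test_functionsI_box[OF C1_reflect[OF R(1)], of R]) (use R(3) in auto)
  show "partial_x (\<lambda>z. \<phi> (- fst z, snd z)) = (\<lambda>z. - partial_x \<phi> (- fst z, snd z))"
    "partial_y (\<lambda>z. \<phi> (- fst z, snd z)) = (\<lambda>z. partial_y \<phi> (- fst z, snd z))"
    using C1_partial_x[OF C1_reflect[OF R(1)]] C1_partial_y[OF C1_reflect[OF R(1)]] by auto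
qed

lemma test_function_uminus:
  assumes "\<phi> \<in> test_functions"
  shows "(\<lambda>z. - \<phi> z) \<in> test_functions" "partial_x (\<lambda>z. - \<phi> z) = (\<lambda>z. - partial_x \<phi> z)"
proof -
  obtain R where R: "C1 \<phi> (partial_x \<phi>) (partial_y \<phi>)" "R > 0" "\<And>x y. \<bar>x\<bar> \<ge> R \<or> \<bar>y\<bar> \<ge> R \<Longrightarrow> \<phi> (x, y) = 0"
    using test_functionsE[OF assms] by blast
  have C: "C1 (\<lambda>z. - \<phi> z) (\<lambda>z. - partial_x \<phi> z) (\<lambda>z. - partial_y \<phi> z)"
    using C1_cmult[OF R(1), of "-1"] by simp
  show "(\<lambda>z. - \<phi> z) \<in> test_functions"
    by (rule test_functionsI_box[OF C, of R]) (use R(3) in auto)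
  show "partial_x (\<lambda>z. - \<phi> z) = (\<lambda>z. - partial_x \<phi> z)" using C1_partial_x[OF C] .
qed

text \<open>Reflection flips the sign of the \<open>x\<close>-derivative, which the sign change of
  the first component undoes, and the weight is even. Left chambers are thereby reduced to right
  ones.\<close>

lemma reflect_grushin_div:
  assumes "\<alpha> \<ge> 0" "\<phi>\<^sub>1 \<in> test_functions" "\<phi>\<^sub>2 \<in> test_functions" "G \<in> sets lebesgue"
  shows "set_lebesgue_integral lebesgue ((\<lambda>z. (- fst z, snd z)) -` G)
      (grushin_div \<alpha> (\<lambda>z. - \<phi>\<^sub>1 (- fst z, snd z)) (\<lambda>z. \<phi>\<^sub>2 (- fst z, snd z)))
    = set_lebesgue_integral lebesgue G (grushin_div \<alpha> \<phi>\<^sub>1 \<phi>\<^sub>2)"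
proof -
  have "continuous_on UNIV (grushin_div \<alpha> \<phi>\<^sub>1 \<phi>\<^sub>2)"
    using continuous_on_grushin_div[OF assms(1)] test_functionsE assms(2,3) by metis
  from reflect_integral[OF assms(4) this] show ?thesis
    by (simp add: grushin_div_def reflect_test_function[OF assms(2)] reflect_test_function[OF assms(3)]
        test_function_uminus[OF reflect_test_function(1)[OF assms(2)]] weight_minus)
qed

section \<open>The extremal profile\<close>

text \<open>Sine and cosine of the angle of the extremal curve of width 1.\<close>

definition slope :: "real \<Rightarrow> real" where "slope t = 1 / 2 - 3 / 2 * t"

definition cslope :: "real \<Rightarrow> real" where "cslope t = sqrt (1 - (slope t)\<^sup>2)"

lemma slope_abs: "0 < t \<Longrightarrow> t < 1 \<Longrightarrow> \<bar>slope t\<bar> < 1"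
  by (auto simp: slope_def abs_less_iff)

lemma slope_abs_le: "0 \<le> t \<Longrightarrow> t \<le> 1 \<Longrightarrow> \<bar>slope t\<bar> \<le> 1"
  by (auto simp: slope_def abs_le_iff)

lemma cslope_nonneg: "0 \<le> t \<Longrightarrow> t \<le> 1 \<Longrightarrow> 0 \<le> cslope t"
  using slope_abs_le[of t] by (simp add: cslope_def abs_square_le_1)

lemma cslope_pos: "0 < t \<Longrightarrow> t < 1 \<Longrightarrow> 0 < cslope t"
  using slope_abs[of t] by (simp add: cslope_def abs_square_less_1)

lemma cslope_pos0: "0 \<le> t \<Longrightarrow> t < 1 \<Longrightarrow> 0 < cslope t"
  by (cases "t = 0") (auto simp: cslope_pos, simp add: cslope_def slope_def power2_eq_square)

lemma slope_cslope: "0 \<le> t \<Longrightarrow> t \<le> 1 \<Longrightarrow> (slope t)\<^sup>2 + (cslope t)\<^sup>2 = 1"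
  using slope_abs_le[of t] by (simp add: cslope_def abs_square_le_1)

lemma cslope_1 [simp]: "cslope 1 = 0" by (simp add: cslope_def slope_def)

lemma continuous_slope [continuous_intros]: "continuous_on S u \<Longrightarrow> continuous_on S (\<lambda>x. slope (u x))"
  unfolding slope_def by (intro continuous_intros)

lemma continuous_cslope [continuous_intros]: "continuous_on S u \<Longrightarrow> continuous_on S (\<lambda>x. cslope (u x))"
  unfolding cslope_def by (intro continuous_intros)

lemma DERIV_slope: "(slope has_real_derivative - (3 / 2)) (at t)"
  unfolding slope_def[abs_def] by (auto intro!: derivative_eq_intros)

lemma DERIV_cslope: "0 < t \<Longrightarrow> t < 1 \<Longrightarrow> (cslope has_real_derivative 3 / 2 * slope t / cslope t) (at t)"
  using cslope_pos[of t] unfolding cslope_def[abs_def]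
  by (auto intro!: derivative_eq_intros DERIV_slope simp: field_simps cslope_def)

lemma DERIV_x_weight:
  assumes "x > 0" "\<alpha> \<ge> 0"
  shows "((\<lambda>x. x * grushin_weight \<alpha> x) has_real_derivative (\<alpha> + 1) * grushin_weight \<alpha> x) (at x)"
proof -
  have "((\<lambda>x. x powr (\<alpha> + 1)) has_real_derivative (\<alpha> + 1) * grushin_weight \<alpha> x) (at x)"
    using assms by (auto intro!: derivative_eq_intros simp: weight_eq_powr)
  thus ?thesis
    by (rule has_field_derivative_transform_within_open[of _ _ _ "{0<..}"])
      (use assms in \<open>auto simp: weight_eq_powr powr_add\<close>)
qed

text \<open>The substitution \<open>slope x = cos \<phi>\<close> removes the singularity of the slope at \<open>x = 1\<close>.\<close>

lemma unit_profile:
  assumes "\<alpha> \<ge> 0"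
  obtains F where "continuous_on {0..1} F"
    "\<And>x. 0 < x \<Longrightarrow> x < 1 \<Longrightarrow> (F has_real_derivative grushin_weight \<alpha> x * slope x / cslope x) (at x)"
    "F 1 = 0"
proof -
  \<comment> \<open>With \<open>slope x = cos t\<close> one has
    \<open>x = (1 / 2 - cos t) * (2 / 3)\<close> and \<open>dx = 2 / 3 * sin t dt\<close>, while
    \<open>cslope x = sin t\<close>; the sines cancel and a continuous integrand remains.\<close>
  have "continuous_on UNIV (\<lambda>t. 2 / 3 * grushin_weight \<alpha> ((1 / 2 - cos t) * (2 / 3)) * cos t)"
    by (intro continuous_intros continuous_on_compose2[OF continuous_on_weight[OF assms, of UNIV]]) auto
  then obtain H where H: "\<And>t. (H has_real_derivative 2 / 3 * grushin_weight \<alpha> ((1 / 2 - cos t) * (2 / 3)) * cos t) (at t)"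
    using global_antiderivative by blast
  have Hc: "continuous_on UNIV H" by (rule DERIV_continuous_on) (rule H)
  define F where "F = (\<lambda>x. H (arccos (slope x)) - H pi)"
  show ?thesis
  proof (rule that[of F])
    show "F 1 = 0" by (simp add: F_def slope_def)
    show "continuous_on {0..1} F"
      unfolding F_def by (intro continuous_intros continuous_on_compose2[OF Hc]) (auto simp: slope_def)
    fix x :: real assume x: "0 < x" "x < 1"
    have s: "- 1 < slope x" "slope x < 1" using slope_abs[OF x] by auto
    have d: "((\<lambda>x. arccos (slope x)) has_real_derivative inverse (- cslope x) * (- (3 / 2))) (at x)"
      unfolding cslope_def by (rule DERIV_chain2[OF DERIV_arccos[OF s] DERIV_slope])
    have c: "cos (arccos (slope x)) = slope x" using s by simp
    have e: "(1 / 2 - slope x) * (2 / 3) = x" by (simp add: slope_def field_simps)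
    have q: "2 / 3 * grushin_weight \<alpha> x * slope x * (inverse (- cslope x) * - (3 / 2)) =
        grushin_weight \<alpha> x * slope x / cslope x"
      using cslope_pos[OF x] by (simp add: field_simps)
    from DERIV_chain2[OF H d, unfolded c e q]
    have "((\<lambda>x. H (arccos (slope x))) has_real_derivative
        grushin_weight \<alpha> x * slope x / cslope x) (at x)" .
    thus "(F has_real_derivative grushin_weight \<alpha> x * slope x / cslope x) (at x)"
      unfolding F_def by (auto intro!: derivative_eq_intros)
  qed
qed

text \<open>The last claim ties the area under the profile to the constant \<kappa> of the perimeter
  bound. After rescaling it becomes the stationarity condition on which \<open>optimal_width\<close>
  rests.\<close>

lemma unit_profile_properties:
  assumes "\<alpha> \<ge> 0" "continuous_on {0..1} F"
    "\<And>x. 0 < x \<Longrightarrow> x < 1 \<Longrightarrow> (F has_real_derivative grushin_weight \<alpha> x * slope x / cslope x) (at x)"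
    "F 1 = 0"
  shows "\<And>x. 0 \<le> x \<Longrightarrow> x < 1 \<Longrightarrow> 0 < F x"
    and "0 < integral {0..1} (\<lambda>x. grushin_weight \<alpha> x * cslope x)"
    and "(F has_integral 2 / 3 * ((\<alpha> + 1) * integral {0..1} (\<lambda>x. grushin_weight \<alpha> x * cslope x))) {0..1}"
proof -
  let ?w = "grushin_weight \<alpha>"
  note wc = continuous_on_weight[OF assms(1)]
  have wcc: "continuous_on {0..1} (\<lambda>x. ?w x * cslope x)" by (intro continuous_intros wc)
  show "0 < F x" if x: "0 \<le> x" "x < 1" for x
  proof -
    \<comment> \<open>The subtracted term is the profile for the constant weight
      \<open>?w (1 / 3)\<close>, an arc of an ellipse. Since \<open>slope\<close> changes sign at
      \<open>1 / 3\<close> and the weight is monotone, the difference of the derivatives is nowhere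
      positive, and both profiles vanish at 1.\<close>
    define D where "D = (\<lambda>x. F x - 2 / 3 * ?w (1 / 3) * cslope x)"
    have "D 1 \<le> D x"
    proof (rule DERIV_nonpos_imp_decreasing_open[where f = D and a = x and b = 1])
      show "x \<le> 1" using x by simp
      show "continuous_on {x..1} D"
        unfolding D_def using x by (intro continuous_intros continuous_on_subset[OF assms(2)]) auto
      fix t assume t: "x < t" "t < 1"
      have d: "(D has_real_derivative (?w t - ?w (1 / 3)) * slope t / cslope t) (at t)"
        unfolding D_def using t x cslope_pos[of t]
        by (auto intro!: derivative_eq_intros assms(3) DERIV_cslope simp: field_simps)
      have "(?w t - ?w (1 / 3)) * slope t \<le> 0"
      proof (cases "t \<le> 1 / 3")
        case True
        thus ?thesis using weight_mono[OF assms(1), of t "1 / 3"] t x by (intro mult_nonpos_nonneg) (auto simp: slope_def)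
      next
        case False
        thus ?thesis using weight_mono[OF assms(1), of "1 / 3" t] t x by (intro mult_nonneg_nonpos) (auto simp: slope_def)
      qed
      hence "(?w t - ?w (1 / 3)) * slope t / cslope t \<le> 0"
        using cslope_pos[of t] t x by (simp add: divide_nonpos_pos)
      with d show "\<exists>y. (D has_real_derivative y) (at t) \<and> y \<le> 0" by blast
    qed
    moreover have "D 1 = 0" by (simp add: D_def assms(4))
    moreover have "2 / 3 * ?w (1 / 3) * cslope x > 0"
      using cslope_pos0[OF x] weight_pos[of "1/3" \<alpha>] by simp
    ultimately show ?thesis unfolding D_def by linarith
  qed
  have hi: "((\<lambda>x. ?w x * cslope x) has_integral integral {0..1} (\<lambda>x. ?w x * cslope x)) {0..1}"
    using integrable_continuous_interval[OF wcc] by blast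
  have "integral {0..1} (\<lambda>x. ?w x * cslope x) \<ge> 0"
    by (rule integral_nonneg) (use hi cslope_nonneg weight_nonneg in auto)
  moreover have "integral {0..1} (\<lambda>x. ?w x * cslope x) \<noteq> 0"
  proof
    assume "integral {0..1} (\<lambda>x. ?w x * cslope x) = 0"
    hence "?w (1/2) * cslope (1/2) = 0"
      using has_integral_0_cbox_imp_0[of "0::real" 1 "\<lambda>x. ?w x * cslope x" "1/2"] hi wcc cslope_nonneg weight_nonneg
      by simp
    thus False using cslope_pos[of "1/2"] weight_pos[of "1/2" \<alpha>] by simp
  qed
  ultimately show "0 < integral {0..1} (\<lambda>x. ?w x * cslope x)" by simp
  \<comment> \<open>Chosen so that the singular terms with \<open>slope x / cslope x\<close> cancel
    in the derivative. \<open>E\<close> vanishes at both ends, because \<open>cslope 1 = 0\<close>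
    and \<open>F 1 = 0\<close>.\<close>
  define E where "E = (\<lambda>x. x * ?w x * cslope x - 3 / 2 * (x * F x))"
  have "((\<lambda>x. (\<alpha> + 1) * (?w x * cslope x) - 3 / 2 * F x) has_integral E 1 - E 0) {0..1}"
  proof (rule fundamental_theorem_of_calculus_interior)
    show "continuous_on {0..1} E"
      unfolding E_def by (intro continuous_intros wc assms(2))
    fix x :: real assume "x \<in> {0<..<1}"
    hence x: "0 < x" "x < 1" by auto
    have "((\<lambda>x. (x * ?w x) * cslope x) has_real_derivative
       (\<alpha> + 1) * ?w x * cslope x + (3 / 2 * slope x / cslope x) * (x * ?w x)) (at x)"
      using DERIV_mult[OF DERIV_x_weight[OF x(1) assms(1)] DERIV_cslope[OF x]] .
    moreover have "((\<lambda>x. 3 / 2 * (x * F x)) has_real_derivative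
       3 / 2 * (F x + x * (?w x * slope x / cslope x))) (at x)"
      by (auto intro!: derivative_eq_intros assms(3) x)
    ultimately have "(E has_real_derivative ((\<alpha> + 1) * ?w x * cslope x + (3 / 2 * slope x / cslope x) * (x * ?w x))
        - 3 / 2 * (F x + x * (?w x * slope x / cslope x))) (at x)"
      unfolding E_def by (rule DERIV_diff)
    also have "((\<alpha> + 1) * ?w x * cslope x + (3 / 2 * slope x / cslope x) * (x * ?w x))
        - 3 / 2 * (F x + x * (?w x * slope x / cslope x)) = (\<alpha> + 1) * (?w x * cslope x) - 3 / 2 * F x"
      by (simp add: algebra_simps)
    finally show "(E has_vector_derivative (\<alpha> + 1) * (?w x * cslope x) - 3 / 2 * F x) (at x)"
      by (simp add: has_real_derivative_iff_has_vector_derivative)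
  qed simp
  hence "((\<lambda>x. (\<alpha> + 1) * (?w x * cslope x) - 3 / 2 * F x) has_integral 0) {0..1}"
    by (simp add: E_def assms(4))
  from has_integral_diff[OF has_integral_mult_right[OF hi, of "\<alpha> + 1"] this]
  have "((\<lambda>x. 3 / 2 * F x) has_integral (\<alpha> + 1) * integral {0..1} (\<lambda>x. ?w x * cslope x)) {0..1}"
    by simp
  from has_integral_mult_right[OF this, of "2 / 3"]
  show "(F has_integral 2 / 3 * ((\<alpha> + 1) * integral {0..1} (\<lambda>x. ?w x * cslope x))) {0..1}"
    by simp
qed

text \<open>The Grushin dilations scale \<open>x\<close> by \<open>r\<close>, \<open>y\<close> by
  \<open>r powr (\<alpha> + 1)\<close> and area by \<open>r powr (\<alpha> + 2)\<close>, so
  prescribing the area of the chamber fixes \<open>r\<close>. The graph bounds only the upper half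
  of the chamber, hence \<open>v / 2\<close>.\<close>

lemma model_profile:
  assumes "\<alpha> \<ge> 0" "v > 0"
  defines "\<kappa> \<equiv> integral {0..1} (\<lambda>x. grushin_weight \<alpha> x * cslope x)"
  obtains r f where "r > 0" "continuous_on {0..r} f" "f r = 0" "\<And>x. 0 \<le> x \<Longrightarrow> x < r \<Longrightarrow> 0 < f x"
    "\<And>x. 0 < x \<Longrightarrow> x < r \<Longrightarrow>
      (f has_real_derivative grushin_weight \<alpha> x * slope (x / r) / cslope (x / r)) (at x)"
    "(f has_integral v / 2) {0..r}"
    "((\<lambda>x. grushin_weight \<alpha> x * cslope (x / r)) has_integral r powr (\<alpha> + 1) * \<kappa>) {0..r}"
    "v / 2 = 2 / 3 * (\<alpha> + 1) * \<kappa> * r powr (\<alpha> + 2)"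
proof -
  let ?w = "grushin_weight \<alpha>"
  obtain F where F: "continuous_on {0..1} F"
    "\<And>x. 0 < x \<Longrightarrow> x < 1 \<Longrightarrow> (F has_real_derivative ?w x * slope x / cslope x) (at x)"
    "F 1 = 0"
    using unit_profile[OF assms(1)] by blast
  note P = unit_profile_properties[OF assms(1) F, folded \<kappa>_def]
  \<comment> \<open>The area of the chamber of width 1, that is, twice the integral of
    \<open>F\<close>.\<close>
  define b where "b = 4 / 3 * ((\<alpha> + 1) * \<kappa>)"
  have b: "b > 0" using P(2) assms(1) by (simp add: b_def)
  define r where "r = (v / b) powr (1 / (\<alpha> + 2))"
  have r: "r > 0" using assms b by (simp add: r_def)
  have rv: "r powr (\<alpha> + 2) = v / b"
    using assms b by (simp add: r_def powr_powr)
  define f where "f = (\<lambda>x. r powr (\<alpha> + 1) * F (x / r))"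
  have img: "(\<lambda>x. x / (1 / r)) ` {0..1} = {0..r}"
  proof -
    have "(\<lambda>x. x / (1 / r)) = (*) r" by (simp add: fun_eq_iff)
    thus ?thesis using image_mult_atLeastAtMost[OF r, of 0 1] by (simp only: mult_zero_right mult_1_right)
  qed
  have scale: "((\<lambda>x. g (x / r)) has_integral r * I) {0..r}" if "(g has_integral I) {0..1}" for g :: "real \<Rightarrow> real" and I
    using has_integral_stretch_real[OF that, of "1 / r"] r unfolding img by simp
  have rp: "r powr (\<alpha> + 1) * r = r powr (\<alpha> + 2)" "r powr \<alpha> * r = r powr (\<alpha> + 1)"
    using r by (simp_all add: powr_add power2_eq_square)
  have ws: "r powr \<alpha> * ?w (x / r) = ?w x" for x
    using weight_scale[OF r, of \<alpha> "x / r"] r by simp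
  have wcc: "continuous_on {0..1} (\<lambda>x. ?w x * cslope x)"
    by (intro continuous_intros continuous_on_weight assms(1))
  show ?thesis
  proof (rule that[of r f])
    show "r > 0" by fact
    show "continuous_on {0..r} f"
      unfolding f_def using r
      by (intro continuous_intros continuous_on_compose2[OF F(1)]) auto
    show "f r = 0" using r by (simp add: f_def F(3))
    show "0 < f x" if "0 \<le> x" "x < r" for x
      using P(1)[of "x / r"] that r by (simp add: f_def)
    show "(f has_real_derivative ?w x * slope (x / r) / cslope (x / r)) (at x)" if x: "0 < x" "x < r" for x
    proof -
      have "((\<lambda>x. x / r) has_real_derivative 1 / r) (at x)"
        using r by (auto intro!: derivative_eq_intros)
      from DERIV_cmult[OF DERIV_chain2[OF F(2) this], of "r powr (\<alpha> + 1)"]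
      have "(f has_real_derivative r powr (\<alpha> + 1) * (?w (x / r) * slope (x / r) / cslope (x / r) * (1 / r))) (at x)"
        unfolding f_def using x r by simp
      also have "r powr (\<alpha> + 1) * (?w (x / r) * slope (x / r) / cslope (x / r) * (1 / r))
          = (r powr \<alpha> * ?w (x / r)) * slope (x / r) / cslope (x / r)"
        using r by (simp flip: rp(2))
      finally show ?thesis unfolding ws .
    qed
    show "(f has_integral v / 2) {0..r}"
    proof -
      have "(f has_integral r powr (\<alpha> + 1) * (r * (2 / 3 * ((\<alpha> + 1) * \<kappa>)))) {0..r}"
        unfolding f_def by (intro has_integral_mult_right scale P(3))
      also have "r powr (\<alpha> + 1) * (r * (2 / 3 * ((\<alpha> + 1) * \<kappa>))) = r powr (\<alpha> + 2) * (b / 2)"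
        by (simp add: b_def flip: rp(1))
      finally show ?thesis unfolding rv using b by simp
    qed
    show "((\<lambda>x. ?w x * cslope (x / r)) has_integral r powr (\<alpha> + 1) * \<kappa>) {0..r}"
    proof -
      have "((\<lambda>x. ?w x * cslope x) has_integral \<kappa>) {0..1}"
        unfolding \<kappa>_def by (rule integrable_integral[OF integrable_continuous_interval[OF wcc]])
      from has_integral_mult_right[OF scale[OF this], of "r powr \<alpha>"]
      have "((\<lambda>x. r powr \<alpha> * ?w (x / r) * cslope (x / r)) has_integral r powr \<alpha> * r * \<kappa>) {0..r}"
        by (simp only: mult.assoc)
      thus ?thesis unfolding ws rp .
    qed
    show "v / 2 = 2 / 3 * (\<alpha> + 1) * \<kappa> * r powr (\<alpha> + 2)"
    proof -
      have "2 / 3 * (\<alpha> + 1) * \<kappa> = b / 2" by (simp add: b_def)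
      hence "2 / 3 * (\<alpha> + 1) * \<kappa> * r powr (\<alpha> + 2) = b / 2 * (v / b)" by (simp only: rv)
      thus ?thesis using b by simp
    qed
  qed
qed

text \<open>The hypothesis on \<open>v\<close> is the stationarity condition in \<rho> at
  \<open>r\<close>. For \<open>t = \<rho> / r\<close> the claim reduces to \<open>\<alpha> + 2 \<le>
  t powr (\<alpha> + 1) + (\<alpha> + 1) / t\<close>, which is Young's inequality for
  \<open>t * 1\<close> with exponent \<open>\<alpha> + 2\<close>.\<close>

lemma optimal_width:
  fixes \<alpha> r \<rho> \<kappa> v :: real
  assumes "\<alpha> \<ge> 0" "r > 0" "\<rho> > 0" "\<kappa> > 0"
    "v / 2 = 2 / 3 * (\<alpha> + 1) * \<kappa> * r powr (\<alpha> + 2)"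
  shows "3 / (2 * r) * v + 2 * (r powr (\<alpha> + 1) * \<kappa>) \<le> 3 / (2 * \<rho>) * v + 2 * (\<rho> powr (\<alpha> + 1) * \<kappa>)"
proof -
  define p where "p = \<alpha> + 2"
  define t where "t = \<rho> / r"
  have t: "t > 0" "\<rho> = t * r" using assms by (auto simp: t_def)
  have "t * 1 \<le> t powr p / p + 1 powr (p / (p - 1)) / (p / (p - 1))"
    using assms(1) t(1) by (intro Youngs_inequality) (auto simp: p_def field_simps)
  hence "t \<le> (t powr p + (p - 1)) / p"
    by (simp add: add_divide_distrib)
  moreover have "p > 0" using assms(1) by (simp add: p_def)
  ultimately have "p * t \<le> t powr p + (p - 1)"
    by (simp add: pos_le_divide_eq mult.commute)
  also have "t powr p = t * t powr (\<alpha> + 1)"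
    using t(1) by (simp add: p_def powr_mult_base add.commute)
  finally have "(\<alpha> + 2) \<le> t powr (\<alpha> + 1) + (\<alpha> + 1) / t"
    using t(1) by (simp add: p_def field_simps)
  hence *: "2 * (r powr (\<alpha> + 1) * \<kappa>) * (\<alpha> + 2) \<le> 2 * (r powr (\<alpha> + 1) * \<kappa>) * (t powr (\<alpha> + 1) + (\<alpha> + 1) / t)"
    using assms(4) by (intro mult_left_mono) auto
  have rp: "r powr (\<alpha> + 2) = r * r powr (\<alpha> + 1)"
    using assms(2) by (simp add: powr_mult_base add.commute)
  have v: "v = 4 / 3 * (\<alpha> + 1) * \<kappa> * (r * r powr (\<alpha> + 1))"
    using assms(5) rp by simp
  have l: "3 / (2 * r) * v + 2 * (r powr (\<alpha> + 1) * \<kappa>) = 2 * (r powr (\<alpha> + 1) * \<kappa>) * (\<alpha> + 2)"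
    unfolding v using assms(2) by (simp add: field_simps)
  have rhs: "3 / (2 * \<rho>) * v + 2 * (\<rho> powr (\<alpha> + 1) * \<kappa>) = 2 * (r powr (\<alpha> + 1) * \<kappa>) * (t powr (\<alpha> + 1) + (\<alpha> + 1) / t)"
    unfolding v t(2) using assms(2) t(1) by (simp add: field_simps powr_mult)
  from * show ?thesis unfolding l rhs .
qed

section \<open>Divergence theorem for regions under a graph\<close>

lemma null_sets_line: "{z :: real \<times> real. fst z = c} \<in> null_sets lebesgue"
proof -
  have "negligible {z :: real \<times> real. (1, 0) \<bullet> z = c}"
    by (rule negligible_hyperplane) (auto simp: zero_prod_def)
  thus ?thesis by (simp add: negligible_iff_null_sets inner_prod_def)
qed

lemma half_planes_measurable:
  "{z :: real \<times> real. fst z > 0} \<in> sets lebesgue" "{z :: real \<times> real. fst z < 0} \<in> sets lebesgue"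
proof -
  have "open {z :: real \<times> real. fst z > 0}" "open {z :: real \<times> real. fst z < 0}"
    by (intro open_Collect_less continuous_intros)+
  thus "{z :: real \<times> real. fst z > 0} \<in> sets lebesgue" "{z :: real \<times> real. fst z < 0} \<in> sets lebesgue"
    by (auto intro: borel_open)
qed

lemma pos_x_alt: "pos_x F = F \<inter> {z. fst z > 0}" by (auto simp: pos_x_def)

lemma neg_x_alt: "neg_x F = F \<inter> {z. fst z < 0}" by (auto simp: neg_x_def)

lemma pos_neg_measurable:
  assumes "F \<in> sets lebesgue"
  shows "pos_x F \<in> sets lebesgue" "neg_x F \<in> sets lebesgue"
  using assms half_planes_measurable by (auto simp: pos_x_alt neg_x_alt)

lemma integral_split_x:
  fixes h :: "real \<times> real \<Rightarrow> real"
  assumes "F \<in> sets lebesgue" "set_integrable lebesgue F h"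
  shows "set_lebesgue_integral lebesgue F h =
    set_lebesgue_integral lebesgue (pos_x F) h + set_lebesgue_integral lebesgue (neg_x F) h"
proof -
  note m = pos_neg_measurable[OF assms(1)]
  have "AE z :: real \<times> real in lebesgue. fst z \<noteq> 0"
    using AE_not_in[OF null_sets_line[of 0]] by simp
  hence ae: "AE z in lebesgue. indicator F z *\<^sub>R h z =
      indicator (pos_x F) z *\<^sub>R h z + indicator (neg_x F) z *\<^sub>R h z"
    by eventually_elim (auto simp: pos_x_def neg_x_def indicator_def)
  have i: "integrable lebesgue (\<lambda>z. indicator (pos_x F) z *\<^sub>R h z)"
    "integrable lebesgue (\<lambda>z. indicator (neg_x F) z *\<^sub>R h z)"
    using set_integrable_subset[OF assms(2) m(1)] set_integrable_subset[OF assms(2) m(2)]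
    by (auto simp: set_integrable_def pos_x_def neg_x_def)
  have "(\<integral>z. indicator F z *\<^sub>R h z \<partial>lebesgue) =
      (\<integral>z. indicator (pos_x F) z *\<^sub>R h z + indicator (neg_x F) z *\<^sub>R h z \<partial>lebesgue)"
    using assms(2) i ae
    by (intro integral_cong_AE) (auto simp: set_integrable_def)
  also have "\<dots> = (\<integral>z. indicator (pos_x F) z *\<^sub>R h z \<partial>lebesgue) + (\<integral>z. indicator (neg_x F) z *\<^sub>R h z \<partial>lebesgue)"
    by (rule Bochner_Integration.integral_add[OF i])
  finally show ?thesis by (simp add: set_lebesgue_integral_def)
qed

definition half_region :: "(real \<Rightarrow> real) \<Rightarrow> real \<Rightarrow> (real \<times> real) set" where
  "half_region f r = {(x, y). 0 < x \<and> x < r \<and> \<bar>y\<bar> < f x}"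

lemma open_half_region:
  assumes "continuous_on {0..r} f"
  shows "open (half_region f r)"
proof -
  have "continuous_on ({0<..<r} \<times> UNIV) (\<lambda>z :: real \<times> real. f (fst z) - \<bar>snd z\<bar>)"
    by (intro continuous_intros continuous_on_compose2[OF assms]) auto
  hence "open (({0<..<r} \<times> UNIV) \<inter> (\<lambda>z :: real \<times> real. f (fst z) - \<bar>snd z\<bar>) -` {0<..})"
    by (rule continuous_open_preimage) (auto intro: open_Times)
  also have "({0<..<r} \<times> UNIV) \<inter> (\<lambda>z :: real \<times> real. f (fst z) - \<bar>snd z\<bar>) -` {0<..} = half_region f r"
    by (auto simp: half_region_def)
  finally show ?thesis .
qed

lemma bounded_half_region:
  assumes "continuous_on {0..r} f"
  obtains M where "M > 0" "\<And>x. 0 \<le> x \<Longrightarrow> x \<le> r \<Longrightarrow> \<bar>f x\<bar> \<le> M" "half_region f r \<subseteq> cbox (0, - M) (r, M)"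
proof -
  have "compact (f ` {0..r})" by (intro compact_continuous_image assms compact_Icc)
  then obtain M where M: "M > 0" "\<And>x. x \<in> {0..r} \<Longrightarrow> \<bar>f x\<bar> \<le> M"
    by (metis bounded_pos compact_imp_bounded image_eqI real_norm_def)
  have "half_region f r \<subseteq> cbox (0, - M) (r, M)"
  proof
    fix z assume "z \<in> half_region f r"
    thus "z \<in> cbox (0, - M) (r, M)" using M(2)[of "fst z"] by (cases z) (auto simp: half_region_def cbox_Pair_eq)
  qed
  with M that show ?thesis by auto
qed

text \<open>Fubini, with the outer integral stated as a gauge integral: it is later compared with a
  majorant that comes from the fundamental theorem and may be unbounded near
  \<open>x = r\<close>.\<close>

lemma has_integral_half_region:
  fixes h :: "real \<times> real \<Rightarrow> real"
  assumes "continuous_on {0..r} f" "continuous_on UNIV h"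
  shows "((\<lambda>x. integral {- f x..f x} (\<lambda>y. h (x, y))) has_integral
    set_lebesgue_integral lebesgue (half_region f r) h) {0<..<r}"
proof -
  let ?E = "half_region f r"
  obtain M where M: "M > 0" "\<And>x. 0 \<le> x \<Longrightarrow> x \<le> r \<Longrightarrow> \<bar>f x\<bar> \<le> M" "?E \<subseteq> cbox (0, - M) (r, M)"
    using bounded_half_region[OF assms(1)] by blast
  have Eb: "?E \<in> sets borel" using open_half_region[OF assms(1)] by (rule borel_open)
  have hb: "h \<in> borel_measurable borel" using assms(2) by (rule borel_measurable_continuous_onI)
  define k where "k = (\<lambda>z. indicator ?E z *\<^sub>R h z)"
  have "integrable lborel (\<lambda>z. indicator (cbox (0, - M) (r, M)) z *\<^sub>R h z)"
    by (intro borel_integrable_compact compact_cbox continuous_on_subset[OF assms(2)]) auto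
  hence "integrable lborel (\<lambda>z. indicator ?E z *\<^sub>R (indicator (cbox (0, - M) (r, M)) z *\<^sub>R h z))"
    by (rule integrable_mult_indicator[rotated]) (use Eb in simp)
  also have "(\<lambda>z. indicator ?E z *\<^sub>R (indicator (cbox (0, - M) (r, M)) z *\<^sub>R h z)) = k"
    using M(3) by (auto simp: k_def indicator_def fun_eq_iff)
  finally have ki: "integrable (lborel \<Otimes>\<^sub>M lborel) k" by (simp add: lborel_prod)
  have kb: "k \<in> borel_measurable lborel"
    unfolding k_def using Eb hb by measurable
  have "set_lebesgue_integral lebesgue ?E h = integral\<^sup>L lborel k"
    unfolding set_lebesgue_integral_def using integral_completion[OF kb] by (simp add: k_def)
  also have "\<dots> = (\<integral>x. (\<integral>y. k (x, y) \<partial>lborel) \<partial>lborel)"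
    using lborel_pair.integral_fst'[OF ki] by (simp add: lborel_prod)
  finally have eq: "set_lebesgue_integral lebesgue ?E h = (\<integral>x. (\<integral>y. k (x, y) \<partial>lborel) \<partial>lborel)" .
  have inner: "(\<integral>y. k (x, y) \<partial>lborel) = (if x \<in> {0<..<r} then integral {- f x..f x} (\<lambda>y. h (x, y)) else 0)" for x
  proof (cases "x \<in> {0<..<r}")
    case True
    have "(\<lambda>y. k (x, y)) = (\<lambda>y. indicator {- f x<..<f x} y *\<^sub>R h (x, y))"
      using True by (auto simp: k_def half_region_def indicator_def fun_eq_iff abs_less_iff)
    moreover have "set_integrable lborel {- f x<..<f x} (\<lambda>y. h (x, y))"
    proof -
      have "set_integrable lborel {- f x..f x} (\<lambda>y. h (x, y))"
        unfolding set_integrable_def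
        by (intro borel_integrable_compact compact_Icc continuous_on_compose2[OF assms(2)] continuous_intros) auto
      thus ?thesis by (rule set_integrable_subset) auto
    qed
    ultimately have "(\<integral>y. k (x, y) \<partial>lborel) = integral {- f x<..<f x} (\<lambda>y. h (x, y))"
      using set_borel_integral_eq_integral(2) unfolding set_lebesgue_integral_def by metis
    also have "\<dots> = integral {- f x..f x} (\<lambda>y. h (x, y))"
      using integral_open_interval[of "- f x" "f x" "\<lambda>y. h (x, y)"] by simp
    finally show ?thesis using True by simp
  next
    case False
    hence "(\<lambda>y. k (x, y)) = (\<lambda>y. 0)" by (auto simp: k_def half_region_def indicator_def)
    thus ?thesis unfolding if_not_P[OF False] by simp
  qed
  have "integrable lborel (\<lambda>x. \<integral>y. k (x, y) \<partial>lborel)"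
    using lborel_pair.integrable_fst'[OF ki] .
  from has_integral_integral_lborel[OF this]
  show ?thesis unfolding eq inner has_integral_restrict_UNIV .
qed

lemma half_region_measure:
  assumes "continuous_on {0..r} f" "\<And>x. 0 \<le> x \<Longrightarrow> x < r \<Longrightarrow> 0 < f x" "(f has_integral v / 2) {0..r}"
  shows "half_region f r \<in> sets lebesgue" "emeasure lebesgue (half_region f r) = ennreal v"
proof -
  have L: "half_region f r \<in> lmeasurable"
    using open_half_region[OF assms(1)] bounded_half_region[OF assms(1)] bounded_cbox bounded_subset
    by (metis lmeasurable_open)
  thus "half_region f r \<in> sets lebesgue" by auto
  have "((\<lambda>x. integral {- f x..f x} (\<lambda>y. 1 :: real)) has_integral
      set_lebesgue_integral lebesgue (half_region f r) (\<lambda>_. 1 :: real)) {0<..<r}"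
    by (rule has_integral_half_region[OF assms(1), of "\<lambda>_. 1"]) simp
  moreover have "((\<lambda>x. integral {- f x..f x} (\<lambda>y. 1 :: real)) has_integral v) {0<..<r}"
  proof (rule has_integral_eq)
    show "((\<lambda>x. 2 * f x) has_integral v) {0<..<r}"
      using has_integral_mult_right[OF assms(3), of 2] by (simp add: has_integral_Icc_iff_Ioo)
    show "2 * f x = integral {- f x..f x} (\<lambda>y. 1 :: real)" if "x \<in> {0<..<r}" for x
      using assms(2)[of x] that by simp
  qed
  ultimately have "set_lebesgue_integral lebesgue (half_region f r) (\<lambda>_. 1 :: real) = v"
    by (rule has_integral_unique)
  hence "measure lebesgue (half_region f r) = v" using L by (simp add: set_lebesgue_integral_def)
  thus "emeasure lebesgue (half_region f r) = ennreal v" using L by (simp add: emeasure_eq_measure2)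
qed

lemma unit_vectors_inner_le:
  fixes a b c d :: real
  assumes "a\<^sup>2 + b\<^sup>2 = 1" "c\<^sup>2 + d\<^sup>2 \<le> 1"
  shows "a * c + b * d \<le> 1"
proof -
  have "0 \<le> (a - c)\<^sup>2 + (b - d)\<^sup>2" by simp
  thus ?thesis using assms by (simp add: power2_diff)
qed

text \<open>Apart from the trace on \<open>x = 0\<close>, the bound is the Grushin length of the
  curved boundary. For sine \<open>s\<close> and cosine \<open>c\<close> the length element of each
  arc is \<open>w / c = w * c + s * f'\<close>; integrating \<open>2 * s * f'\<close> by parts gives
  \<open>- f 0 + 3 / (2 * r) * v\<close>, since \<open>s\<close> is \<open>1 / 2\<close> at 0 and
  \<open>f r = 0\<close>.\<close>

lemma gauss_green_half_region:
  assumes "\<alpha> \<ge> 0" "r > 0" "continuous_on {0..r} f" "f r = 0" "\<And>x. 0 \<le> x \<Longrightarrow> x < r \<Longrightarrow> 0 < f x"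
    and f': "\<And>x. 0 < x \<Longrightarrow> x < r \<Longrightarrow>
      (f has_real_derivative grushin_weight \<alpha> x * slope (x / r) / cslope (x / r)) (at x)"
    and fi: "(f has_integral v / 2) {0..r}"
    and ki: "((\<lambda>x. grushin_weight \<alpha> x * cslope (x / r)) has_integral k) {0..r}"
    and t: "\<phi>\<^sub>1 \<in> test_functions" "\<phi>\<^sub>2 \<in> test_functions" "\<And>z. (\<phi>\<^sub>1 z)\<^sup>2 + (\<phi>\<^sub>2 z)\<^sup>2 \<le> 1"
  shows "set_lebesgue_integral lebesgue (half_region f r) (grushin_div \<alpha> \<phi>\<^sub>1 \<phi>\<^sub>2)
    \<le> 2 * k - f 0 + 3 / (2 * r) * v - integral {- f 0..f 0} (\<lambda>y. \<phi>\<^sub>1 (0, y))"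
proof -
  let ?w = "grushin_weight \<alpha>"
  define g where "g = partial_x \<phi>\<^sub>1"
  define h where "h = partial_y \<phi>\<^sub>1"
  obtain g2 where 1: "C1 \<phi>\<^sub>1 g h" and 2: "C1 \<phi>\<^sub>2 g2 (partial_y \<phi>\<^sub>2)"
    unfolding g_def h_def using test_functionsE t(1,2) by metis
  define Q where "Q = (\<lambda>z. integral {0..1} (\<lambda>t. snd z * \<phi>\<^sub>1 (fst z, t * snd z)))"
  define Qx where "Qx = (\<lambda>z. integral {0..1} (\<lambda>t. snd z * g (fst z, t * snd z)))"
  have Q: "C1 Q Qx \<phi>\<^sub>1" unfolding Q_def Qx_def by (rule C1_antiderivative_y[OF 1])
  have Q0: "Q (x, f x) - Q (x, - f x) = integral {- f x..f x} (\<lambda>y. \<phi>\<^sub>1 (x, y))" if "0 \<le> x" "x < r" for x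
    unfolding Q_def fst_conv snd_conv
    by (rule integral_rescale_symmetric[of "\<lambda>y. \<phi>\<^sub>1 (x, y)"])
      (use assms(5)[OF that] in \<open>auto intro!: continuous_on_compose2[OF C1_continuous[OF 1, of UNIV]] continuous_intros\<close>)
  have Q1: "Qx (x, f x) - Qx (x, - f x) = integral {- f x..f x} (\<lambda>y. g (x, y))" if "0 \<le> x" "x < r" for x
    unfolding Qx_def fst_conv snd_conv
    by (rule integral_rescale_symmetric[of "\<lambda>y. g (x, y)"])
      (use assms(5)[OF that] in \<open>auto intro!: continuous_on_compose2[OF C1_continuous_x[OF 1, of UNIV]] continuous_intros\<close>)
  define f1 where "f1 = (\<lambda>x. ?w x * slope (x / r) / cslope (x / r))"
  \<comment> \<open>The difference of the two values of \<open>Q\<close> is the integral of the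
    first component over the vertical section; the last term carries out the integration by parts.
    Continuity up to \<open>x = r\<close> is enough for the fundamental theorem, although
    \<open>f1\<close> may be singular there.\<close>
  define \<Phi> where "\<Phi> = (\<lambda>x. Q (x, f x) - Q (x, - f x) + 2 * (slope (x / r) * f x))"
  define \<Phi>' where "\<Phi>' = (\<lambda>x. Qx (x, f x) - Qx (x, - f x) + f1 x * (\<phi>\<^sub>1 (x, f x) + \<phi>\<^sub>1 (x, - f x))
     + 2 * (- (3 / (2 * r)) * f x + slope (x / r) * f1 x))"
  have FTC: "(\<Phi>' has_integral \<Phi> r - \<Phi> 0) {0..r}"
  proof (rule fundamental_theorem_of_calculus_interior)
    have c: "continuous_on {0..r} (\<lambda>x. Q (x, u x))" if "continuous_on {0..r} u" for u
      by (intro continuous_on_compose2[OF C1_continuous[OF Q, of UNIV]] continuous_intros that) auto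
    show "continuous_on {0..r} \<Phi>" unfolding \<Phi>_def using assms(2)
      by (intro continuous_intros c assms(3)) auto
    fix x assume "x \<in> {0<..<r}"
    hence x: "0 < x" "x < r" by auto
    have fd: "(f has_real_derivative f1 x) (at x)" using f'[OF x] by (simp add: f1_def)
    have s: "((\<lambda>x. slope (x / r)) has_real_derivative - (3 / (2 * r))) (at x)"
      unfolding slope_def using assms(2) by (auto intro!: derivative_eq_intros)
    have a: "((\<lambda>x. Q (x, f x)) has_real_derivative Qx (x, f x) * 1 + \<phi>\<^sub>1 (x, f x) * f1 x) (at x)"
      by (rule C1_chain[OF Q DERIV_ident fd])
    have b: "((\<lambda>x. Q (x, - f x)) has_real_derivative Qx (x, - f x) * 1 + \<phi>\<^sub>1 (x, - f x) * (- f1 x)) (at x)"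
      by (rule C1_chain[OF Q DERIV_ident DERIV_minus[OF fd]])
    have "(\<Phi> has_real_derivative (Qx (x, f x) * 1 + \<phi>\<^sub>1 (x, f x) * f1 x) - (Qx (x, - f x) * 1 + \<phi>\<^sub>1 (x, - f x) * (- f1 x))
       + 2 * (- (3 / (2 * r)) * f x + f1 x * slope (x / r))) (at x)"
      unfolding \<Phi>_def by (intro DERIV_add DERIV_diff a b DERIV_cmult DERIV_mult[OF s fd])
    thus "(\<Phi> has_vector_derivative \<Phi>' x) (at x)"
      unfolding has_real_derivative_iff_has_vector_derivative[symmetric] \<Phi>'_def by (simp add: algebra_simps)
  qed (use assms(2) in simp)
  have \<Phi>r: "\<Phi> r = 0" by (simp add: \<Phi>_def assms(4))
  have \<Phi>0: "\<Phi> 0 = integral {- f 0..f 0} (\<lambda>y. \<phi>\<^sub>1 (0, y)) + f 0"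
    using Q0[of 0] assms(2) by (simp add: \<Phi>_def slope_def)
  have "((\<lambda>x. \<Phi>' x + 2 * (?w x * cslope (x / r)) + 3 / r * f x) has_integral
      (\<Phi> r - \<Phi> 0) + 2 * k + 3 / r * (v / 2)) {0..r}"
    by (intro has_integral_add FTC has_integral_mult_right ki fi)
  hence major: "((\<lambda>x. \<Phi>' x + 2 * (?w x * cslope (x / r)) + 3 / r * f x) has_integral
      (\<Phi> r - \<Phi> 0) + 2 * k + 3 / r * (v / 2)) {0<..<r}"
    by (simp add: has_integral_Icc_iff_Ioo)
  have dc: "continuous_on UNIV (grushin_div \<alpha> \<phi>\<^sub>1 \<phi>\<^sub>2)"
    by (rule continuous_on_grushin_div[OF assms(1) 1 2])
  have "set_lebesgue_integral lebesgue (half_region f r) (grushin_div \<alpha> \<phi>\<^sub>1 \<phi>\<^sub>2)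
      \<le> (\<Phi> r - \<Phi> 0) + 2 * k + 3 / r * (v / 2)"
  proof (rule has_integral_le[OF has_integral_half_region[OF assms(3) dc] major])
    fix x assume "x \<in> {0<..<r}"
    hence x: "0 < x" "x < r" by auto
    have fx: "f x > 0" using assms(5) x by simp
    have cx: "cslope (x / r) > 0" "(slope (x / r))\<^sup>2 + (cslope (x / r))\<^sup>2 = 1"
      using cslope_pos[of "x / r"] slope_cslope[of "x / r"] x by auto
    have gi: "(\<lambda>y. g (x, y)) integrable_on {- f x..f x}"
      by (intro integrable_continuous_interval continuous_on_compose2[OF C1_continuous_x[OF 1, of UNIV]] continuous_intros) auto
    have hi: "((\<lambda>y. partial_y \<phi>\<^sub>2 (x, y)) has_integral \<phi>\<^sub>2 (x, f x) - \<phi>\<^sub>2 (x, - f x)) {- f x..f x}"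
      using fx C1_DERIV_y[OF 2]
      by (intro fundamental_theorem_of_calculus) (auto simp: has_real_derivative_iff_has_vector_derivative)
    have "((\<lambda>y. grushin_div \<alpha> \<phi>\<^sub>1 \<phi>\<^sub>2 (x, y)) has_integral
        integral {- f x..f x} (\<lambda>y. g (x, y)) + ?w x * (\<phi>\<^sub>2 (x, f x) - \<phi>\<^sub>2 (x, - f x))) {- f x..f x}"
      unfolding grushin_div_def fst_conv g_def[symmetric]
      by (intro has_integral_add has_integral_mult_right hi integrable_integral gi)
    hence L: "integral {- f x..f x} (\<lambda>y. grushin_div \<alpha> \<phi>\<^sub>1 \<phi>\<^sub>2 (x, y))
        = Qx (x, f x) - Qx (x, - f x) + ?w x * (\<phi>\<^sub>2 (x, f x) - \<phi>\<^sub>2 (x, - f x))"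
      using Q1[of x] x by (simp add: integral_unique)
    let ?s = "slope (x / r)" and ?c = "cslope (x / r)"
    \<comment> \<open>The length element of one arc. As \<open>f1\<close> and the weight are
      \<open>q\<close> times sine and cosine, the pointwise comparison is Cauchy-Schwarz with the
      unit normals \<open>(- ?s, ?c)\<close> and \<open>(- ?s, - ?c)\<close>.\<close>
    define q where "q = ?w x / ?c"
    have q: "q \<ge> 0" "f1 x = q * ?s" "?w x = q * ?c"
      using cx(1) weight_nonneg[of \<alpha> x] by (auto simp: q_def f1_def)
    have u: "- ?s * \<phi>\<^sub>1 (x, f x) + ?c * \<phi>\<^sub>2 (x, f x) \<le> 1"
      by (rule unit_vectors_inner_le) (use cx(2) t(3) in auto)
    have l: "- ?s * \<phi>\<^sub>1 (x, - f x) + (- ?c) * \<phi>\<^sub>2 (x, - f x) \<le> 1"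
      by (rule unit_vectors_inner_le) (use cx(2) t(3) in auto)
    have "q * (- ?s * \<phi>\<^sub>1 (x, f x) + ?c * \<phi>\<^sub>2 (x, f x) + (- ?s * \<phi>\<^sub>1 (x, - f x) + (- ?c) * \<phi>\<^sub>2 (x, - f x)))
        \<le> q * (2 * (?s\<^sup>2 + ?c\<^sup>2))"
      using u l cx(2) by (intro mult_left_mono q(1)) auto
    moreover have "\<Phi>' x + 2 * (?w x * ?c) + 3 / r * f x
        = Qx (x, f x) - Qx (x, - f x) + f1 x * (\<phi>\<^sub>1 (x, f x) + \<phi>\<^sub>1 (x, - f x)) + 2 * (?s * f1 x + ?w x * ?c)"
      using assms(2) by (simp add: \<Phi>'_def field_simps)
    ultimately show "integral {- f x..f x} (\<lambda>y. grushin_div \<alpha> \<phi>\<^sub>1 \<phi>\<^sub>2 (x, y))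
        \<le> \<Phi>' x + 2 * (?w x * cslope (x / r)) + 3 / r * f x"
      unfolding L q(2,3) by (simp add: algebra_simps power2_eq_square)
  qed
  thus ?thesis unfolding \<Phi>r \<Phi>0 by simp
qed

section \<open>Closing gaps\<close>

text \<open>\<open>\<tau>\<close> closes the gaps of the density \<open>a\<close>: it moves the mass \<open>w a dx\<close> monotonically towards
  \<open>x = \<epsilon>\<close>, where the weight \<open>w\<close> is smaller.\<close>

lemma gap_closing_map:
  fixes a :: "real \<Rightarrow> real"
  assumes "\<alpha> \<ge> 0" "\<epsilon> > 0" "continuous_on UNIV a" "\<And>x. 0 \<le> a x" "\<And>x. a x \<le> 1"
    "\<And>x. x \<le> \<epsilon> \<or> R \<le> x \<Longrightarrow> a x = 0"
  obtains \<tau> \<tau>' where "\<And>x. (\<tau> has_real_derivative \<tau>' x) (at x)" "continuous_on UNIV \<tau>'"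
    "\<And>x. x \<le> \<epsilon> \<Longrightarrow> \<tau> x = \<epsilon>" "\<And>x. R \<le> x \<Longrightarrow> \<tau> x = \<tau> R" "mono \<tau>" "\<And>x. a x \<le> \<tau>' x"
    "\<And>x. grushin_weight \<alpha> (\<tau> x) * \<tau>' x = grushin_weight \<alpha> x * a x"
proof -
  let ?w = "grushin_weight \<alpha>"
  have wac: "continuous_on UNIV (\<lambda>x. (\<alpha> + 1) * (?w x * a x))"
    by (intro continuous_intros continuous_on_weight assms(1,3))
  then obtain M where M: "\<And>x. (M has_real_derivative (\<alpha> + 1) * (?w x * a x)) (at x)"
    using global_antiderivative by blast
  \<comment> \<open>The equation \<open>w (\<tau>) * \<tau>' = w * a\<close> says that
    \<open>\<tau> powr (\<alpha> + 1)\<close> has derivative \<open>(\<alpha> + 1) * w * a\<close>.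
    So \<open>m\<close> is this power, started at \<open>\<tau> \<epsilon> = \<epsilon>\<close>, and
    \<tau> is recovered as its root.\<close>
  define m where "m = (\<lambda>x. M x - M \<epsilon> + \<epsilon> powr (\<alpha> + 1))"
  have m': "(m has_real_derivative (\<alpha> + 1) * (?w x * a x)) (at x)" for x
    unfolding m_def by (auto intro!: derivative_eq_intros M)
  have mc: "continuous_on S m" for S
    by (rule DERIV_continuous_on) (rule has_field_derivative_at_within[OF m'])
  have nn: "0 \<le> (\<alpha> + 1) * (?w x * a x)" for x
    using assms(1,4) weight_nonneg[of \<alpha> x] by simp
  have mono_m: "m x \<le> m y" if "x \<le> y" for x y
    by (rule DERIV_nonneg_imp_nondecreasing[OF that]) (use m' nn in blast)
  have const: "m x = m y" if "x \<le> y" "\<And>t. x \<le> t \<Longrightarrow> t \<le> y \<Longrightarrow> a t = 0" for x y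
  proof -
    have "m y \<le> m x"
      by (rule DERIV_nonpos_imp_nonincreasing[OF that(1)]) (use m' that(2) in \<open>metis mult_zero_right order_refl\<close>)
    thus ?thesis using mono_m[OF that(1)] by simp
  qed
  have m\<epsilon>: "m \<epsilon> = \<epsilon> powr (\<alpha> + 1)" by (simp add: m_def)
  have m_le: "m x = \<epsilon> powr (\<alpha> + 1)" if "x \<le> \<epsilon>" for x
    using const[OF that] assms(6) m\<epsilon> by auto
  have m_pos: "m x > 0" for x
  proof -
    have "m x \<ge> \<epsilon> powr (\<alpha> + 1)"
      using mono_m[of \<epsilon> x] m_le[of x] m\<epsilon> by (cases "x \<le> \<epsilon>") auto
    thus ?thesis using assms(2) by (smt (verit) powr_gt_zero)
  qed
  \<comment> \<open>Since \<open>a \<le> 1\<close>, the map never overtakes the identity: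
    \<open>\<tau> x \<le> x\<close> for \<open>x \<ge> \<epsilon>\<close>. Then the weight at
    \<open>\<tau> x\<close> is at most the weight at \<open>x\<close>, which gives
    \<open>a \<le> \<tau>'\<close>.\<close>
  have m_ub: "m x \<le> x powr (\<alpha> + 1)" if "\<epsilon> \<le> x" for x
  proof -
    have "\<epsilon> powr (\<alpha> + 1) - m \<epsilon> \<le> x powr (\<alpha> + 1) - m x"
    proof (rule DERIV_nonneg_imp_nondecreasing[OF that])
      fix t assume t: "\<epsilon> \<le> t" "t \<le> x"
      have "((\<lambda>t. t powr (\<alpha> + 1) - m t) has_real_derivative (\<alpha> + 1) * ?w t - (\<alpha> + 1) * (?w t * a t)) (at t)"
        using t assms(2) by (auto intro!: derivative_eq_intros m' simp: weight_eq_powr)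
      moreover have "(\<alpha> + 1) * ?w t * (1 - a t) \<ge> 0"
        using assms(1) assms(5)[of t] weight_nonneg[of \<alpha> t] by (intro mult_nonneg_nonneg) auto
      ultimately show "\<exists>y. ((\<lambda>t. t powr (\<alpha> + 1) - m t) has_real_derivative y) (at t) \<and> 0 \<le> y"
        by (intro exI[of _ "(\<alpha> + 1) * ?w t - (\<alpha> + 1) * (?w t * a t)"]) (auto simp: algebra_simps)
    qed
    thus ?thesis using m\<epsilon> by simp
  qed
  define \<tau> where "\<tau> = (\<lambda>x. m x powr (1 / (\<alpha> + 1)))"
  define \<tau>' where "\<tau>' = (\<lambda>x. ?w x * a x * m x powr (1 / (\<alpha> + 1) - 1))"
  have \<tau>pos: "\<tau> x > 0" for x using m_pos[of x] by (simp add: \<tau>_def)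
  have d: "(\<tau> has_real_derivative \<tau>' x) (at x)" for x
  proof -
    have "(\<tau> has_real_derivative 1 / (\<alpha> + 1) * m x powr (1 / (\<alpha> + 1) - 1) * ((\<alpha> + 1) * (?w x * a x))) (at x)"
      unfolding \<tau>_def by (rule DERIV_chain2[OF has_real_derivative_powr[OF m_pos] m'])
    also have "1 / (\<alpha> + 1) * m x powr (1 / (\<alpha> + 1) - 1) * ((\<alpha> + 1) * (?w x * a x)) = \<tau>' x"
      using assms(1) by (simp add: \<tau>'_def)
    finally show ?thesis .
  qed
  have e: "?w (\<tau> x) * \<tau>' x = ?w x * a x" for x
  proof -
    have exp0: "\<alpha> / (\<alpha> + 1) + (1 / (\<alpha> + 1) - 1) = 0" using assms(1) by (simp add: field_simps)
    have "?w (\<tau> x) * m x powr (1 / (\<alpha> + 1) - 1) = m x powr (\<alpha> / (\<alpha> + 1)) * m x powr (1 / (\<alpha> + 1) - 1)"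
      using \<tau>pos[of x] by (simp add: weight_eq_powr) (simp add: \<tau>_def powr_powr)
    also have "\<dots> = 1" using m_pos[of x] by (simp add: exp0 flip: powr_add)
    finally show ?thesis by (simp add: \<tau>'_def algebra_simps)
  qed
  show ?thesis
  proof (rule that[OF d _ _ _ _ _ e])
    show "continuous_on UNIV \<tau>'"
      unfolding \<tau>'_def using m_pos
      by (intro continuous_intros continuous_on_weight assms(1,3) mc) (auto simp: less_imp_neq[symmetric])
    show "\<tau> x = \<epsilon>" if "x \<le> \<epsilon>" for x
      using assms(1,2) by (simp add: \<tau>_def m_le[OF that] powr_powr)
    show "\<tau> x = \<tau> R" if "R \<le> x" for x
      using const[OF that] assms(6) by (auto simp: \<tau>_def)
    show "mono \<tau>"
    proof (rule monoI)
      fix x y :: real assume "x \<le> y"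
      thus "\<tau> x \<le> \<tau> y" unfolding \<tau>_def
        using mono_m m_pos assms(1) by (intro powr_mono2) (auto simp: less_imp_le)
    qed
    show "a x \<le> \<tau>' x" for x
    proof (cases "x \<le> \<epsilon>")
      case True
      thus ?thesis using assms(6)[of x] by (simp add: \<tau>'_def)
    next
      case False
      hence x: "\<epsilon> \<le> x" "x > 0" using assms(2) by auto
      have "\<tau> x \<le> (x powr (\<alpha> + 1)) powr (1 / (\<alpha> + 1))"
        unfolding \<tau>_def using m_ub[OF x(1)] m_pos[of x] assms(1) by (intro powr_mono2) auto
      also have "\<dots> = x" using x assms(1) by (simp add: powr_powr)
      finally have "?w (\<tau> x) \<le> ?w x" using \<tau>pos[of x] assms(1) by (intro weight_mono) auto
      hence "?w (\<tau> x) * a x \<le> ?w (\<tau> x) * \<tau>' x"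
        unfolding e by (intro mult_right_mono assms(4))
      thus ?thesis using weight_pos[of "\<tau> x" \<alpha>] \<tau>pos[of x] by simp
    qed
  qed
qed

text \<open>\<open>p\<close> stands for a smoothed indicator and \<open>N x\<close> for its section
  length. Along each vertical line \<open>2 * Q - (Q (x, R) + Q (x, - R))\<close> increases from
  \<open>- N x\<close> to \<open>N x\<close>; divided by \<open>N x\<close> it is a smoothed sign
  that changes only where \<open>p\<close> is positive. The last two claims are Fubini for factors
  depending on \<open>x\<close> alone.\<close>

lemma vertical_primitive:
  fixes p :: "real \<times> real \<Rightarrow> real"
  assumes "C1 p g h" "\<And>z. 0 \<le> p z" "\<And>z. z \<notin> box (\<epsilon>, - R) (R, R) \<Longrightarrow> p z = 0" "R > 0" "\<epsilon> \<le> R"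
  obtains Q Qx N N' where "C1 Q Qx p"
    "\<And>x. (N has_real_derivative N' x) (at x)" "continuous_on UNIV N'" "\<And>x. 0 \<le> N x"
    "\<And>x. x \<le> \<epsilon> \<or> R \<le> x \<Longrightarrow> N x = 0"
    "\<And>x y. \<bar>2 * Q (x, y) - (Q (x, R) + Q (x, - R))\<bar> \<le> N x"
    "\<And>K. continuous_on UNIV K \<Longrightarrow> integrable lebesgue (\<lambda>z. K (fst z) * p z)"
    "\<And>K. continuous_on UNIV K \<Longrightarrow> (\<integral>z. K (fst z) * p z \<partial>lebesgue) = integral {\<epsilon>..R} (\<lambda>x. K x * N x)"
proof -
  obtain Q Qx where Q: "C1 Q Qx p" using C1_antiderivative_y[OF assms(1)] by blast
  define N where "N = (\<lambda>x. Q (x, R) - Q (x, - R))"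
  define N' where "N' = (\<lambda>x. Qx (x, R) - Qx (x, - R))"
  have p0: "p (x, y) = 0" if "x \<le> \<epsilon> \<or> R \<le> x \<or> y \<le> - R \<or> R \<le> y" for x y
    using that by (intro assms(3)) (auto simp: mem_box Basis_prod_def inner_Pair)
  have mono: "Q (x, y) \<le> Q (x, y')" if "y \<le> y'" for x y y'
    by (rule DERIV_nonneg_imp_nondecreasing[OF that]) (use C1_DERIV_y[OF Q] assms(2) in blast)
  have const: "Q (x, y) = Q (x, y')" if "y \<le> y'" "\<And>t. y \<le> t \<Longrightarrow> t \<le> y' \<Longrightarrow> p (x, t) = 0" for x y y'
  proof -
    have "Q (x, y') \<le> Q (x, y)"
      by (rule DERIV_nonpos_imp_nonincreasing[OF that(1)]) (use C1_DERIV_y[OF Q] that(2) in \<open>metis order_refl\<close>)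
    thus ?thesis using mono[OF that(1), of x] by simp
  qed
  have between: "Q (x, - R) \<le> Q (x, y)" "Q (x, y) \<le> Q (x, R)" for x y
    using mono[of "- R" y x] mono[of y R x] const[of y "- R" x] const[of R y x] p0 assms(4)
    by (metis linorder_linear order_refl)+
  have Kc: "continuous_on UNIV (\<lambda>z :: real \<times> real. K (fst z) * p z)" if "continuous_on UNIV K" for K
    by (intro continuous_intros C1_continuous[OF assms(1)] continuous_on_compose2[OF that]) auto
  have Ki: "integrable lebesgue (\<lambda>z. K (fst z) * p z)" if "continuous_on UNIV K" for K
    using set_integrable_compact_support[OF Kc[OF that], of "box (\<epsilon>, - R) (R, R)" UNIV] assms(3)
    by (auto simp: set_integrable_def)
  show ?thesis
  proof (rule that[OF Q, of N N'])
    show "(N has_real_derivative N' x) (at x)" for x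
      unfolding N_def N'_def by (intro DERIV_diff C1_DERIV_x[OF Q])
    show "continuous_on UNIV N'"
      unfolding N'_def by (intro continuous_intros continuous_on_compose2[OF C1_continuous_x[OF Q, of UNIV]]) auto
    show "0 \<le> N x" for x using mono[of "- R" R x] assms(4) by (simp add: N_def)
    show "N x = 0" if "x \<le> \<epsilon> \<or> R \<le> x" for x
      using const[of "- R" R x] p0[of x] that assms(4) by (auto simp: N_def)
    show "\<bar>2 * Q (x, y) - (Q (x, R) + Q (x, - R))\<bar> \<le> N x" for x y
      using between[of x y] by (auto simp: N_def)
    fix K :: "real \<Rightarrow> real" assume K: "continuous_on UNIV K"
    show "integrable lebesgue (\<lambda>z. K (fst z) * p z)" by (rule Ki[OF K])
    have "((\<lambda>z. K (fst z) * p z) has_integral (\<integral>z. K (fst z) * p z \<partial>lebesgue)) UNIV"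
      by (rule has_integral_integral_lebesgue[OF Ki[OF K]])
    moreover have "(\<lambda>z. if z \<in> cbox (\<epsilon>, - R) (R, R) then K (fst z) * p z else 0) = (\<lambda>z. K (fst z) * p z)"
      using assms(3) box_subset_cbox by (fastforce simp: fun_eq_iff)
    ultimately have "((\<lambda>z. K (fst z) * p z) has_integral (\<integral>z. K (fst z) * p z \<partial>lebesgue)) (cbox (\<epsilon>, - R) (R, R))"
      using has_integral_restrict_UNIV[of "cbox (\<epsilon>, - R) (R, R)" "\<lambda>z. K (fst z) * p z"] by simp
    hence "(\<integral>z. K (fst z) * p z \<partial>lebesgue) = integral (cbox (\<epsilon>, - R) (R, R)) (\<lambda>z. K (fst z) * p z)"
      by (simp add: integral_unique)
    also have "\<dots> = integral (cbox \<epsilon> R) (\<lambda>x. integral (cbox (- R) R) (\<lambda>y. K (fst (x, y)) * p (x, y)))"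
      by (rule integral_prod_continuous) (rule continuous_on_subset[OF Kc[OF K] subset_UNIV])
    also have "\<dots> = integral (cbox \<epsilon> R) (\<lambda>x. K x * N x)"
    proof (rule Henstock_Kurzweil_Integration.integral_cong)
      fix x
      have "((\<lambda>y. K x * p (x, y)) has_integral K x * N x) {- R..R}"
        unfolding N_def using assms(4) C1_DERIV_y[OF Q]
        by (intro has_integral_mult_right fundamental_theorem_of_calculus)
          (auto simp: has_real_derivative_iff_has_vector_derivative)
      thus "integral (cbox (- R) R) (\<lambda>y. K (fst (x, y)) * p (x, y)) = K x * N x"
        by (simp only: integral_unique fst_conv cbox_interval)
    qed
    finally show "(\<integral>z. K (fst z) * p z \<partial>lebesgue) = integral {\<epsilon>..R} (\<lambda>x. K x * N x)" by simp
  qed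
qed

text \<open>Substituting \<open>\<theta> = (\<tau> - \<epsilon>) / \<rho>\<close>, which runs from 0
  to 1, would be exact with \<open>w (\<tau> - \<epsilon>) * \<tau>'\<close> in place of
  \<open>w * a = w (\<tau>) * \<tau>'\<close>. Monotonicity of the weight supplies the
  inequality.\<close>

lemma gap_closing_integral:
  assumes "\<alpha> \<ge> 0" "\<epsilon> > 0" "\<epsilon> \<le> R" "\<And>x. (\<tau> has_real_derivative \<tau>' x) (at x)" "mono \<tau>" "\<And>x. 0 \<le> \<tau>' x"
    "\<tau> \<epsilon> = \<epsilon>" "\<epsilon> < \<tau> R" "\<And>x. grushin_weight \<alpha> (\<tau> x) * \<tau>' x = grushin_weight \<alpha> x * a x"
    "continuous_on UNIV a"
  defines "\<rho> \<equiv> \<tau> R - \<epsilon>"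
  shows "\<rho> powr (\<alpha> + 1) * integral {0..1} (\<lambda>x. grushin_weight \<alpha> x * cslope x)
    \<le> integral {\<epsilon>..R} (\<lambda>x. grushin_weight \<alpha> x * a x * cslope ((\<tau> x - \<epsilon>) / \<rho>))"
proof -
  let ?w = "grushin_weight \<alpha>"
  have \<rho>: "\<rho> > 0" using assms(8) by (simp add: \<rho>_def)
  \<comment> \<open>Outside the unit interval \<open>cslope\<close> is the root of a negative
    number; real \<open>sqrt\<close> is odd and continuous, so a global primitive exists.\<close>
  have "continuous_on UNIV (\<lambda>x. ?w x * cslope x)"
    by (intro continuous_intros continuous_on_weight assms(1))
  then obtain H where H: "\<And>x. (H has_real_derivative ?w x * cslope x) (at x)"
    using global_antiderivative by blast
  have "((\<lambda>x. ?w x * cslope x) has_integral H 1 - H 0) {0..1}"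
    using H by (intro fundamental_theorem_of_calculus)
      (auto simp flip: has_real_derivative_iff_has_vector_derivative intro: has_field_derivative_at_within)
  hence K: "integral {0..1} (\<lambda>x. ?w x * cslope x) = H 1 - H 0" by (rule integral_unique)
  define \<theta> where "\<theta> = (\<lambda>x. (\<tau> x - \<epsilon>) / \<rho>)"
  have \<theta>': "(\<theta> has_real_derivative \<tau>' x / \<rho>) (at x)" for x
    unfolding \<theta>_def using \<rho> by (auto intro!: derivative_eq_intros assms(4))
  have J: "((\<lambda>x. ?w (\<tau> x - \<epsilon>) * \<tau>' x * cslope (\<theta> x)) has_integral
      \<rho> powr (\<alpha> + 1) * H (\<theta> R) - \<rho> powr (\<alpha> + 1) * H (\<theta> \<epsilon>)) {\<epsilon>..R}"
  proof (rule fundamental_theorem_of_calculus)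
    fix x
    have "((\<lambda>x. \<rho> powr (\<alpha> + 1) * H (\<theta> x)) has_real_derivative
        \<rho> powr (\<alpha> + 1) * (?w (\<theta> x) * cslope (\<theta> x) * (\<tau>' x / \<rho>))) (at x)"
      by (intro DERIV_cmult DERIV_chain2[OF H] \<theta>')
    also have "\<rho> powr (\<alpha> + 1) * (?w (\<theta> x) * cslope (\<theta> x) * (\<tau>' x / \<rho>))
        = (\<rho> powr \<alpha> * ?w (\<theta> x)) * \<tau>' x * cslope (\<theta> x)"
      using \<rho> by (simp add: powr_add)
    also have "\<rho> powr \<alpha> * ?w (\<theta> x) = ?w (\<tau> x - \<epsilon>)"
      using weight_scale[OF \<rho>, of \<alpha> "\<theta> x"] \<rho> by (simp add: \<theta>_def)
    finally show "((\<lambda>x. \<rho> powr (\<alpha> + 1) * H (\<theta> x)) has_vector_derivative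
        ?w (\<tau> x - \<epsilon>) * \<tau>' x * cslope (\<theta> x)) (at x within {\<epsilon>..R})"
      unfolding has_real_derivative_iff_has_vector_derivative[symmetric] by (rule has_field_derivative_at_within)
  qed (rule assms(3))
  have \<theta>R: "\<theta> R = 1" "\<theta> \<epsilon> = 0" using \<rho> assms(7) by (auto simp: \<theta>_def \<rho>_def)
  have \<theta>c: "continuous_on S \<theta>" for S
    by (rule DERIV_continuous_on) (rule has_field_derivative_at_within[OF \<theta>'])
  have "\<rho> powr (\<alpha> + 1) * H (\<theta> R) - \<rho> powr (\<alpha> + 1) * H (\<theta> \<epsilon>)
      \<le> integral {\<epsilon>..R} (\<lambda>x. ?w x * a x * cslope (\<theta> x))"
  proof (rule has_integral_le[OF J integrable_integral])
    show "(\<lambda>x. ?w x * a x * cslope (\<theta> x)) integrable_on {\<epsilon>..R}"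
      by (intro integrable_continuous_interval continuous_intros continuous_on_weight assms(1) \<theta>c
          continuous_on_subset[OF assms(10)]) auto
    fix x assume x: "x \<in> {\<epsilon>..R}"
    have t: "\<epsilon> \<le> \<tau> x" "\<tau> x \<le> \<tau> R" using monoD[OF assms(5), of \<epsilon> x] monoD[OF assms(5), of x R] x assms(7) by auto
    have "0 \<le> \<theta> x" "\<theta> x \<le> 1" using t \<rho> by (auto simp: \<theta>_def \<rho>_def)
    hence c: "0 \<le> cslope (\<theta> x)" by (rule cslope_nonneg)
    have "?w (\<tau> x - \<epsilon>) \<le> ?w (\<tau> x)" using t assms(1,2) by (intro weight_mono) auto
    hence "?w (\<tau> x - \<epsilon>) * \<tau>' x * cslope (\<theta> x) \<le> ?w (\<tau> x) * \<tau>' x * cslope (\<theta> x)"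
      by (intro mult_right_mono c assms(6))
    thus "?w (\<tau> x - \<epsilon>) * \<tau>' x * cslope (\<theta> x) \<le> ?w x * a x * cslope (\<theta> x)" by (simp add: assms(9))
  qed
  thus ?thesis unfolding \<theta>R K by (simp add: \<theta>_def algebra_simps)
qed

section \<open>Calibration of an arbitrary set\<close>

text \<open>The box must keep a positive distance from \<open>x = 0\<close>: it leaves the strip in
  which the two test fields can separate, and it starts the gap closing map at a positive
  \<epsilon>.\<close>

lemma exhausting_box:
  fixes G :: "(real \<times> real) set"
  assumes "G \<in> sets lebesgue" "G \<subseteq> {z. fst z > 0}" "emeasure lebesgue G < \<infinity>" "e > 0"
  obtains R where "R > 1" "measure lebesgue (G - box (1 / R, - R) (R, R)) < e"
proof -
  define B where "B = (\<lambda>n::nat. box (1 / (real n + 2), - (real n + 2)) (real n + 2, real n + 2))"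
  have B: "z \<in> B n \<longleftrightarrow> 1 / (real n + 2) < fst z \<and> fst z < real n + 2 \<and> \<bar>snd z\<bar> < real n + 2" for z n
    by (cases z) (auto simp: B_def mem_box Basis_prod_def inner_Pair)
  have Bm: "B n \<in> sets lebesgue" for n unfolding B_def by auto
  have "(\<lambda>n. measure lebesgue (G - B n)) \<longlonglongrightarrow> measure lebesgue (\<Inter>n. G - B n)"
  proof (rule Lim_measure_decseq)
    show "range (\<lambda>n. G - B n) \<subseteq> sets lebesgue" using assms(1) Bm by auto
    show "decseq (\<lambda>n. G - B n)"
    proof (rule decseq_SucI)
      fix n
      have "1 / (real (Suc n) + 2) \<le> 1 / (real n + 2)" by (intro divide_left_mono) auto
      thus "G - B (Suc n) \<le> G - B n" by (auto simp: B)
    qed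
    show "emeasure lebesgue (G - B n) \<noteq> \<infinity>" for n
      using emeasure_mono[of "G - B n" G lebesgue] assms(1,3) by (auto simp: top_unique)
  qed
  also have "(\<Inter>n. G - B n) = {}"
  proof -
    have "\<exists>n. z \<in> B n" if "z \<in> G" for z
    proof -
      have z: "fst z > 0" using assms(2) that by auto
      obtain n where n: "real n > max (1 / fst z) (max (fst z) \<bar>snd z\<bar>)" using reals_Archimedean2 by blast
      hence "1 / fst z < real n + 2" by auto
      hence "1 / (real n + 2) < fst z" using z by (simp add: field_simps)
      thus ?thesis using n by (auto simp: B)
    qed
    thus ?thesis by auto
  qed
  finally have "(\<lambda>n. measure lebesgue (G - B n)) \<longlonglongrightarrow> 0" by simp
  from order_tendstoD(2)[OF this assms(4)] obtain n where "measure lebesgue (G - B n) < e"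
    using eventually_happens trivial_limit_sequentially by blast
  thus ?thesis by (intro that[of "real n + 2"]) (auto simp: B_def)
qed

text \<open>\<open>X\<close> and \<open>Z\<close> test the perimeter of the chamber alone.
  \<open>Y\<close> and \<open>Z\<close> vanish for \<open>x \<le> 0\<close>, so they can be glued to
  fields on the other side to test the whole set. Only the sum of the two integrals is estimated,
  since only it enters the partition perimeter.\<close>

lemma calibration_fields:
  fixes G :: "(real \<times> real) set"
  assumes \<alpha>: "\<alpha> \<ge> 0" and G: "G \<in> sets lebesgue" "G \<subseteq> {z. fst z > 0}" "emeasure lebesgue G = ennreal v"
    and v: "v > 0" and e: "0 < e" "e < 1"
  defines "\<kappa> \<equiv> integral {0..1} (\<lambda>x. grushin_weight \<alpha> x * cslope x)"
  obtains X Y Z \<rho> where "X \<in> test_functions" "Y \<in> test_functions" "Z \<in> test_functions"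
    "\<And>z. (X z)\<^sup>2 + (Z z)\<^sup>2 \<le> 1" "\<And>z. (Y z)\<^sup>2 + (Z z)\<^sup>2 \<le> 1"
    "\<And>z. fst z \<le> 0 \<Longrightarrow> Y z = 0 \<and> Z z = 0" "\<rho> > 0"
    "set_lebesgue_integral lebesgue G (grushin_div \<alpha> X Z) + set_lebesgue_integral lebesgue G (grushin_div \<alpha> Y Z)
      \<ge> 2 * ((1 - e) * (3 / (2 * \<rho>) * v) + 2 * (\<rho> powr (\<alpha> + 1) * \<kappa>) - 2 * e)"
proof -
  let ?w = "grushin_weight \<alpha>"
  have Gm: "G \<in> lmeasurable" "measure lebesgue G = v"
    using G(1,3) v by (auto simp: fmeasurable_def measure_def)
  \<comment> \<open>Error budget: the area outside the box, the L1 error \<mu> of the smoothing, and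
    the regularisation \<delta> of the section length each cost at most \<open>e * v / 6\<close>.
    They replace \<open>v\<close> by \<open>(1 - e / 2) * v\<close>; a second factor
    \<open>1 - e / 2\<close> comes from \<open>c\<close>.\<close>
  obtain R where R: "R > 1" "measure lebesgue (G - box (1 / R, - R) (R, R)) < e * v / 6"
    using exhausting_box[OF G(1,2), of "e * v / 6"] G(3) e v by auto
  define \<epsilon> where "\<epsilon> = 1 / R"
  have "1 * 1 \<le> R * R" using R(1) by (intro mult_mono) auto
  hence \<epsilon>: "\<epsilon> > 0" "\<epsilon> \<le> R" using R(1) by (auto simp: \<epsilon>_def field_simps)
  define B where "B = box (\<epsilon>, - R) (R, R)"
  define GB where "GB = G \<inter> B"
  have GB: "GB \<in> sets lebesgue" "GB \<subseteq> B" "GB \<subseteq> G" unfolding GB_def using G(1) by (auto simp: B_def)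
  have GBm: "GB \<in> lmeasurable" using fmeasurableI2[OF Gm(1) GB(3,1)] .
  have GBv: "measure lebesgue GB \<ge> v - e * v / 6"
  proof -
    have "measure lebesgue G - measure lebesgue GB = measure lebesgue (G - GB)"
      using measurable_measure_Diff[OF Gm(1) GB(1,3)] by simp
    also have "G - GB = G - box (1 / R, - R) (R, R)" by (auto simp: GB_def B_def \<epsilon>_def)
    finally show ?thesis using R(2) Gm(2) by simp
  qed
  define W where "W = R powr \<alpha>"
  have W: "W \<ge> 1" using R(1) \<alpha> by (simp add: W_def ge_one_powr_ge_zero)
  have wW: "?w x \<le> W" if "0 < x" "x \<le> R" for x
    using that \<alpha> by (simp add: weight_eq_powr W_def powr_mono2)
  define \<delta> where "\<delta> = e * v / (6 * R)"
  have \<delta>: "\<delta> > 0" using e v R by (simp add: \<delta>_def)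
  \<comment> \<open>The second entry pays for the part of \<open>p\<close> outside \<open>G\<close>,
    where the gain density \<open>q\<close> may be as large as
    \<open>2 * W / \<delta>\<close>.\<close>
  define \<mu> where "\<mu> = min (e * v / 6) (e * \<delta> / (2 * W))"
  have \<mu>: "\<mu> > 0" "\<mu> \<le> e * v / 6" "2 * W / \<delta> * \<mu> \<le> e"
  proof -
    show "\<mu> > 0" using e v \<delta> W by (simp add: \<mu>_def)
    show "\<mu> \<le> e * v / 6" by (simp add: \<mu>_def)
    have "2 * W / \<delta> * \<mu> \<le> 2 * W / \<delta> * (e * \<delta> / (2 * W))"
      using \<delta> W by (intro mult_left_mono) (auto simp: \<mu>_def)
    thus "2 * W / \<delta> * \<mu> \<le> e" using \<delta> W by simp
  qed
  obtain p gp hp where p: "C1 p gp hp" "\<And>z. 0 \<le> p z" "\<And>z. p z \<le> 1" "\<And>z. z \<notin> B \<Longrightarrow> p z = 0"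
    "(\<integral>z. \<bar>p z - indicator GB z\<bar> \<partial>lebesgue) \<le> \<mu>"
  proof (rule C1_approx_indicator[OF GB(1,2) _ _ \<mu>(1)], goal_cases)
    case (3 p gp hp)
    show ?case by (rule 3(1)[OF 3(2-)])
  qed (simp_all add: B_def bounded_box open_box)
  have R0: "R > 0" using R(1) by simp
  obtain Q Qx N N' where Q: "C1 Q Qx p"
    and N': "\<And>x. (N has_real_derivative N' x) (at x)" "continuous_on UNIV N'" and N0: "\<And>x. 0 \<le> N x"
    and Nz: "\<And>x. x \<le> \<epsilon> \<or> R \<le> x \<Longrightarrow> N x = 0"
    and QN: "\<And>x y. \<bar>2 * Q (x, y) - (Q (x, R) + Q (x, - R))\<bar> \<le> N x"
    and Ki: "\<And>K. continuous_on UNIV K \<Longrightarrow> integrable lebesgue (\<lambda>z. K (fst z) * p z)"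
    and KN: "\<And>K. continuous_on UNIV K \<Longrightarrow> (\<integral>z. K (fst z) * p z \<partial>lebesgue) = integral {\<epsilon>..R} (\<lambda>x. K x * N x)"
  proof (rule vertical_primitive[OF p(1,2) p(4)[unfolded B_def] R0 \<epsilon>(2)], goal_cases)
    case (2 Q Qx N N')
    show ?case by (rule 2(1)[OF 2(2-)])
  qed
  have Nc: "continuous_on S N" for S
    by (rule DERIV_continuous_on) (rule has_field_derivative_at_within[OF N'(1)])
  \<comment> \<open>A regularised reciprocal of the section length. The product
    \<open>a = u * N\<close> is then a C1 substitute, with values in \<open>{0..1}\<close>, for the
    indicator of those \<open>x\<close> whose vertical line meets the set.\<close>
  define u where "u = (\<lambda>x. 1 / (N x + \<delta>))"
  define u' where "u' = (\<lambda>x. - N' x / (N x + \<delta>)\<^sup>2)"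
  have Nd: "N x + \<delta> > 0" for x using N0[of x] \<delta> by simp
  have u': "(u has_real_derivative u' x) (at x)" for x
    unfolding u_def u'_def using Nd[of x] by (auto intro!: derivative_eq_intros N'(1) simp: power2_eq_square)
  have uc: "continuous_on S u" for S
    by (rule DERIV_continuous_on) (rule has_field_derivative_at_within[OF u'])
  have u'c: "continuous_on UNIV u'"
    unfolding u'_def using Nd by (intro continuous_intros N'(2) Nc) (auto simp: less_imp_neq[symmetric])
  have u0: "0 < u x" "u x \<le> 1 / \<delta>" for x
    using Nd[of x] N0[of x] \<delta> by (auto simp: u_def intro!: divide_left_mono)
  define a where "a = (\<lambda>x. u x * N x)"
  have a1: "1 - a x = \<delta> * u x" for x using Nd[of x] by (simp add: a_def u_def field_simps)
  have a: "0 \<le> a x" "a x \<le> 1" for x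
    using a1[of x] u0(1)[of x] \<delta> N0[of x] by (auto simp: a_def) (metis diff_ge_0_iff_ge less_imp_le mult_pos_pos)
  have ac: "continuous_on UNIV a" unfolding a_def by (intro continuous_intros uc Nc)
  have az: "a x = 0" if "x \<le> \<epsilon> \<or> R \<le> x" for x using Nz[OF that] by (simp add: a_def)
  obtain \<tau> \<tau>' where \<tau>: "\<And>x. (\<tau> has_real_derivative \<tau>' x) (at x)" "continuous_on UNIV \<tau>'"
    "\<And>x. x \<le> \<epsilon> \<Longrightarrow> \<tau> x = \<epsilon>" "\<And>x. R \<le> x \<Longrightarrow> \<tau> x = \<tau> R" "mono \<tau>" "\<And>x. a x \<le> \<tau>' x"
    "\<And>x. ?w (\<tau> x) * \<tau>' x = ?w x * a x"
  proof (rule gap_closing_map[where R = R, OF \<alpha> \<epsilon>(1) ac a az], goal_cases)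
    case (2 \<tau> \<tau>')
    show ?case by (rule 2(1)[OF 2(2-)])
  qed
  define \<rho> where "\<rho> = \<tau> R - \<epsilon>"
  have pi: "integrable lebesgue p" using Ki[of "\<lambda>_. 1"] by simp
  have GBi: "integrable lebesgue (indicator GB :: _ \<Rightarrow> real)" "integrable lebesgue (indicator G :: _ \<Rightarrow> real)"
    using GBm Gm(1) by (auto simp: fmeasurable_def intro!: integrable_real_indicator)
  have di: "integrable lebesgue (\<lambda>z. \<bar>p z - indicator GB z\<bar>)"
    using pi GBi(1) by (intro integrable_abs Bochner_Integration.integrable_diff)
  have \<rho>: "\<rho> > 0"
  proof (rule ccontr)
    \<comment> \<open>If \<tau> is constant on the interval, then \<open>a\<close> and
      \<open>N\<close> vanish and \<open>p\<close> has integral 0, which contradicts its closeness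
      to the indicator of \<open>GB\<close>.\<close>
    assume "\<not> \<rho> > 0"
    hence t: "\<tau> R \<le> \<epsilon>" by (simp add: \<rho>_def)
    have "a x = 0" for x
    proof -
      consider "x \<le> \<epsilon> \<or> R \<le> x" | "\<epsilon> < x" "x < R" by linarith
      thus ?thesis
      proof cases
        case 2
        have "((\<lambda>_. \<epsilon>) has_real_derivative 0) (at x)" by simp
        hence "(\<tau> has_real_derivative 0) (at x)"
        proof (rule has_field_derivative_transform_within_open[of _ _ _ "{\<epsilon><..<R}"])
          fix y assume "y \<in> {\<epsilon><..<R}"
          thus "\<epsilon> = \<tau> y"
            using monoD[OF \<tau>(5), of \<epsilon> y] monoD[OF \<tau>(5), of y R] t \<tau>(3)[of \<epsilon>] by simp
        qed (use 2 in auto)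
        hence "\<tau>' x = 0" using \<tau>(1) DERIV_unique by blast
        thus ?thesis using \<tau>(6)[of x] a(1)[of x] by simp
      qed (rule az)
    qed
    hence "u x * N x = 0" for x by (simp add: a_def)
    hence "N x = 0" for x using u0(1)[of x] by (metis less_irrefl mult_eq_0_iff)
    hence p0: "(\<integral>z. p z \<partial>lebesgue) = 0" using KN[of "\<lambda>_. 1"] by simp
    have "measure lebesgue GB = (\<integral>z. indicator GB z \<partial>lebesgue)" using GB(1) by simp
    also have "\<dots> \<le> (\<integral>z. \<bar>p z - indicator GB z\<bar> + p z \<partial>lebesgue)"
      by (rule Bochner_Integration.integral_mono[OF GBi(1) Bochner_Integration.integrable_add[OF di pi]])
        (auto simp: indicator_def)
    also have "\<dots> = (\<integral>z. \<bar>p z - indicator GB z\<bar> \<partial>lebesgue)"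
      using di pi p0 by simp
    finally have "measure lebesgue GB \<le> \<mu>" using p(5) by linarith
    moreover have "e * v < v" using e v by simp
    ultimately show False using GBv \<mu>(2) v by linarith
  qed
  define \<theta> where "\<theta> = (\<lambda>x. (\<tau> x - \<epsilon>) / \<rho>)"
  have \<theta>': "(\<theta> has_real_derivative \<tau>' x / \<rho>) (at x)" for x
    unfolding \<theta>_def using \<rho> by (auto intro!: derivative_eq_intros \<tau>(1))
  have \<theta>c: "continuous_on S \<theta>" for S
    by (rule DERIV_continuous_on) (rule has_field_derivative_at_within[OF \<theta>'])
  have \<theta>01: "0 \<le> \<theta> x" "\<theta> x \<le> 1" for x
  proof -
    have "\<epsilon> \<le> \<tau> x" using monoD[OF \<tau>(5), of \<epsilon> x] \<tau>(3)[of \<epsilon>] \<tau>(3)[of x] by (cases "x \<le> \<epsilon>") auto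
    moreover have "\<tau> x \<le> \<tau> R" using monoD[OF \<tau>(5), of x R] \<tau>(4)[of x] by (cases "x \<le> R") auto
    ultimately show "0 \<le> \<theta> x" "\<theta> x \<le> 1" using \<rho> by (auto simp: \<theta>_def \<rho>_def)
  qed
  have \<theta>0: "\<theta> x = 0" if "x \<le> \<epsilon>" for x using \<tau>(3)[OF that] by (simp add: \<theta>_def)
  have s1: "\<bar>slope (\<theta> x)\<bar> \<le> 1" for x using slope_abs_le \<theta>01 by blast
  have s': "((\<lambda>x. slope (\<theta> x)) has_real_derivative - (3 / 2) * (\<tau>' x / \<rho>)) (at x)" for x
    by (rule DERIV_chain2[OF DERIV_slope \<theta>'])
  have \<tau>'0: "0 \<le> \<tau>' x" for x using \<tau>(6)[of x] a(1)[of x] by linarith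
  \<comment> \<open>The slope reaches -1 where \<open>\<theta> = 1\<close>, and there the cosine has
    no derivative. Shrinking the sine by \<open>c < 1\<close> keeps the radicand in \<open>k\<close>
    positive, so \<open>k\<close> is C1, and still
    \<open>cslope (\<theta> x) \<le> k x\<close>.\<close>
  define c where "c = 1 - e / 2"
  have c: "0 < c" "c < 1" using e by (auto simp: c_def)
  define k where "k = (\<lambda>x. sqrt (1 - c\<^sup>2 * (slope (\<theta> x))\<^sup>2))"
  have cs: "c\<^sup>2 * (slope (\<theta> x))\<^sup>2 \<le> c\<^sup>2" for x
    using s1[of x] by (intro mult_left_le) (auto simp: abs_square_le_1)
  have c2: "c\<^sup>2 < 1" using c by (simp add: power_less_one_iff abs_square_less_1)
  have kpos: "0 < 1 - c\<^sup>2 * (slope (\<theta> x))\<^sup>2" for x using cs[of x] c2 by linarith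
  define k' where "k' = (\<lambda>x. (- (c\<^sup>2 * (2 * slope (\<theta> x) * (- (3 / 2) * (\<tau>' x / \<rho>))))) / (2 * k x))"
  have k': "(k has_real_derivative k' x) (at x)" for x
    unfolding k_def k'_def using kpos[of x]
    by (auto intro!: derivative_eq_intros s' simp: field_simps)
  have kc: "continuous_on S k" for S
    by (rule DERIV_continuous_on) (rule has_field_derivative_at_within[OF k'])
  have k0: "0 < k x" "k x \<le> 1" "cslope (\<theta> x) \<le> k x" for x
  proof -
    show "0 < k x" using kpos[of x] by (simp add: k_def)
    show "k x \<le> 1" by (simp add: k_def)
    have "c\<^sup>2 * (slope (\<theta> x))\<^sup>2 \<le> 1 * (slope (\<theta> x))\<^sup>2" using c2 by (intro mult_right_mono) auto
    thus "cslope (\<theta> x) \<le> k x" by (simp add: k_def cslope_def)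
  qed
  have ksq: "(k x)\<^sup>2 = 1 - c\<^sup>2 * (slope (\<theta> x))\<^sup>2" for x using kpos[of x] by (simp add: k_def)
  have k'c: "continuous_on UNIV k'"
    unfolding k'_def using k0(1) \<rho>
    by (intro continuous_intros \<theta>c \<tau>(2) kc) (auto simp: less_imp_neq[symmetric])
  obtain b where b: "b > 0" "\<And>L. L > 0 \<Longrightarrow> \<exists>\<theta> \<theta>'.
      (\<forall>t. (\<theta> has_real_derivative \<theta>' t) (at t)) \<and> continuous_on UNIV \<theta>' \<and>
      (\<forall>t. 0 \<le> \<theta> t \<and> \<theta> t \<le> 1 \<and> \<bar>\<theta>' t\<bar> \<le> b / L) \<and> (\<forall>t. \<bar>t\<bar> \<le> L \<longrightarrow> \<theta> t = 1) \<and>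
      (\<forall>t. \<bar>t\<bar> \<ge> 2 * L \<longrightarrow> \<theta> t = 0)"
    by (rule smooth_cutoff) blast
  \<comment> \<open>At least \<open>R\<close>, so that the cutoffs are 1 on the box; the other entry
    makes the total cost of the cutoff derivatives over \<open>G\<close> at most
    \<open>e\<close>.\<close>
  define L where "L = max R ((1 + W) * b * v / e)"
  have L: "L > 0" "L \<ge> R" using R(1) by (auto simp: L_def)
  have L2: "(1 + W) * (b / L) * v \<le> e"
  proof -
    have "(1 + W) * b * v / e \<le> L" by (simp add: L_def)
    hence "(1 + W) * b * v \<le> L * e" using e by (simp add: field_simps)
    thus ?thesis using L(1) by (simp add: field_simps)
  qed
  obtain j j' where j: "\<And>t. (j has_real_derivative j' t) (at t)" "continuous_on UNIV j'"
    "\<And>t. 0 \<le> j t" "\<And>t. j t \<le> 1" "\<And>t. \<bar>j' t\<bar> \<le> b / L" "\<And>t. \<bar>t\<bar> \<le> L \<Longrightarrow> j t = 1" "\<And>t. \<bar>t\<bar> \<ge> 2 * L \<Longrightarrow> j t = 0"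
    using b(2)[OF L(1)] by blast
  have jc: "continuous_on S j" for S
    by (rule DERIV_continuous_on) (rule has_field_derivative_at_within[OF j(1)])
  obtain s ds C where s: "\<And>t. (s has_real_derivative ds t) (at t)" "continuous_on UNIV ds"
    "\<And>t. 0 \<le> s t" "\<And>t. s t \<le> 1" "\<And>t. t \<le> 0 \<Longrightarrow> s t = 0" "\<And>t. t \<ge> 1 \<Longrightarrow> s t = 1" "\<And>t. \<bar>ds t\<bar> \<le> C"
    using smooth_step by metis
  define \<sigma> where "\<sigma> = (\<lambda>x. s (x / \<epsilon>))"
  define \<sigma>' where "\<sigma>' = (\<lambda>x. ds (x / \<epsilon>) * (1 / \<epsilon>))"
  have \<sigma>': "(\<sigma> has_real_derivative \<sigma>' x) (at x)" for x
    unfolding \<sigma>_def \<sigma>'_def by (rule DERIV_chain2[OF s(1)]) (use \<epsilon>(1) in \<open>auto intro!: derivative_eq_intros\<close>)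
  have \<sigma>'c: "continuous_on UNIV \<sigma>'"
    unfolding \<sigma>'_def using \<epsilon>(1) by (intro continuous_intros continuous_on_compose2[OF s(2)]) auto
  have \<sigma>c: "continuous_on S \<sigma>" for S
    by (rule DERIV_continuous_on) (rule has_field_derivative_at_within[OF \<sigma>'])
  have \<sigma>: "0 \<le> \<sigma> x" "\<sigma> x \<le> 1" "x \<le> 0 \<Longrightarrow> \<sigma> x = 0" "x \<ge> \<epsilon> \<Longrightarrow> \<sigma> x = 1" for x
    using s(3-6) \<epsilon>(1) by (auto simp: \<sigma>_def divide_nonpos_pos)
  text \<open>Near the line \<open>x = 0\<close> the two fields interpolate between their common value and the values
    \<open>-c\<close> and \<open>0\<close> there, with constant sum, so that the traces on the line cancel.\<close>
  define F where "F = (\<lambda>x. - c * (j x * slope (\<theta> x)))"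
  define F' where "F' = (\<lambda>x. - c * (j' x * slope (\<theta> x) + - (3 / 2) * (\<tau>' x / \<rho>) * j x))"
  have F': "(F has_real_derivative F' x) (at x)" for x
    unfolding F_def F'_def by (intro DERIV_cmult DERIV_mult j(1) s')
  have F'c: "continuous_on UNIV F'"
    unfolding F'_def using \<rho> by (intro continuous_intros \<theta>c \<tau>(2) j(2) jc) auto
  have Fc: "continuous_on S F" for S
    by (rule DERIV_continuous_on) (rule has_field_derivative_at_within[OF F'])
  have Fs: "\<bar>F x\<bar> \<le> c * \<bar>slope (\<theta> x)\<bar>" for x
    unfolding F_def using c(1) j(3,4)[of x] by (simp add: abs_mult mult_left_le_one_le mult_left_mono)
  define Y1 where "Y1 = (\<lambda>x. F x * \<sigma> x)"
  define Y1' where "Y1' = (\<lambda>x. F' x * \<sigma> x + \<sigma>' x * F x)"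
  have Y1': "(Y1 has_real_derivative Y1' x) (at x)" for x
    unfolding Y1_def Y1'_def by (intro DERIV_mult F' \<sigma>')
  have Y1'c: "continuous_on UNIV Y1'"
    unfolding Y1'_def by (intro continuous_intros F'c \<sigma>'c Fc \<sigma>c)
  define X1 where "X1 = (\<lambda>x. 2 * F x - Y1 x)"
  define X1' where "X1' = (\<lambda>x. 2 * F' x - Y1' x)"
  have X1': "(X1 has_real_derivative X1' x) (at x)" for x
    unfolding X1_def X1'_def by (intro DERIV_diff DERIV_cmult F' Y1')
  have X1'c: "continuous_on UNIV X1'"
    unfolding X1'_def by (intro continuous_intros F'c Y1'c)
  define X where "X = (\<lambda>z. X1 (fst z) * j (snd z))"
  define Y where "Y = (\<lambda>z. Y1 (fst z) * j (snd z))"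
  have CX: "C1 X (\<lambda>z. X1' (fst z) * j (snd z)) (\<lambda>z. X1 (fst z) * j' (snd z))"
    unfolding X_def using C1_mult[OF C1_fst[OF X1' X1'c] C1_snd[OF j(1,2)]] by simp
  have CY: "C1 Y (\<lambda>z. Y1' (fst z) * j (snd z)) (\<lambda>z. Y1 (fst z) * j' (snd z))"
    unfolding Y_def using C1_mult[OF C1_fst[OF Y1' Y1'c] C1_snd[OF j(1,2)]] by simp
  \<comment> \<open>Multiplied by \<open>u\<close> this is the smoothed sign. Its vertical
    derivative is \<open>2 * p\<close>, so crossing the set produces the gain of
    \<open>Z\<close>.\<close>
  define D where "D = (\<lambda>z. 2 * Q z + - (Q (fst z, R) + Q (fst z, - R)))"
  have DN: "\<bar>D z\<bar> \<le> N (fst z)" for z using QN[of "fst z" "snd z"] by (simp add: D_def)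
  obtain Dx where CD: "C1 D Dx (\<lambda>z. 2 * p z)"
  proof -
    have q: "((\<lambda>x. - (Q (x, R) + Q (x, - R))) has_real_derivative - (Qx (x, R) + Qx (x, - R))) (at x)" for x
      by (intro DERIV_minus DERIV_add C1_DERIV_x[OF Q])
    have qc: "continuous_on UNIV (\<lambda>x. - (Qx (x, R) + Qx (x, - R)))"
      by (intro continuous_intros continuous_on_compose2[OF C1_continuous_x[OF Q, of UNIV]]) auto
    show ?thesis using C1_add[OF C1_cmult[OF Q, of 2] C1_fst[OF q qc]] that unfolding D_def by simp
  qed
  define Z where "Z = (\<lambda>z. (k (fst z) * u (fst z) * j (snd z)) * D z)"
  obtain Zx where CZ: "C1 Z Zx (\<lambda>z. (k (fst z) * u (fst z) * j' (snd z)) * D z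
      + (k (fst z) * u (fst z) * j (snd z)) * (2 * p z))"
  proof -
    have ku: "((\<lambda>x. k x * u x) has_real_derivative k' x * u x + u' x * k x) (at x)" for x
      by (intro DERIV_mult k' u')
    have kuc: "continuous_on UNIV (\<lambda>x. k' x * u x + u' x * k x)"
      by (intro continuous_intros kc uc k'c u'c)
    show ?thesis
      using C1_mult[OF C1_mult[OF C1_fst[OF ku kuc] C1_snd[OF j(1,2)]] CD] that unfolding Z_def by simp
  qed
  have jz: "j x = 0 \<or> j y = 0" if "\<bar>x\<bar> \<ge> 2 * L \<or> \<bar>y\<bar> \<ge> 2 * L" for x y using that j(7) by blast
  have Fj: "F x = 0" if "j x = 0" for x using that by (simp add: F_def)
  have X_test: "X \<in> test_functions"
    by (rule test_functionsI_box[OF CX, of "2 * L"]) (use jz Fj in \<open>auto simp: X_def X1_def Y1_def\<close>)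
  have Y_test: "Y \<in> test_functions"
    by (rule test_functionsI_box[OF CY, of "2 * L"]) (use jz Fj in \<open>auto simp: Y_def Y1_def\<close>)
  have Z_test: "Z \<in> test_functions"
  proof (rule test_functionsI_box[OF CZ, of "2 * L"])
    fix x y assume xy: "\<bar>x\<bar> \<ge> 2 * L \<or> \<bar>y\<bar> \<ge> 2 * L"
    show "Z (x, y) = 0"
    proof (cases "\<bar>y\<bar> \<ge> 2 * L")
      case True thus ?thesis using j(7)[of y] by (simp add: Z_def)
    next
      case False
      hence "x \<le> \<epsilon> \<or> R \<le> x" using xy L \<epsilon>(1) R(1) by linarith
      thus ?thesis using DN[of "(x, y)"] Nz[of x] by (simp add: Z_def)
    qed
  qed
  have Zbound: "(Z z)\<^sup>2 \<le> 1 - c\<^sup>2 * (slope (\<theta> (fst z)))\<^sup>2" for z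
  proof -
    have "\<bar>u (fst z) * D z\<bar> \<le> a (fst z)"
      unfolding a_def abs_mult using DN[of z] u0(1)[of "fst z"] by (simp add: mult_left_mono)
    hence "\<bar>j (snd z) * (u (fst z) * D z)\<bar> \<le> 1 * 1"
      unfolding abs_mult[of "j (snd z)"] using j(3,4)[of "snd z"] a(2)[of "fst z"] by (intro mult_mono) auto
    hence "(j (snd z) * (u (fst z) * D z))\<^sup>2 \<le> 1" by (simp add: abs_square_le_1)
    hence "(k (fst z))\<^sup>2 * (j (snd z) * (u (fst z) * D z))\<^sup>2 \<le> (k (fst z))\<^sup>2 * 1"
      by (intro mult_left_mono) auto
    thus ?thesis unfolding ksq[symmetric] by (simp add: Z_def power_mult_distrib ac_simps)
  qed
  have Zz: "Z z = 0" if "fst z \<le> \<epsilon>" for z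
    using DN[of z] Nz[of "fst z"] that by (simp add: Z_def)
  \<comment> \<open>Left of \<epsilon> the component \<open>Z\<close> vanishes, so absolute value at
    most 1 suffices. Right of \<epsilon> the first component is \<open>F\<close>, bounded by
    \<open>c\<close> times the sine, and \<open>k\<close> is the complementary cosine.\<close>
  have bound: "(A (fst z) * j (snd z))\<^sup>2 + (Z z)\<^sup>2 \<le> 1"
    if A1: "\<And>x. \<bar>A x\<bar> \<le> 1" and A2: "\<And>x. x \<ge> \<epsilon> \<Longrightarrow> A x = F x" for A :: "real \<Rightarrow> real" and z
  proof (cases "fst z \<le> \<epsilon>")
    case True
    have "\<bar>A (fst z) * j (snd z)\<bar> \<le> 1 * 1"
      unfolding abs_mult using A1[of "fst z"] j(3,4)[of "snd z"] by (intro mult_mono) auto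
    hence "(A (fst z) * j (snd z))\<^sup>2 \<le> 1" by (simp add: abs_square_le_1)
    thus ?thesis using Zz[OF True] by simp
  next
    case False
    hence "A (fst z) = F (fst z)" using A2[of "fst z"] by simp
    moreover have "\<bar>F (fst z) * j (snd z)\<bar> \<le> \<bar>c * slope (\<theta> (fst z))\<bar> * 1"
      unfolding abs_mult[of "F (fst z)"] using Fs[of "fst z"] j(3,4)[of "snd z"] c(1)
      by (intro mult_mono) (auto simp: abs_mult)
    hence "(F (fst z) * j (snd z))\<^sup>2 \<le> (c * slope (\<theta> (fst z)))\<^sup>2"
      by (simp add: abs_le_square_iff)
    ultimately show ?thesis using Zbound[of z] by (simp add: power_mult_distrib)
  qed
  have F1: "\<bar>F x\<bar> \<le> 1" for x
  proof -
    have "c * \<bar>slope (\<theta> x)\<bar> \<le> 1 * 1" using c s1[of x] by (intro mult_mono) auto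
    thus ?thesis using Fs[of x] by linarith
  qed
  have XZ: "(X z)\<^sup>2 + (Z z)\<^sup>2 \<le> 1" for z
    unfolding X_def
  proof (rule bound)
    show "X1 x = F x" if "x \<ge> \<epsilon>" for x using \<sigma>(4)[OF that] by (simp add: X1_def Y1_def)
    show "\<bar>X1 x\<bar> \<le> 1" for x
    proof (cases "x \<ge> \<epsilon>")
      case True
      thus ?thesis using \<sigma>(4)[OF True] F1[of x] by (simp add: X1_def Y1_def)
    next
      case False
      \<comment> \<open>The sine 1/2 at the line is what keeps the doubled component
        \<open>2 * F\<close> within absolute value \<open>c\<close>.\<close>
      hence "slope (\<theta> x) = 1 / 2" using \<theta>0[of x] by (simp add: slope_def)
      hence "X1 x = - (c * j x * (1 - \<sigma> x / 2))" by (simp add: X1_def Y1_def F_def algebra_simps)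
      moreover have "\<bar>c * j x * (1 - \<sigma> x / 2)\<bar> \<le> 1 * 1 * 1"
        unfolding abs_mult using c j(3,4)[of x] \<sigma>(1,2)[of x] by (intro mult_mono) auto
      ultimately show ?thesis by simp
    qed
  qed
  have YZ: "(Y z)\<^sup>2 + (Z z)\<^sup>2 \<le> 1" for z
    unfolding Y_def
  proof (rule bound)
    show "Y1 x = F x" if "x \<ge> \<epsilon>" for x using \<sigma>(4)[OF that] by (simp add: Y1_def)
    show "\<bar>Y1 x\<bar> \<le> 1" for x
    proof -
      have "\<bar>F x\<bar> * \<bar>\<sigma> x\<bar> \<le> 1 * 1" using F1[of x] \<sigma>(1,2)[of x] by (intro mult_mono) auto
      thus ?thesis by (simp add: Y1_def abs_mult)
    qed
  qed
  have YZ0: "Y z = 0 \<and> Z z = 0" if "fst z \<le> 0" for z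
    using Zz[of z] that \<epsilon>(1) \<sigma>(3)[OF that] by (simp add: Y_def Y1_def)
  \<comment> \<open>Half the sum of the two divergences. The transition function \<sigma> has
    dropped out, because \<open>X1 + Y1 = 2 * F\<close>.\<close>
  define \<Delta> where "\<Delta> = (\<lambda>z. F' (fst z) * j (snd z) + ?w (fst z) * ((k (fst z) * u (fst z) * j' (snd z)) * D z
      + (k (fst z) * u (fst z) * j (snd z)) * (2 * p z)))"
  have \<Delta>: "grushin_div \<alpha> X Z z + grushin_div \<alpha> Y Z z = 2 * \<Delta> z" for z
    unfolding grushin_div_def C1_partial_x[OF CX] C1_partial_x[OF CY] C1_partial_y[OF CZ] \<Delta>_def X1'_def
    by (simp add: algebra_simps)
  have Xi: "set_integrable lebesgue G (grushin_div \<alpha> X Z)" and Yi: "set_integrable lebesgue G (grushin_div \<alpha> Y Z)"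
    using set_integrable_grushin_div[OF \<alpha> _ Z_test G(1)] X_test Y_test by blast+
  have \<Delta>i: "set_integrable lebesgue G \<Delta>"
    using set_integrable_mult_right[of "1 / 2", OF set_integral_add(1)[OF Xi Yi]] by (simp add: \<Delta>)
  have sum: "set_lebesgue_integral lebesgue G (grushin_div \<alpha> X Z) + set_lebesgue_integral lebesgue G (grushin_div \<alpha> Y Z)
      = 2 * set_lebesgue_integral lebesgue G \<Delta>"
    using set_integral_add(2)[OF Xi Yi] by (simp add: \<Delta>)
  define lam where "lam = c * (3 / (2 * \<rho>))"
  have lam: "lam > 0" using c \<rho> by (simp add: lam_def)
  define q where "q = (\<lambda>x. 2 * (?w x * (cslope (\<theta> x) * u x)))"
  have qc: "continuous_on UNIV q"
    unfolding q_def by (intro continuous_intros continuous_on_weight \<alpha> \<theta>c uc)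
  \<comment> \<open>A minorant of \<Delta> on \<open>G\<close> and of 0 elsewhere, made of terms
    whose integrals over the whole plane are accessible. The first group bounds
    \<open>lam * a\<close> on \<open>GB\<close> from below; the second pays for the cutoffs;
    \<open>q * p\<close> is the gain of the sign switch; the last term cancels this gain where
    \<open>p\<close> spills outside \<open>G\<close>.\<close>
  define m where "m = (\<lambda>z. lam * (indicator GB z - \<bar>p z - indicator GB z\<bar> - \<delta> * (u (fst z) * p z))
      - (1 + W) * (b / L) * indicator G z + q (fst z) * p z - 2 * W / \<delta> * \<bar>p z - indicator GB z\<bar>)"
  have B: "z \<in> B \<longleftrightarrow> \<epsilon> < fst z \<and> fst z < R \<and> \<bar>snd z\<bar> < R" for z
    by (cases z) (auto simp: B_def mem_box Basis_prod_def inner_Pair)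
  have c1: "indicator GB z - \<bar>p z - indicator GB z\<bar> - \<delta> * (u (fst z) * p z) \<le> a (fst z) * indicator GB z" for z
  proof -
    have "\<delta> * (u (fst z) * p z) = p z - a (fst z) * p z"
      unfolding mult.assoc[symmetric] a1[symmetric] by (simp add: left_diff_distrib)
    moreover have "a (fst z) * p z \<le> a (fst z)" using a(1)[of "fst z"] p(3)[of z] by (simp add: mult_left_le)
    moreover have "a (fst z) * p z \<le> p z" using a(2)[of "fst z"] p(2)[of z] by (simp add: mult_left_le_one_le a(1))
    ultimately show ?thesis using p(2,3)[of z] by (auto simp: indicator_def abs_real_def)
  qed
  have minor: "m z \<le> indicator G z *\<^sub>R \<Delta> z" for z
  proof (cases "z \<in> G")
    case True
    hence x: "fst z > 0" using G(2) by auto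
    \<comment> \<open>On \<open>GB\<close> both cutoffs are 1 and \<open>a \<le> \<tau>'\<close>;
      elsewhere the indicator is 0 and the right side is nonnegative up to the cutoff derivative,
      which costs at most \<open>b / L\<close>.\<close>
    have aF: "lam * (a (fst z) * indicator GB z) - b / L \<le> F' (fst z) * j (snd z)"
    proof -
      let ?x = "fst z"
      have "a ?x * indicator GB z \<le> \<tau>' ?x * j ?x * j (snd z)"
      proof (cases "z \<in> GB")
        case True
        hence "?x < R" "\<bar>snd z\<bar> < R" "?x > \<epsilon>" using GB(2) B[of z] by blast+
        hence "j ?x = 1" "j (snd z) = 1" using L(2) \<epsilon>(1) by (auto intro!: j(6))
        thus ?thesis using \<tau>(6)[of ?x] True by simp
      next
        case False
        thus ?thesis using \<tau>'0 j(3) by simp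
      qed
      hence "lam * (a ?x * indicator GB z) \<le> lam * (\<tau>' ?x * j ?x * j (snd z))"
        using lam by (intro mult_left_mono) auto
      moreover have "\<bar>c * (j' ?x * slope (\<theta> ?x) * j (snd z))\<bar> \<le> 1 * (b / L * 1 * 1)"
        unfolding abs_mult using c j(3-5) s1[of ?x] b(1) L(1) by (intro mult_mono) auto
      moreover have "F' ?x * j (snd z) = lam * (\<tau>' ?x * j ?x * j (snd z)) - c * (j' ?x * slope (\<theta> ?x) * j (snd z))"
        using \<rho> by (simp add: F'_def lam_def field_simps)
      ultimately show ?thesis by linarith
    qed
    have w2: "- (W * (b / L)) \<le> ?w (fst z) * ((k (fst z) * u (fst z) * j' (snd z)) * D z)"
    proof (cases "fst z < R")
      case True
      have "\<bar>u (fst z) * D z\<bar> \<le> 1"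
        unfolding abs_mult using DN[of z] u0(1)[of "fst z"] a(2)[of "fst z", unfolded a_def]
        by (smt (verit) mult_left_mono)
      hence "\<bar>?w (fst z) * (k (fst z) * (j' (snd z) * (u (fst z) * D z)))\<bar> \<le> W * (1 * (b / L * 1))"
        unfolding abs_mult[of "?w (fst z)"] abs_mult[of "k (fst z)"] abs_mult[of "j' (snd z)"]
        using wW[OF x] True weight_nonneg[of \<alpha> "fst z"] k0(1,2)[of "fst z"] j(5)[of "snd z"] W b(1) L(1)
        by (intro mult_mono) auto
      thus ?thesis by (simp add: ac_simps abs_le_iff)
    next
      case False
      hence "D z = 0" using DN[of z] Nz[of "fst z"] by simp
      thus ?thesis using W b(1) L(1) by simp
    qed
    have q3: "q (fst z) * p z \<le> ?w (fst z) * ((k (fst z) * u (fst z) * j (snd z)) * (2 * p z))"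
    proof (cases "z \<in> B")
      case True
      hence "j (snd z) = 1" using B[of z] True L(2) by (intro j(6)) linarith
      moreover have "?w (fst z) * (cslope (\<theta> (fst z)) * u (fst z) * (2 * p z))
          \<le> ?w (fst z) * (k (fst z) * u (fst z) * (2 * p z))"
        using k0(3)[of "fst z"] u0(1)[of "fst z"] p(2)[of z]
        by (intro mult_left_mono mult_right_mono weight_nonneg) auto
      ultimately show ?thesis by (simp add: q_def ac_simps)
    qed (simp add: p(4))
    have "lam * (indicator GB z - \<bar>p z - indicator GB z\<bar> - \<delta> * (u (fst z) * p z)) \<le> lam * (a (fst z) * indicator GB z)"
      using lam c1[of z] by (intro mult_left_mono) auto
    moreover have "0 \<le> 2 * W / \<delta> * \<bar>p z - indicator GB z\<bar>" using W \<delta> by simp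
    moreover have "m z = lam * (indicator GB z - \<bar>p z - indicator GB z\<bar> - \<delta> * (u (fst z) * p z))
      - (b / L + W * (b / L)) + q (fst z) * p z - 2 * W / \<delta> * \<bar>p z - indicator GB z\<bar>"
      using True by (simp add: m_def distrib_right add_divide_distrib)
    moreover have "indicator G z *\<^sub>R \<Delta> z = F' (fst z) * j (snd z) + ?w (fst z) * ((k (fst z) * u (fst z) * j' (snd z)) * D z)
      + ?w (fst z) * ((k (fst z) * u (fst z) * j (snd z)) * (2 * p z))"
      using True by (simp add: \<Delta>_def distrib_left)
    ultimately show ?thesis using aF w2 q3 by linarith
  next
    case False
    hence z: "z \<notin> GB" using GB(3) by auto
    have "q (fst z) * p z \<le> 2 * W / \<delta> * \<bar>p z\<bar>"
    proof (cases "z \<in> B")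
      case True
      hence x: "0 < fst z" "fst z \<le> R" using B[of z] True \<epsilon>(1) by linarith+
      have "cslope (\<theta> (fst z)) \<le> 1" using k0(2,3)[of "fst z"] by linarith
      hence "?w (fst z) * (cslope (\<theta> (fst z)) * u (fst z)) \<le> W * (1 * (1 / \<delta>))"
        using wW[OF x] u0[of "fst z"] W \<delta> cslope_nonneg[OF \<theta>01, of "fst z"] by (intro mult_mono) auto
      hence "q (fst z) \<le> 2 * W / \<delta>" by (simp add: q_def)
      hence "q (fst z) * p z \<le> 2 * W / \<delta> * p z" by (rule mult_right_mono[OF _ p(2)])
      thus ?thesis using p(2)[of z] by simp
    qed (simp add: p(4))
    moreover have "0 \<le> lam * (\<bar>p z\<bar> + \<delta> * (u (fst z) * p z))"
      using lam \<delta> u0(1)[of "fst z"] p(2)[of z] by (simp add: less_imp_le)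
    ultimately show ?thesis using False z by (simp add: m_def algebra_simps)
  qed
  have ui: "integrable lebesgue (\<lambda>z. u (fst z) * p z)" by (rule Ki[OF uc])
  have qi: "integrable lebesgue (\<lambda>z. q (fst z) * p z)" by (rule Ki[OF qc])
  note I = GBi di ui qi
  have mi: "integrable lebesgue m"
    unfolding m_def using I by (intro Bochner_Integration.integrable_diff Bochner_Integration.integrable_add
        integrable_mult_right)
  have m_eq: "(\<integral>z. m z \<partial>lebesgue) = lam * (measure lebesgue GB - (\<integral>z. \<bar>p z - indicator GB z\<bar> \<partial>lebesgue)
      - \<delta> * (\<integral>z. u (fst z) * p z \<partial>lebesgue)) - (1 + W) * (b / L) * v + (\<integral>z. q (fst z) * p z \<partial>lebesgue)
      - 2 * W / \<delta> * (\<integral>z. \<bar>p z - indicator GB z\<bar> \<partial>lebesgue)"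
  proof -
    define P where "P = (\<lambda>z. \<bar>p z - indicator GB z\<bar>)"
    define U where "U = (\<lambda>z. u (fst z) * p z)"
    define V where "V = (\<lambda>z. q (fst z) * p z)"
    have "(\<integral>z. indicator GB z \<partial>lebesgue) = measure lebesgue GB" "(\<integral>z. indicator G z \<partial>lebesgue) = v"
      using GB(1) G(1) Gm(2) by simp_all
    moreover have "integrable lebesgue P" "integrable lebesgue U" "integrable lebesgue V"
      unfolding P_def U_def V_def using I by blast+
    ultimately show ?thesis using GBi
      unfolding m_def P_def[symmetric, THEN fun_cong, simplified] U_def[symmetric, THEN fun_cong, simplified]
        V_def[symmetric, THEN fun_cong, simplified]
      by simp
  qed
  \<comment> \<open>Integrating over vertical lines turns \<open>u * p\<close> into
    \<open>a \<le> 1\<close> on an interval of length at most \<open>R\<close>, so the choice of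
    \<delta> gives the bound.\<close>
  have E1: "\<delta> * (\<integral>z. u (fst z) * p z \<partial>lebesgue) \<le> e * v / 6"
  proof -
    have "(\<integral>z. u (fst z) * p z \<partial>lebesgue) = integral {\<epsilon>..R} a" unfolding a_def by (rule KN[OF uc])
    also have "\<dots> \<le> integral {\<epsilon>..R} (\<lambda>_. 1)"
      by (intro integral_le integrable_continuous_interval continuous_on_subset[OF ac] a(2)) auto
    also have "\<dots> \<le> R" using \<epsilon> by simp
    finally have "\<delta> * (\<integral>z. u (fst z) * p z \<partial>lebesgue) \<le> \<delta> * R" using \<delta> by (intro mult_left_mono) auto
    also have "\<dots> = e * v / 6" using R(1) by (simp add: \<delta>_def)
    finally show ?thesis .
  qed
  have E2: "2 * (\<rho> powr (\<alpha> + 1) * \<kappa>) \<le> (\<integral>z. q (fst z) * p z \<partial>lebesgue)"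
  proof -
    have "\<rho> powr (\<alpha> + 1) * \<kappa> \<le> integral {\<epsilon>..R} (\<lambda>x. ?w x * a x * cslope ((\<tau> x - \<epsilon>) / \<rho>))"
      unfolding \<kappa>_def \<rho>_def
      by (rule gap_closing_integral[OF \<alpha> \<epsilon> \<tau>(1,5) \<tau>'0 _ _ \<tau>(7) ac]) (use \<tau>(3) \<rho> in \<open>auto simp: \<rho>_def\<close>)
    also have "2 * \<dots> = integral {\<epsilon>..R} (\<lambda>x. q x * N x)"
      unfolding integral_mult_right[symmetric] by (simp add: q_def a_def \<theta>_def ac_simps)
    also have "\<dots> = (\<integral>z. q (fst z) * p z \<partial>lebesgue)" by (rule KN[OF qc, symmetric])
    finally show ?thesis by simp
  qed
  have "(1 - e) * (3 / (2 * \<rho>) * v) + 2 * (\<rho> powr (\<alpha> + 1) * \<kappa>) - 2 * e \<le> (\<integral>z. m z \<partial>lebesgue)"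
  proof -
    have "lam * (v - e * v / 2) \<le> lam * (measure lebesgue GB - (\<integral>z. \<bar>p z - indicator GB z\<bar> \<partial>lebesgue)
      - \<delta> * (\<integral>z. u (fst z) * p z \<partial>lebesgue))"
      using lam GBv p(5) \<mu>(2) E1 by (intro mult_left_mono) auto
    moreover have "(1 - e) * (3 / (2 * \<rho>) * v) \<le> lam * (v - e * v / 2)"
    proof -
      have "(1 - e) * (3 / (2 * \<rho>) * v) \<le> (1 - e / 2)\<^sup>2 * (3 / (2 * \<rho>) * v)"
        using \<rho> v by (intro mult_right_mono) (auto simp: power2_eq_square algebra_simps)
      also have "\<dots> = lam * ((1 - e / 2) * v)" by (simp add: lam_def c_def power2_eq_square)
      also have "(1 - e / 2) * v = v - e * v / 2" by (simp add: algebra_simps)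
      finally show ?thesis .
    qed
    moreover have "2 * W / \<delta> * (\<integral>z. \<bar>p z - indicator GB z\<bar> \<partial>lebesgue) \<le> e"
    proof -
      have "2 * W / \<delta> * (\<integral>z. \<bar>p z - indicator GB z\<bar> \<partial>lebesgue) \<le> 2 * W / \<delta> * \<mu>"
        using W \<delta> p(5) by (intro mult_left_mono) auto
      thus ?thesis using \<mu>(3) by linarith
    qed
    ultimately show ?thesis using E2 L2 m_eq by linarith
  qed
  also have "(\<integral>z. m z \<partial>lebesgue) \<le> set_lebesgue_integral lebesgue G \<Delta>"
    unfolding set_lebesgue_integral_def
    by (rule Bochner_Integration.integral_mono[OF mi]) (use \<Delta>i minor in \<open>auto simp: set_integrable_def\<close>)
  finally have final: "(1 - e) * (3 / (2 * \<rho>) * v) + 2 * (\<rho> powr (\<alpha> + 1) * \<kappa>) - 2 * e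
      \<le> set_lebesgue_integral lebesgue G \<Delta>" .
  have res: "2 * ((1 - e) * (3 / (2 * \<rho>) * v) + 2 * (\<rho> powr (\<alpha> + 1) * \<kappa>) - 2 * e) \<le>
      set_lebesgue_integral lebesgue G (grushin_div \<alpha> X Z) + set_lebesgue_integral lebesgue G (grushin_div \<alpha> Y Z)"
    unfolding sum by (rule mult_left_mono[OF final]) simp
  show ?thesis
    by (rule that[OF X_test Y_test Z_test XZ YZ _ \<rho> res]) (rule YZ0)
qed

section \<open>Bounds for the partition perimeter\<close>

lemma perimeter_ge:
  assumes "\<phi>\<^sub>1 \<in> test_functions" "\<phi>\<^sub>2 \<in> test_functions" "\<And>z. (\<phi>\<^sub>1 z)\<^sup>2 + (\<phi>\<^sub>2 z)\<^sup>2 \<le> 1"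
  shows "ereal (set_lebesgue_integral lebesgue E (grushin_div \<alpha> \<phi>\<^sub>1 \<phi>\<^sub>2)) \<le> grushin_perimeter \<alpha> E"
  unfolding grushin_perimeter_def using assms by (intro Sup_upper) (auto intro!: exI)

lemma perimeter_le:
  assumes "\<And>\<phi>\<^sub>1 \<phi>\<^sub>2. \<phi>\<^sub>1 \<in> test_functions \<Longrightarrow> \<phi>\<^sub>2 \<in> test_functions \<Longrightarrow> (\<And>z. (\<phi>\<^sub>1 z)\<^sup>2 + (\<phi>\<^sub>2 z)\<^sup>2 \<le> 1) \<Longrightarrow>
    set_lebesgue_integral lebesgue E (grushin_div \<alpha> \<phi>\<^sub>1 \<phi>\<^sub>2) \<le> c"
  shows "grushin_perimeter \<alpha> E \<le> ereal c"
  unfolding grushin_perimeter_def using assms by (intro Sup_least) auto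

lemma partition_perimeter_ge:
  assumes "ereal a \<le> grushin_perimeter \<alpha> (pos_x E)" "ereal b \<le> grushin_perimeter \<alpha> (neg_x E)"
    "ereal c \<le> grushin_perimeter \<alpha> E"
  shows "ereal ((a + b + c) / 2) \<le> partition_perimeter \<alpha> E"
proof -
  have "ereal a + ereal b + ereal c \<le> grushin_perimeter \<alpha> (pos_x E) + grushin_perimeter \<alpha> (neg_x E) + grushin_perimeter \<alpha> E"
    by (intro add_mono assms)
  hence "1 / 2 * (ereal a + ereal b + ereal c) \<le> partition_perimeter \<alpha> E"
    unfolding partition_perimeter_def by (intro ereal_mult_left_mono) auto
  moreover have "1 / 2 * (ereal a + ereal b + ereal c) = ereal ((a + b + c) / 2)"
    by (simp add: one_ereal_def numeral_eq_ereal)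
  ultimately show ?thesis by simp
qed

lemma partition_perimeter_le:
  assumes "grushin_perimeter \<alpha> (pos_x E) \<le> ereal a" "grushin_perimeter \<alpha> (neg_x E) \<le> ereal b"
    "grushin_perimeter \<alpha> E \<le> ereal c"
  shows "partition_perimeter \<alpha> E \<le> ereal ((a + b + c) / 2)"
proof -
  have "grushin_perimeter \<alpha> (pos_x E) + grushin_perimeter \<alpha> (neg_x E) + grushin_perimeter \<alpha> E \<le> ereal a + ereal b + ereal c"
    by (intro add_mono assms)
  hence "partition_perimeter \<alpha> E \<le> 1 / 2 * (ereal a + ereal b + ereal c)"
    unfolding partition_perimeter_def by (intro ereal_mult_left_mono) auto
  moreover have "1 / 2 * (ereal a + ereal b + ereal c) = ereal ((a + b + c) / 2)"
    by (simp add: one_ereal_def numeral_eq_ereal)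
  ultimately show ?thesis by simp
qed

lemma test_function_add:
  assumes "\<phi> \<in> test_functions" "\<psi> \<in> test_functions"
  shows "(\<lambda>z. \<phi> z + \<psi> z) \<in> test_functions"
    "partial_x (\<lambda>z. \<phi> z + \<psi> z) = (\<lambda>z. partial_x \<phi> z + partial_x \<psi> z)"
    "partial_y (\<lambda>z. \<phi> z + \<psi> z) = (\<lambda>z. partial_y \<phi> z + partial_y \<psi> z)"
proof -
  obtain R where R: "C1 \<phi> (partial_x \<phi>) (partial_y \<phi>)" "R > 0" "\<And>x y. \<bar>x\<bar> \<ge> R \<or> \<bar>y\<bar> \<ge> R \<Longrightarrow> \<phi> (x, y) = 0"
    using test_functionsE[OF assms(1)] by blast
  obtain R' where R': "C1 \<psi> (partial_x \<psi>) (partial_y \<psi>)" "R' > 0" "\<And>x y. \<bar>x\<bar> \<ge> R' \<or> \<bar>y\<bar> \<ge> R' \<Longrightarrow> \<psi> (x, y) = 0"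
    using test_functionsE[OF assms(2)] by blast
  note C = C1_add[OF R(1) R'(1)]
  show "(\<lambda>z. \<phi> z + \<psi> z) \<in> test_functions"
    by (rule test_functionsI_box[OF C, of "max R R'"]) (use R(3) R'(3) in auto)
  show "partial_x (\<lambda>z. \<phi> z + \<psi> z) = (\<lambda>z. partial_x \<phi> z + partial_x \<psi> z)"
    "partial_y (\<lambda>z. \<phi> z + \<psi> z) = (\<lambda>z. partial_y \<phi> z + partial_y \<psi> z)"
    using C1_partial_x[OF C] C1_partial_y[OF C] by auto
qed

lemma test_function_partials_zero:
  assumes "\<phi> \<in> test_functions" "open T" "\<And>z. z \<in> T \<Longrightarrow> \<phi> z = 0" "z \<in> T"
  shows "partial_x \<phi> z = 0" "partial_y \<phi> z = 0"
  using test_partial_zero assms test_functionsE by metis+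

text \<open>The left chamber is calibrated through its mirror image. The two chambers may receive
  different widths \<rho>, and each is compared separately with \<open>r\<close>. The sum of the two
  inner fields is admissible because they vanish on opposite sides of the line.\<close>

lemma partition_perimeter_lower_bound:
  assumes \<alpha>: "\<alpha> \<ge> 0" and v: "v > 0" and F: "F \<in> partition_class v"
  defines "\<kappa> \<equiv> integral {0..1} (\<lambda>x. grushin_weight \<alpha> x * cslope x)"
  assumes r: "r > 0" "v / 2 = 2 / 3 * (\<alpha> + 1) * \<kappa> * r powr (\<alpha> + 2)"
  shows "ereal (2 * (3 / (2 * r) * v + 2 * (r powr (\<alpha> + 1) * \<kappa>))) \<le> partition_perimeter \<alpha> F"
proof -
  define \<beta> where "\<beta> = 3 / (2 * r) * v + 2 * (r powr (\<alpha> + 1) * \<kappa>)"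
  have \<kappa>: "\<kappa> > 0" unfolding \<kappa>_def
    using unit_profile[OF \<alpha>] unit_profile_properties(2)[OF \<alpha>] by metis
  let ?\<rho> = "\<lambda>z :: real \<times> real. (- fst z, snd z)"
  have Fm: "F \<in> sets lebesgue" and Fp: "emeasure lebesgue (pos_x F) = ennreal v"
    and Fn: "emeasure lebesgue (neg_x F) = ennreal v"
    using F by (auto simp: partition_class_def)
  note m = pos_neg_measurable[OF Fm]
  define N where "N = ?\<rho> -` neg_x F"
  have N: "N \<in> sets lebesgue" "emeasure lebesgue N = ennreal v" "N \<subseteq> {z. fst z > 0}"
    using reflect_set[OF m(2)] Fn by (auto simp: N_def neg_x_def)
  have NN: "?\<rho> -` N = neg_x F" by (auto simp: N_def)
  have step: "ereal (2 * ((1 - e) * \<beta> - 2 * e)) \<le> partition_perimeter \<alpha> F" if e: "0 < e" "e < 1" for e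
  proof -
    \<comment> \<open>The loss \<open>1 - e\<close> affects only the area term. Shrinking the other
      term by the same factor makes \<open>optimal_width\<close> applicable.\<close>
    have bd: "(1 - e) * (3 / (2 * \<rho>) * v) + 2 * (\<rho> powr (\<alpha> + 1) * \<kappa>) - 2 * e \<ge> (1 - e) * \<beta> - 2 * e" if "\<rho> > 0" for \<rho>
    proof -
      have "(1 - e) * \<beta> \<le> (1 - e) * (3 / (2 * \<rho>) * v + 2 * (\<rho> powr (\<alpha> + 1) * \<kappa>))"
        unfolding \<beta>_def using e by (intro mult_left_mono optimal_width[OF \<alpha> r(1) that \<kappa> r(2)]) auto
      moreover have "(1 - e) * (2 * (\<rho> powr (\<alpha> + 1) * \<kappa>)) \<le> 1 * (2 * (\<rho> powr (\<alpha> + 1) * \<kappa>))"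
        using e \<kappa> by (intro mult_right_mono) auto
      ultimately show ?thesis by (simp add: distrib_left)
    qed
    obtain X Y Z \<rho> where R: "X \<in> test_functions" "Y \<in> test_functions" "Z \<in> test_functions"
      "\<And>z. (X z)\<^sup>2 + (Z z)\<^sup>2 \<le> 1" "\<And>z. (Y z)\<^sup>2 + (Z z)\<^sup>2 \<le> 1"
      "\<And>z. fst z \<le> 0 \<Longrightarrow> Y z = 0 \<and> Z z = 0" "\<rho> > 0"
      "set_lebesgue_integral lebesgue (pos_x F) (grushin_div \<alpha> X Z) + set_lebesgue_integral lebesgue (pos_x F) (grushin_div \<alpha> Y Z)
        \<ge> 2 * ((1 - e) * (3 / (2 * \<rho>) * v) + 2 * (\<rho> powr (\<alpha> + 1) * \<kappa>) - 2 * e)"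
      unfolding \<kappa>_def
    proof (rule calibration_fields[OF \<alpha> m(1) _ Fp v e], goal_cases)
      case (2 X Y Z \<rho>)
      show ?case by (rule 2(1)[OF 2(2-)])
    qed (auto simp: pos_x_def)
    obtain X' Y' Z' \<rho>' where L: "X' \<in> test_functions" "Y' \<in> test_functions" "Z' \<in> test_functions"
      "\<And>z. (X' z)\<^sup>2 + (Z' z)\<^sup>2 \<le> 1" "\<And>z. (Y' z)\<^sup>2 + (Z' z)\<^sup>2 \<le> 1"
      "\<And>z. fst z \<le> 0 \<Longrightarrow> Y' z = 0 \<and> Z' z = 0" "\<rho>' > 0"
      "set_lebesgue_integral lebesgue N (grushin_div \<alpha> X' Z') + set_lebesgue_integral lebesgue N (grushin_div \<alpha> Y' Z')
        \<ge> 2 * ((1 - e) * (3 / (2 * \<rho>') * v) + 2 * (\<rho>' powr (\<alpha> + 1) * \<kappa>) - 2 * e)"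
      unfolding \<kappa>_def
    proof (rule calibration_fields[OF \<alpha> N(1,3,2) v e], goal_cases)
      case (1 X Y Z \<rho>)
      show ?case by (rule 1(1)[OF 1(2-)])
    qed
    define XL where "XL = (\<lambda>z. - X' (?\<rho> z))"
    define YL where "YL = (\<lambda>z. - Y' (?\<rho> z))"
    define ZL where "ZL = (\<lambda>z. Z' (?\<rho> z))"
    have t: "XL \<in> test_functions" "YL \<in> test_functions" "ZL \<in> test_functions"
      unfolding XL_def YL_def ZL_def using L(1-3) reflect_test_function(1) test_function_uminus(1) by blast+
    have iX: "set_lebesgue_integral lebesgue (neg_x F) (grushin_div \<alpha> XL ZL) = set_lebesgue_integral lebesgue N (grushin_div \<alpha> X' Z')"
      using reflect_grushin_div[OF \<alpha> L(1,3) N(1)] unfolding NN XL_def ZL_def .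
    have iY: "set_lebesgue_integral lebesgue (neg_x F) (grushin_div \<alpha> YL ZL) = set_lebesgue_integral lebesgue N (grushin_div \<alpha> Y' Z')"
      using reflect_grushin_div[OF \<alpha> L(2,3) N(1)] unfolding NN YL_def ZL_def .
    define YS where "YS = (\<lambda>z. Y z + YL z)"
    define ZS where "ZS = (\<lambda>z. Z z + ZL z)"
    have tS: "YS \<in> test_functions" "ZS \<in> test_functions"
      unfolding YS_def ZS_def using test_function_add(1) R(2,3) t(2,3) by blast+
    have L0: "YL z = 0 \<and> ZL z = 0" if "fst z \<ge> 0" for z
      using L(6)[of "?\<rho> z"] that by (simp add: YL_def ZL_def)
    have op: "open {z :: real \<times> real. fst z > 0}" "open {z :: real \<times> real. fst z < 0}"
      by (intro open_Collect_less continuous_intros)+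
    have dS: "grushin_div \<alpha> YS ZS z = grushin_div \<alpha> Y Z z + grushin_div \<alpha> YL ZL z" for z
      unfolding grushin_div_def YS_def ZS_def test_function_add(2)[OF R(2) t(2)] test_function_add(3)[OF R(3) t(3)]
      by (simp add: algebra_simps)
    have dp: "grushin_div \<alpha> YS ZS z = grushin_div \<alpha> Y Z z" if "z \<in> pos_x F" for z
    proof -
      have "z \<in> {z. fst z > 0}" using that by (auto simp: pos_x_def)
      hence "grushin_div \<alpha> YL ZL z = 0"
        using test_function_partials_zero(1)[OF t(2) op(1)] test_function_partials_zero(2)[OF t(3) op(1)] L0
        by (simp add: grushin_div_def)
      thus ?thesis by (simp add: dS)
    qed
    have dn: "grushin_div \<alpha> YS ZS z = grushin_div \<alpha> YL ZL z" if "z \<in> neg_x F" for z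
    proof -
      have "z \<in> {z. fst z < 0}" using that by (auto simp: neg_x_def)
      hence "grushin_div \<alpha> Y Z z = 0"
        using test_function_partials_zero(1)[OF R(2) op(2)] test_function_partials_zero(2)[OF R(3) op(2)] R(6)
        by (simp add: grushin_div_def)
      thus ?thesis by (simp add: dS)
    qed
    have S1: "(YS z)\<^sup>2 + (ZS z)\<^sup>2 \<le> 1" for z
    proof (cases "fst z \<ge> 0")
      case True thus ?thesis using L0[OF True] R(5)[of z] by (simp add: YS_def ZS_def)
    next
      case False
      hence "YS z = YL z \<and> ZS z = ZL z" using R(6)[of z] by (simp add: YS_def ZS_def)
      thus ?thesis using L(5)[of "?\<rho> z"] by (simp add: YL_def ZL_def)
    qed
    have "set_lebesgue_integral lebesgue F (grushin_div \<alpha> YS ZS) =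
        set_lebesgue_integral lebesgue (pos_x F) (grushin_div \<alpha> YS ZS) + set_lebesgue_integral lebesgue (neg_x F) (grushin_div \<alpha> YS ZS)"
      by (rule integral_split_x[OF Fm set_integrable_grushin_div[OF \<alpha> tS Fm]])
    also have "set_lebesgue_integral lebesgue (pos_x F) (grushin_div \<alpha> YS ZS) = set_lebesgue_integral lebesgue (pos_x F) (grushin_div \<alpha> Y Z)"
      by (rule set_lebesgue_integral_cong) (use m dp in auto)
    also have "set_lebesgue_integral lebesgue (neg_x F) (grushin_div \<alpha> YS ZS) = set_lebesgue_integral lebesgue (neg_x F) (grushin_div \<alpha> YL ZL)"
      by (rule set_lebesgue_integral_cong) (use m dn in auto)
    finally have SF: "set_lebesgue_integral lebesgue F (grushin_div \<alpha> YS ZS) =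
        set_lebesgue_integral lebesgue (pos_x F) (grushin_div \<alpha> Y Z) + set_lebesgue_integral lebesgue N (grushin_div \<alpha> Y' Z')"
      unfolding iY .
    have XL1: "(XL z)\<^sup>2 + (ZL z)\<^sup>2 \<le> 1" for z using L(4)[of "?\<rho> z"] by (simp add: XL_def ZL_def)
    have "ereal ((set_lebesgue_integral lebesgue (pos_x F) (grushin_div \<alpha> X Z) + set_lebesgue_integral lebesgue N (grushin_div \<alpha> X' Z')
       + set_lebesgue_integral lebesgue F (grushin_div \<alpha> YS ZS)) / 2) \<le> partition_perimeter \<alpha> F"
      using perimeter_ge[OF R(1,3,4)] perimeter_ge[OF t(1,3) XL1, of "neg_x F" \<alpha>, unfolded iX] perimeter_ge[OF tS S1]
      by (rule partition_perimeter_ge)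
    moreover have "2 * ((1 - e) * \<beta> - 2 * e) \<le> (set_lebesgue_integral lebesgue (pos_x F) (grushin_div \<alpha> X Z) + set_lebesgue_integral lebesgue N (grushin_div \<alpha> X' Z')
       + set_lebesgue_integral lebesgue F (grushin_div \<alpha> YS ZS)) / 2"
    proof -
      have "2 * b \<le> (x + x' + (y + y')) / 2"
        if "2 * a \<le> x + y" "2 * a' \<le> x' + y'" "b \<le> a" "b \<le> a'" for a a' b x x' y y' :: real
        using that by (simp add: field_simps)
      from this[OF R(8) L(8) bd[OF R(7)] bd[OF L(7)]] show ?thesis unfolding SF .
    qed
    ultimately show ?thesis by (meson ereal_less_eq(3) order_trans)
  qed
  \<comment> \<open>The fields and the widths depend on \<open>e\<close> without any control as
    \<open>e\<close> tends to 0; only the inequality passes to the limit.\<close>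
  have "((\<lambda>e. ereal (2 * ((1 - e) * \<beta> - 2 * e))) \<longlongrightarrow> ereal (2 * ((1 - 0) * \<beta> - 2 * 0))) (at_right 0)"
    by (intro tendsto_intros)
  moreover have "\<forall>\<^sub>F e in at_right (0::real). ereal (2 * ((1 - e) * \<beta> - 2 * e)) \<le> partition_perimeter \<alpha> F"
    unfolding eventually_at_right_field by (intro exI[of _ 1] conjI allI impI step) auto
  ultimately have "ereal (2 * ((1 - 0) * \<beta> - 2 * 0)) \<le> partition_perimeter \<alpha> F"
    by (intro tendsto_upperbound[where F = "at_right (0::real)"]) auto
  thus ?thesis by (simp add: \<beta>_def)
qed

section \<open>The extremal set: its perimeter and its properties\<close>

text \<open>The strict inequalities make the vertical sections open, as Schwarz symmetry requires;
  the closed subgraph of the theorem differs from this set by a null set.\<close>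

definition full_region :: "(real \<Rightarrow> real) \<Rightarrow> real \<Rightarrow> (real \<times> real) set" where
  "full_region f r = {(x, y). \<bar>x\<bar> < r \<and> \<bar>y\<bar> < f \<bar>x\<bar>}"

lemma pos_x_full_region: "pos_x (full_region f r) = half_region f r"
  by (auto simp: pos_x_def full_region_def half_region_def)

lemma neg_x_full_region: "neg_x (full_region f r) = (\<lambda>z. (- fst z, snd z)) -` half_region f r"
proof (rule set_eqI)
  fix z :: "real \<times> real"
  obtain x y where z: "z = (x, y)" by (cases z)
  show "z \<in> neg_x (full_region f r) \<longleftrightarrow> z \<in> (\<lambda>z. (- fst z, snd z)) -` half_region f r"
    by (cases "x < 0") (simp_all add: z neg_x_def full_region_def half_region_def)
qed

lemma open_full_region:
  assumes "continuous_on {0..r} f"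
  shows "open (full_region f r)"
proof -
  have "continuous_on ({- r<..<r} \<times> UNIV) (\<lambda>z :: real \<times> real. f \<bar>fst z\<bar> - \<bar>snd z\<bar>)"
    by (intro continuous_intros continuous_on_compose2[OF assms]) auto
  hence "open (({- r<..<r} \<times> UNIV) \<inter> (\<lambda>z :: real \<times> real. f \<bar>fst z\<bar> - \<bar>snd z\<bar>) -` {0<..})"
    by (rule continuous_open_preimage) (auto intro: open_Times)
  also have "({- r<..<r} \<times> UNIV) \<inter> (\<lambda>z :: real \<times> real. f \<bar>fst z\<bar> - \<bar>snd z\<bar>) -` {0<..} = full_region f r"
    by (auto simp: full_region_def)
  finally show ?thesis .
qed

lemma bounded_full_region:
  assumes "continuous_on {0..r} f"
  shows "bounded (full_region f r)"
proof -
  obtain M where M: "M > 0" "\<And>x. 0 \<le> x \<Longrightarrow> x \<le> r \<Longrightarrow> \<bar>f x\<bar> \<le> M"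
  proof (rule bounded_half_region[OF assms], goal_cases)
    case (1 M)
    show ?case by (rule 1(1)[OF 1(2,3)])
  qed
  have "full_region f r \<subseteq> cbox (- r, - M) (r, M)"
  proof
    fix z assume "z \<in> full_region f r"
    hence "\<bar>fst z\<bar> \<le> r" "\<bar>snd z\<bar> \<le> f \<bar>fst z\<bar>" by (auto simp: full_region_def)
    moreover from this have "\<bar>snd z\<bar> \<le> M" using M(2)[of "\<bar>fst z\<bar>"] by simp
    ultimately show "z \<in> cbox (- r, - M) (r, M)"
      by (cases z) (simp add: cbox_Pair_eq abs_le_iff)
  qed
  thus ?thesis using bounded_cbox bounded_subset by blast
qed

text \<open>For one chamber the trace term is at most \<open>2 * f 0\<close>; for the whole set the
  traces from the two sides cancel. Half the sum of the three bounds is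
  \<open>2 * A + 2 * f 0\<close>, and \<open>f 0\<close> drops out because \<open>A\<close> contains
  \<open>- f 0\<close>, the contribution of the sine 1/2 at the line.\<close>

lemma partition_perimeter_full_region:
  assumes "\<alpha> \<ge> 0" "r > 0" "continuous_on {0..r} f" "f r = 0" "\<And>x. 0 \<le> x \<Longrightarrow> x < r \<Longrightarrow> 0 < f x"
    and f': "\<And>x. 0 < x \<Longrightarrow> x < r \<Longrightarrow>
      (f has_real_derivative grushin_weight \<alpha> x * slope (x / r) / cslope (x / r)) (at x)"
    and fi: "(f has_integral v / 2) {0..r}"
    and ki: "((\<lambda>x. grushin_weight \<alpha> x * cslope (x / r)) has_integral k) {0..r}"
  shows "partition_perimeter \<alpha> (full_region f r) \<le> ereal (2 * (3 / (2 * r) * v + 2 * k))"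
proof -
  let ?\<rho> = "\<lambda>z :: real \<times> real. (- fst z, snd z)"
  let ?H = "half_region f r"
  define A where "A = 2 * k - f 0 + 3 / (2 * r) * v"
  have Hm: "?H \<in> sets lebesgue" using open_half_region[OF assms(3)] by (auto intro: borel_open)
  have Em: "full_region f r \<in> sets lebesgue" using open_full_region[OF assms(3)] by (auto intro: borel_open)
  define tr where "tr = (\<lambda>\<phi> :: real \<times> real \<Rightarrow> real. integral {- f 0..f 0} (\<lambda>y. \<phi> (0, y)))"
  have GG: "set_lebesgue_integral lebesgue ?H (grushin_div \<alpha> \<phi>\<^sub>1 \<phi>\<^sub>2) \<le> A - tr \<phi>\<^sub>1"
    if "\<phi>\<^sub>1 \<in> test_functions" "\<phi>\<^sub>2 \<in> test_functions" "\<And>z. (\<phi>\<^sub>1 z)\<^sup>2 + (\<phi>\<^sub>2 z)\<^sup>2 \<le> 1" for \<phi>\<^sub>1 \<phi>\<^sub>2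
    unfolding A_def tr_def by (rule gauss_green_half_region[OF assms(1-5) f' fi ki that])
  have f0: "f 0 > 0" using assms(2,5) by simp
  have ci: "(\<lambda>y. \<phi> (0, y)) integrable_on {- f 0..f 0}" if \<phi>: "\<phi> \<in> test_functions" for \<phi> :: "real \<times> real \<Rightarrow> real"
  proof -
    have c: "continuous_on UNIV \<phi>" by (rule test_functionsE[OF \<phi>]) (rule C1_continuous)
    show ?thesis by (intro integrable_continuous_interval continuous_on_compose2[OF c] continuous_intros) auto
  qed
  have trb: "- tr \<phi>\<^sub>1 \<le> 2 * f 0" if "\<phi>\<^sub>1 \<in> test_functions" "\<And>z. (\<phi>\<^sub>1 z)\<^sup>2 + (\<phi>\<^sub>2 z)\<^sup>2 \<le> 1" for \<phi>\<^sub>1 \<phi>\<^sub>2 :: "real \<times> real \<Rightarrow> real"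
  proof -
    have "- 1 \<le> \<phi>\<^sub>1 z" for z
    proof -
      have "(\<phi>\<^sub>1 z)\<^sup>2 \<le> 1" using that(2)[of z] zero_le_power2[of "\<phi>\<^sub>2 z"] by linarith
      thus ?thesis by (simp add: abs_square_le_1 abs_le_iff)
    qed
    hence "integral {- f 0..f 0} (\<lambda>_. - 1) \<le> tr \<phi>\<^sub>1"
      unfolding tr_def by (intro integral_le[OF integrable_const_ivl ci[OF that(1)]])
    thus ?thesis using f0 by simp
  qed
  have refl: "set_lebesgue_integral lebesgue (?\<rho> -` ?H) (grushin_div \<alpha> \<phi>\<^sub>1 \<phi>\<^sub>2)
      = set_lebesgue_integral lebesgue ?H (grushin_div \<alpha> (\<lambda>z. - \<phi>\<^sub>1 (?\<rho> z)) (\<lambda>z. \<phi>\<^sub>2 (?\<rho> z)))"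
    and reflt: "(\<lambda>z. - \<phi>\<^sub>1 (?\<rho> z)) \<in> test_functions" "(\<lambda>z. \<phi>\<^sub>2 (?\<rho> z)) \<in> test_functions"
    if "\<phi>\<^sub>1 \<in> test_functions" "\<phi>\<^sub>2 \<in> test_functions" for \<phi>\<^sub>1 \<phi>\<^sub>2
  proof -
    show "(\<lambda>z. - \<phi>\<^sub>1 (?\<rho> z)) \<in> test_functions" "(\<lambda>z. \<phi>\<^sub>2 (?\<rho> z)) \<in> test_functions"
      using that reflect_test_function(1) test_function_uminus(1) by blast+
    have "?\<rho> -` (?\<rho> -` ?H) = ?H" by auto
    thus "set_lebesgue_integral lebesgue (?\<rho> -` ?H) (grushin_div \<alpha> \<phi>\<^sub>1 \<phi>\<^sub>2)
      = set_lebesgue_integral lebesgue ?H (grushin_div \<alpha> (\<lambda>z. - \<phi>\<^sub>1 (?\<rho> z)) (\<lambda>z. \<phi>\<^sub>2 (?\<rho> z)))"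
      using reflect_grushin_div[OF assms(1) that reflect_set(1)[OF Hm]] by simp
  qed
  have trr: "tr (\<lambda>z. - \<phi> (?\<rho> z)) = - tr \<phi>" for \<phi> by (simp add: tr_def)
  have "grushin_perimeter \<alpha> ?H \<le> ereal (A + 2 * f 0)"
  proof (rule perimeter_le)
    fix \<phi>\<^sub>1 \<phi>\<^sub>2 :: "real \<times> real \<Rightarrow> real"
    assume t: "\<phi>\<^sub>1 \<in> test_functions" "\<phi>\<^sub>2 \<in> test_functions" "\<And>z. (\<phi>\<^sub>1 z)\<^sup>2 + (\<phi>\<^sub>2 z)\<^sup>2 \<le> 1"
    show "set_lebesgue_integral lebesgue ?H (grushin_div \<alpha> \<phi>\<^sub>1 \<phi>\<^sub>2) \<le> A + 2 * f 0"
      using GG[OF t] trb[OF t(1,3)] by linarith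
  qed
  moreover have "grushin_perimeter \<alpha> (?\<rho> -` ?H) \<le> ereal (A + 2 * f 0)"
  proof (rule perimeter_le)
    fix \<phi>\<^sub>1 \<phi>\<^sub>2 :: "real \<times> real \<Rightarrow> real"
    assume t: "\<phi>\<^sub>1 \<in> test_functions" "\<phi>\<^sub>2 \<in> test_functions" "\<And>z. (\<phi>\<^sub>1 z)\<^sup>2 + (\<phi>\<^sub>2 z)\<^sup>2 \<le> 1"
    have t': "(- \<phi>\<^sub>1 (?\<rho> z))\<^sup>2 + (\<phi>\<^sub>2 (?\<rho> z))\<^sup>2 \<le> 1" for z using t(3) by simp
    show "set_lebesgue_integral lebesgue (?\<rho> -` ?H) (grushin_div \<alpha> \<phi>\<^sub>1 \<phi>\<^sub>2) \<le> A + 2 * f 0"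
      unfolding refl[OF t(1,2)] using GG[OF reflt[OF t(1,2)] t'] trb[OF reflt(1)[OF t(1,2)] t'] by linarith
  qed
  moreover have "grushin_perimeter \<alpha> (full_region f r) \<le> ereal (2 * A)"
  proof (rule perimeter_le)
    fix \<phi>\<^sub>1 \<phi>\<^sub>2 :: "real \<times> real \<Rightarrow> real"
    assume t: "\<phi>\<^sub>1 \<in> test_functions" "\<phi>\<^sub>2 \<in> test_functions" "\<And>z. (\<phi>\<^sub>1 z)\<^sup>2 + (\<phi>\<^sub>2 z)\<^sup>2 \<le> 1"
    have t': "(- \<phi>\<^sub>1 (?\<rho> z))\<^sup>2 + (\<phi>\<^sub>2 (?\<rho> z))\<^sup>2 \<le> 1" for z using t(3) by simp
    show "set_lebesgue_integral lebesgue (full_region f r) (grushin_div \<alpha> \<phi>\<^sub>1 \<phi>\<^sub>2) \<le> 2 * A"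
      unfolding integral_split_x[OF Em set_integrable_grushin_div[OF assms(1) t(1,2) Em]]
        pos_x_full_region neg_x_full_region refl[OF t(1,2)]
      using GG[OF t] GG[OF reflt[OF t(1,2)] t'] unfolding trr by linarith
  qed
  ultimately have "partition_perimeter \<alpha> (full_region f r) \<le> ereal ((A + 2 * f 0 + (A + 2 * f 0) + 2 * A) / 2)"
    by (intro partition_perimeter_le) (simp_all add: pos_x_full_region neg_x_full_region)
  also have "(A + 2 * f 0 + (A + 2 * f 0) + 2 * A) / 2 = 2 * (3 / (2 * r) * v + 2 * k)"
    by (simp add: A_def field_simps)
  finally show ?thesis .
qed

section \<open>Existence of a minimiser\<close>

text \<open>The difference lies in a closed set whose vertical sections have at most two points, so
  Fubini applies. At \<open>\<bar>x\<bar> = r\<close> there is no vertical edge, since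
  \<open>f r = 0\<close>.\<close>

lemma null_sets_full_region_boundary:
  assumes "continuous_on {0..r} f" "f r = 0"
  shows "eq_up_to_null (full_region f r) {(x, y). \<bar>y\<bar> \<le> f \<bar>x\<bar> \<and> \<bar>x\<bar> \<le> r}"
proof -
  define T where "T = ({- r..r} \<times> UNIV) \<inter> (\<lambda>z :: real \<times> real. f \<bar>fst z\<bar> - \<bar>snd z\<bar>) -` {0}"
  have "continuous_on ({- r..r} \<times> UNIV) (\<lambda>z :: real \<times> real. f \<bar>fst z\<bar> - \<bar>snd z\<bar>)"
    by (intro continuous_intros continuous_on_compose2[OF assms(1)]) auto
  hence "closed T"
    unfolding T_def by (rule continuous_closed_preimage) (auto intro: closed_Times)
  hence Tb: "T \<in> sets borel" by (rule borel_closed)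
  hence "T \<in> sets (lborel \<Otimes>\<^sub>M lborel)" unfolding lborel_prod by simp
  hence "emeasure (lborel \<Otimes>\<^sub>M lborel) T = (\<integral>\<^sup>+ x. emeasure lborel (Pair x -` T) \<partial>lborel)"
    by (rule lborel.emeasure_pair_measure_alt)
  also have "\<dots> = (\<integral>\<^sup>+ (x :: real). 0 \<partial>lborel)"
  proof (rule nn_integral_cong)
    fix x :: real
    have "Pair x -` T \<subseteq> {f \<bar>x\<bar>, - f \<bar>x\<bar>}" by (auto simp: T_def)
    hence "finite (Pair x -` T)" using finite_subset by blast
    thus "emeasure lborel (Pair x -` T) = 0" using finite_imp_null_set_lborel by blast
  qed
  finally have "T \<in> null_sets lborel" using Tb by (simp add: lborel_prod null_setsI)
  hence T: "T \<in> null_sets lebesgue" by (rule null_sets_completionI)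
  have "sym_diff (full_region f r) {(x, y). \<bar>y\<bar> \<le> f \<bar>x\<bar> \<and> \<bar>x\<bar> \<le> r} \<subseteq> T"
  proof
    fix z assume z: "z \<in> sym_diff (full_region f r) {(x, y). \<bar>y\<bar> \<le> f \<bar>x\<bar> \<and> \<bar>x\<bar> \<le> r}"
    obtain x y where xy: "z = (x, y)" by (cases z)
    have "\<bar>y\<bar> \<le> f \<bar>x\<bar> \<and> \<bar>x\<bar> \<le> r \<and> \<not> (\<bar>x\<bar> < r \<and> \<bar>y\<bar> < f \<bar>x\<bar>)"
      using z by (auto simp: xy full_region_def)
    moreover have "\<bar>y\<bar> = f \<bar>x\<bar>" if "\<bar>x\<bar> = r" "\<bar>y\<bar> \<le> f \<bar>x\<bar>" using that assms(2) by simp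
    ultimately have "\<bar>y\<bar> = f \<bar>x\<bar>" "\<bar>x\<bar> \<le> r" by force+
    thus "z \<in> T" by (simp add: T_def xy abs_le_iff)
  qed
  moreover have "sym_diff (full_region f r) {(x, y). \<bar>y\<bar> \<le> f \<bar>x\<bar> \<and> \<bar>x\<bar> \<le> r} \<in> sets lebesgue"
    using T calculation completion.complete2[of _ T lborel] by (auto simp: null_sets_def)
  ultimately show ?thesis
    unfolding eq_up_to_null_def using T null_sets_subset by blast
qed

lemma full_region_schwarz:
  assumes "continuous_on {0..r} f"
  shows "full_region f r \<in> y_schwarz_symmetric_sets"
proof -
  have "full_region f r \<in> sets lebesgue" using open_full_region[OF assms] by (auto intro: borel_open)
  moreover have "{y. (t, y) \<in> full_region f r} = (if \<bar>t\<bar> < r then {- f \<bar>t\<bar><..<f \<bar>t\<bar>} else {})" for t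
    by (auto simp: full_region_def abs_less_iff)
  ultimately show ?thesis
    by (auto simp: y_schwarz_symmetric_sets_def full_region_def is_interval_oo)
qed

lemma full_region_x_symmetric:
  assumes "continuous_on {0..r} f"
  shows "full_region f r \<in> x_symmetric_sets"
  using open_full_region[OF assms] by (auto simp: x_symmetric_sets_def full_region_def intro: borel_open)

lemma full_region_partition_class:
  assumes "continuous_on {0..r} f" "\<And>x. 0 \<le> x \<Longrightarrow> x < r \<Longrightarrow> 0 < f x" "(f has_integral v / 2) {0..r}"
  shows "full_region f r \<in> partition_class v"
proof -
  note H = half_region_measure[OF assms]
  show ?thesis
    using open_full_region[OF assms(1)] H(2) reflect_set(2)[OF H(1)]
    by (auto simp: partition_class_def pos_x_full_region neg_x_full_region intro: borel_open)
qed

text \<open>The tangent is increasing in the sine: for nonnegative sines the numerator grows while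
  the denominator shrinks, and oddness gives the remaining signs.\<close>

lemma sine_to_tangent_mono:
  fixes a b :: real
  assumes "- 1 < a" "a \<le> b" "b < 1"
  shows "a / sqrt (1 - a\<^sup>2) \<le> b / sqrt (1 - b\<^sup>2)"
proof -
  have pos: "0 < sqrt (1 - c\<^sup>2)" if "- 1 < c" "c < 1" for c :: real
    using that by (simp add: abs_square_less_1 abs_less_iff)
  have nn: "x / sqrt (1 - x\<^sup>2) \<le> y / sqrt (1 - y\<^sup>2)" if "0 \<le> x" "x \<le> y" "y < 1" for x y :: real
  proof -
    have "x\<^sup>2 \<le> y\<^sup>2" using that by (intro power_mono) auto
    thus ?thesis using that pos[of y] by (intro frac_le) auto
  qed
  show ?thesis
  proof (cases "0 \<le> a \<or> b \<le> 0")
    case True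
    thus ?thesis using nn[of a b] nn[of "- b" "- a"] assms by auto
  next
    case False
    hence "a / sqrt (1 - a\<^sup>2) \<le> 0" "0 \<le> b / sqrt (1 - b\<^sup>2)"
      using pos[of a] pos[of b] assms by (auto intro: divide_nonpos_pos divide_nonneg_pos)
    thus ?thesis by linarith
  qed
qed

lemma convex_strict_subgraph:
  fixes g :: "real \<Rightarrow> real"
  assumes "convex_on {0<..<c} (\<lambda>x. - g x)"
  shows "convex {(x, y). 0 < x \<and> x < c \<and> \<bar>y\<bar> < g x}"
proof (rule convexI)
  fix p q :: "real \<times> real" and u v :: real
  assume p: "p \<in> {(x, y). 0 < x \<and> x < c \<and> \<bar>y\<bar> < g x}" and q: "q \<in> {(x, y). 0 < x \<and> x < c \<and> \<bar>y\<bar> < g x}"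
    and uv: "0 \<le> u" "0 \<le> v" "u + v = 1"
  obtain x y where xy: "p = (x, y)" "0 < x" "x < c" "\<bar>y\<bar> < g x" using p by (cases p) auto
  obtain x' y' where xy': "q = (x', y')" "0 < x'" "x' < c" "\<bar>y'\<bar> < g x'" using q by (cases q) auto
  have dom: "u * x + v * x' \<in> {0<..<c}"
    using convexD[of "{0<..<c}" x x' u v] xy xy' uv by simp
  have "- g (u * x + v * x') \<le> u * - g x + v * - g x'"
    using convex_onD_Icc assms uv xy xy' by (simp add: convex_on_def)
  moreover have "\<bar>u * y + v * y'\<bar> \<le> u * \<bar>y\<bar> + v * \<bar>y'\<bar>"
    using abs_triangle_ineq[of "u * y" "v * y'"] uv by (simp add: abs_mult)
  moreover have "u * \<bar>y\<bar> + v * \<bar>y'\<bar> < u * g x + v * g x'"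
  proof (cases "u = 0")
    case True thus ?thesis using uv xy'(4) by simp
  next
    case False
    thus ?thesis using uv xy(4) xy'(4) by (intro add_less_le_mono mult_strict_left_mono mult_left_mono) auto
  qed
  ultimately have "\<bar>u * y + v * y'\<bar> < g (u * x + v * x')" by linarith
  thus "u *\<^sub>R p + v *\<^sub>R q \<in> {(x, y). 0 < x \<and> x < c \<and> \<bar>y\<bar> < g x}"
    using dom by (simp add: xy(1) xy'(1))
qed

text \<open>In the coordinates of \<open>Psi\<close> the weight cancels, because the inverse change
  of variable \<open>X\<close> has derivative \<open>1 / w\<close>. The boundary then has derivative
  \<open>slope / cslope\<close>, the tangent of an angle whose sine decreases, so the graph is
  concave.\<close>

lemma full_region_transformed_convex:
  assumes "\<alpha> \<ge> 0" "r > 0" "continuous_on {0..r} f"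
    and f': "\<And>x. 0 < x \<Longrightarrow> x < r \<Longrightarrow>
      (f has_real_derivative grushin_weight \<alpha> x * slope (x / r) / cslope (x / r)) (at x)"
  shows "x_transformed_convex \<alpha> (full_region f r)"
proof -
  define P where "P = (\<lambda>x. x powr (\<alpha> + 1) / (\<alpha> + 1))"
  define X where "X = (\<lambda>t. ((\<alpha> + 1) * t) powr (1 / (\<alpha> + 1)))"
  have PX: "P (X t) = t" if "t > 0" for t
    using that assms(1) by (simp add: P_def X_def powr_powr)
  have XP: "X (P x) = x" if "x > 0" for x
    using that assms(1) by (simp add: P_def X_def powr_powr)
  have Xpos: "X t > 0" if "t > 0" for t using that assms(1) by (simp add: X_def)
  have Ppos: "P x > 0" if "x > 0" for x using that assms(1) by (simp add: P_def)
  have Xmono: "X s \<le> X t" if "0 < s" "s \<le> t" for s t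
    unfolding X_def using that assms(1) by (intro powr_mono2 mult_left_mono) auto
  have Xless: "X t < r" if "0 < t" "t < P r" for t
  proof -
    have "X t \<le> r" using Xmono[of t "P r"] that XP[OF assms(2)] by simp
    moreover have "X t \<noteq> r" using PX[OF that(1)] that(2) by auto
    ultimately show ?thesis by simp
  qed
  have Pless: "P x < P r" if "0 < x" "x < r" for x
    unfolding P_def using that assms(1) by (intro divide_strict_right_mono powr_less_mono2) auto
  have "convex_on {0<..<P r} (\<lambda>t. - f (X t))"
  proof (rule convex_on_realI)
    show "connected {0<..<P r}" by simp
    fix t assume t: "t \<in> {0<..<P r}"
    have XX: "0 < X t" "X t < r" using t Xpos Xless by auto
    have "(X has_real_derivative 1 / (\<alpha> + 1) * ((\<alpha> + 1) * t) powr (1 / (\<alpha> + 1) - 1) * ((\<alpha> + 1) * 1)) (at t)"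
      unfolding X_def using t assms(1)
      by (intro DERIV_chain2[OF has_real_derivative_powr] DERIV_cmult DERIV_ident) auto
    also have "1 / (\<alpha> + 1) * ((\<alpha> + 1) * t) powr (1 / (\<alpha> + 1) - 1) * ((\<alpha> + 1) * 1) = ((\<alpha> + 1) * t) powr (1 / (\<alpha> + 1) - 1)"
      using assms(1) by simp
    also have "\<dots> = 1 / grushin_weight \<alpha> (X t)"
    proof -
      have "grushin_weight \<alpha> (X t) = ((\<alpha> + 1) * t) powr (\<alpha> / (\<alpha> + 1))"
        using XX by (simp add: weight_eq_powr) (simp add: X_def powr_powr)
      moreover have "1 / (\<alpha> + 1) - 1 = - (\<alpha> / (\<alpha> + 1))" using assms(1) by (simp add: field_simps)
      ultimately show ?thesis by (simp add: powr_minus_divide)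
    qed
    finally have X': "(X has_real_derivative 1 / grushin_weight \<alpha> (X t)) (at t)" .
    have "((\<lambda>t. - f (X t)) has_real_derivative
        - (grushin_weight \<alpha> (X t) * slope (X t / r) / cslope (X t / r) * (1 / grushin_weight \<alpha> (X t)))) (at t)"
      by (intro DERIV_minus DERIV_chain2[OF f'[OF XX] X'])
    also have "- (grushin_weight \<alpha> (X t) * slope (X t / r) / cslope (X t / r) * (1 / grushin_weight \<alpha> (X t)))
        = - (slope (X t / r) / cslope (X t / r))"
      using weight_pos[of "X t" \<alpha>] XX by simp
    finally show "((\<lambda>t. - f (X t)) has_real_derivative - (slope (X t / r) / cslope (X t / r))) (at t)" .
  next
    fix s t assume st: "s \<in> {0<..<P r}" "t \<in> {0<..<P r}" "s \<le> t"
    have S: "0 < X s" "X s < r" "0 < X t" "X t < r" "X s \<le> X t" using st Xpos Xless Xmono by auto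
    have "slope (X t / r) \<le> slope (X s / r)"
      using S assms(2) by (simp add: slope_def divide_right_mono)
    moreover have "- 1 < slope (X t / r)" "slope (X s / r) < 1"
      using slope_abs[of "X t / r"] slope_abs[of "X s / r"] S by auto
    ultimately have "slope (X t / r) / cslope (X t / r) \<le> slope (X s / r) / cslope (X s / r)"
      unfolding cslope_def by (intro sine_to_tangent_mono)
    thus "- (slope (X s / r) / cslope (X s / r)) \<le> - (slope (X t / r) / cslope (X t / r))" by simp
  qed
  hence "convex {(t, y). 0 < t \<and> t < P r \<and> \<bar>y\<bar> < f (X t)}" by (rule convex_strict_subgraph)
  also have "{(t, y). 0 < t \<and> t < P r \<and> \<bar>y\<bar> < f (X t)} = Psi \<alpha> ` half_region f r"
  proof (intro set_eqI iffI)
    fix z assume "z \<in> {(t, y). 0 < t \<and> t < P r \<and> \<bar>y\<bar> < f (X t)}"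
    then obtain t y where z: "z = (t, y)" "0 < t" "t < P r" "\<bar>y\<bar> < f (X t)" by auto
    have "Psi \<alpha> (X t, y) = z" using PX[OF z(2)] Xpos[OF z(2)] by (simp add: Psi_def z(1) P_def)
    moreover have "(X t, y) \<in> half_region f r" using Xpos Xless z by (simp add: half_region_def)
    ultimately show "z \<in> Psi \<alpha> ` half_region f r" by force
  next
    fix z assume "z \<in> Psi \<alpha> ` half_region f r"
    then obtain x y where z: "z = Psi \<alpha> (x, y)" "0 < x" "x < r" "\<bar>y\<bar> < f x" by (auto simp: half_region_def)
    have "z = (P x, y)" using z by (simp add: Psi_def P_def)
    thus "z \<in> {(t, y). 0 < t \<and> t < P r \<and> \<bar>y\<bar> < f (X t)}" using z XP Ppos Pless by simp
  qed
  finally show ?thesis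
    unfolding x_transformed_convex_def pos_x_full_region using full_region_x_symmetric[OF assms(3)] by blast
qed

text \<open>A compact \<open>K\<close> may be disconnected, so the derivative is bounded on the
  whole interval between its extreme points, where the mean value inequality is available.\<close>

lemma locally_lipschitz_onI_DERIV:
  assumes "\<And>x. a < x \<Longrightarrow> x < b \<Longrightarrow> (f has_real_derivative f' x) (at x)" "continuous_on {a<..<b} f'"
  shows "locally_lipschitz_on {a<..<b} f"
  unfolding locally_lipschitz_on_def
proof (intro allI impI)
  fix K assume K: "compact K \<and> K \<subseteq> {a<..<b}"
  show "\<exists>L. L-lipschitz_on K f"
  proof (cases "K = {}")
    case True
    thus ?thesis using lipschitz_on_empty by (metis order_refl)
  next
    case False
    obtain c where c: "c \<in> K" "\<And>x. x \<in> K \<Longrightarrow> c \<le> x" using compact_attains_inf[of K] K False by blast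
    obtain d where d: "d \<in> K" "\<And>x. x \<in> K \<Longrightarrow> x \<le> d" using compact_attains_sup[of K] K False by blast
    have cd: "{c..d} \<subseteq> {a<..<b}" using c(1) d(1) K by force
    have "compact (f' ` {c..d})"
      by (intro compact_continuous_image continuous_on_subset[OF assms(2) cd] compact_Icc)
    then obtain L where L: "L > 0" "\<And>x. x \<in> {c..d} \<Longrightarrow> \<bar>f' x\<bar> \<le> L"
      by (metis bounded_pos compact_imp_bounded image_eqI real_norm_def)
    have "L-lipschitz_on {c..d} f"
    proof (rule bounded_derivative_imp_lipschitz)
      fix x assume x: "x \<in> {c..d}"
      have "x \<in> {a<..<b}" using x cd by blast
      hence "(f has_real_derivative f' x) (at x within {c..d})"
        using assms(1) by (auto intro: has_field_derivative_at_within)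
      thus "(f has_derivative (*) (f' x)) (at x within {c..d})" by (simp add: has_field_derivative_def)
      show "onorm ((*) (f' x)) \<le> L"
        using L(2)[OF x] by (intro onorm_le) (auto simp: abs_mult mult_right_mono)
    qed (use L(1) in auto)
    moreover have "K \<subseteq> {c..d}" using c(2) d(2) by auto
    ultimately show ?thesis using lipschitz_on_subset by blast
  qed
qed

theorem theorem4p2:
  fixes \<alpha> v :: real
  assumes "\<alpha> \<ge> 0" and "v > 0"
  shows "\<exists>E \<in> partition_class v \<inter> x_symmetric_sets \<inter> y_schwarz_symmetric_sets.
    bounded E \<and> x_transformed_convex \<alpha> E \<and>
    partition_perimeter \<alpha> E = (INF F \<in> partition_class v. partition_perimeter \<alpha> F) \<and>
    (\<exists>r > 0. \<exists>f :: real \<Rightarrow> real.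
       continuous_on {0..r} f \<and> locally_lipschitz_on {0<..<r} f \<and>
       eq_up_to_null E {(x, y). \<bar>y\<bar> \<le> f \<bar>x\<bar> \<and> \<bar>x\<bar> \<le> r})"
proof (rule model_profile[OF assms])
  fix r f
  let ?w = "grushin_weight \<alpha>"
  define \<kappa> where "\<kappa> = integral {0..1} (\<lambda>x. ?w x * cslope x)"
  assume r: "r > 0" and fc: "continuous_on {0..r} f" and fr: "f r = 0" and fpos: "\<And>x. 0 \<le> x \<Longrightarrow> x < r \<Longrightarrow> 0 < f x"
    and f': "\<And>x. 0 < x \<Longrightarrow> x < r \<Longrightarrow> (f has_real_derivative ?w x * slope (x / r) / cslope (x / r)) (at x)"
    and fi: "(f has_integral v / 2) {0..r}"
    and ki: "((\<lambda>x. ?w x * cslope (x / r)) has_integral r powr (\<alpha> + 1) * integral {0..1} (\<lambda>x. ?w x * cslope x)) {0..r}"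
    and v: "v / 2 = 2 / 3 * (\<alpha> + 1) * integral {0..1} (\<lambda>x. ?w x * cslope x) * r powr (\<alpha> + 2)"
  let ?E = "full_region f r"
  have E: "?E \<in> partition_class v" by (rule full_region_partition_class[OF fc fpos fi])
  have "partition_perimeter \<alpha> ?E = (INF F \<in> partition_class v. partition_perimeter \<alpha> F)"
  proof (rule antisym)
    \<comment> \<open>The upper bound for \<open>?E\<close> and the lower bound for every competitor
      are the same number, so the infimum is attained without passing to a limit of minimising
      sets.\<close>
    show "partition_perimeter \<alpha> ?E \<le> (INF F \<in> partition_class v. partition_perimeter \<alpha> F)"
      using partition_perimeter_full_region[OF assms(1) r fc fr fpos f' fi ki]
        partition_perimeter_lower_bound[OF assms _ r v]
      by (intro INF_greatest) (rule order_trans)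
    show "(INF F \<in> partition_class v. partition_perimeter \<alpha> F) \<le> partition_perimeter \<alpha> ?E"
      by (rule INF_lower[OF E])
  qed
  moreover have "locally_lipschitz_on {0<..<r} f"
  proof (rule locally_lipschitz_onI_DERIV[OF f'])
    have "cslope (x / r) \<noteq> 0" if "x \<in> {0<..<r}" for x
      using cslope_pos[of "x / r"] that by auto
    thus "continuous_on {0<..<r} (\<lambda>x. ?w x * slope (x / r) / cslope (x / r))"
      using r by (intro continuous_intros continuous_on_weight assms(1)) auto
  qed auto
  ultimately show ?thesis
    using E full_region_x_symmetric[OF fc] full_region_schwarz[OF fc] bounded_full_region[OF fc]
      full_region_transformed_convex[OF assms(1) r fc f'] null_sets_full_region_boundary[OF fc fr] fc r
    by blast
qed

end
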